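(* Let $\mathsf{k}$ be a field, $E$ a sandpile graph and $S_E$ the set of vertices in $E$ which do not connect to any cycle. Then the following statements are equivalent: (1) $\mathrm{SP}(E)$ has exactly two idempotents; (2) the Leavitt path algebra $L_{\mathsf{k}}(E/S_E)$ is either isomorphic to $\mathbb{M}_n(\mathsf{k}[x,x^{-1}])$ for some $n\in\mathbb{N}^+$ or purely infinite simple; (3) the weighted Leavitt path algebra $L_{\mathsf{k}}(E/S_E,\omega_r)$ is vertex-simple.
   Context: Graphs are directed: $E=(E^0,E^1,s,r)$ with source and range maps $s,r:E^1\to E^0$; the empty graph is allowed. A sink is a vertex emitting no edges; a vertex is regular if it is not a sink and emits only finitely many edges; $E^0_{\mathrm{reg}}$ is the set of regular vertices. Vertices are paths of length $0$. A cycle is a closed path $e_1\cdots e_n$ ($n\ge 1$) with $s(e_i)\ne s(e_j)$ for $i\neq j$; a vertex connects to a cycle if there is a path from it to a vertex of the cycle. A sandpile graph is a finite directed graph with a unique sink (also denoted $s$) such that from every vertex there is a path to $s$. Its sandpile monoid is the commutative monoid $$\mathrm{SP}(E)=\langle v\mid v\in E^0\rangle\big/\big\langle s=0;\ |s^{-1}(v)|\,v=\textstyle\sum_{e\in s^{-1}(v)}r(e)\ \text{for all } v\in E^0\setminus\{s\}\big\rangle,$$ the quotient of the free commutative monoid on $E^0$ by the congruence generated by these relations. $H\subseteq E^0$ is hereditary if $s(e)\in H$ implies $r(e)\in H$ for all $e\in E^1$. For hereditary $H$, the quotient graph $E/H$ has $(E/H)^0=E^0\setminus H$, $(E/H)^1=\{e\in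 E^1\mid r(e)\notin H\}$ with restricted source and range maps. ($S_E$ is hereditary.) A weighted graph is a graph with a map $\omega:E^1\to\{1,2,\dots\}$; for a regular vertex $v$, $\omega(v)=\max\{\omega(e)\mid e\in s^{-1}(v)\}$. The balanced weighted graph associated with $E$ is $(E,\omega)$ with $\omega(e)=|s^{-1}(v)|$ for all $v\in E^0_{\mathrm{reg}}$ and $e\in s^{-1}(v)$. $\omega_r$ denotes the restriction of this weight function $\omega$ to the edges of $E/S_E$. For a row-finite weighted graph $(E,\omega)$ (each vertex emits finitely many edges), the weighted Leavitt path algebra $L_{\mathsf{k}}(E,\omega)$ is the $\mathsf{k}$-algebra generated by $\{v,e_i,e_i^*\mid v\in E^0,e\in E^1,1\le i\le\omega(e)\}$ subject to: (i) $uv=\delta_{uv}u$ for $u,v\in E^0$; (ii) $s(e)e_i=e_i=e_ir(e)$, $r(e)e_i^*=e_i^*=e_i^*s(e)$; (iii) $\sum_{e\in s^{-1}(v)}e_ie_j^*=\delta_{ij}v$ for $v\in E^0_{\mathrm{reg}}$, $1\le i,j\le\omega(v)$; (iv) $\sum_{1\le i\le\omega(v)}e_i^*f_i=\delta_{ef}r(e)$ for $v\in E^0_{\mathrm{reg}}$, $e,f\in s^{-1}(v)$; where $e_i,e_i^*$ are set to $0$ if $i>\omega(e)$. The Leavitt path algebra $L_{\mathsf{k}}(E)$ is the case where all weights are $1$. $\mathcal{L}_{\mathrm{ver}}(L_{\mathsf{k}}(E,\omega))$ is the set of all ideals of $L_{\mathsf{k}}(E,\omega)$ generated by a nonempty set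 of vertices. $L_{\mathsf{k}}(E,\omega)$ is vertex-simple if $\mathcal{L}_{\mathrm{ver}}(L_{\mathsf{k}}(E,\omega))=\{L_{\mathsf{k}}(E,\omega)\}$. A ring is purely infinite simple if it is simple and every nonzero one-sided (right) ideal contains an infinite idempotent. *)

theory Defs
  imports
    "Graph_Theory.Arc_Walk"
    "HOL-Library.Multiset"
    "HOL-Library.Poly_Mapping"
    "HOL-Library.FuncSet"
    "HOL-Algebra.QuotRing"
    "HOL-Algebra.Module"
    "Jordan_Normal_Form.Matrix"
begin

section \<open>Graphs\<close>

text \<open>Source and range of an edge are \<^const>\<open>tail\<close> and \<^const>\<open>head\<close>;
  \<^const>\<open>out_arcs\<close> is the set of edges emitted by a vertex.\<close>

definition sinks :: "('v, 'e) pre_digraph \<Rightarrow> 'v set" where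
  "sinks G = {v \<in> verts G. out_arcs G v = {}}"

definition regular_verts :: "('v, 'e) pre_digraph \<Rightarrow> 'v set" where
  "regular_verts G = {v \<in> verts G. out_arcs G v \<noteq> {} \<and> finite (out_arcs G v)}"

text \<open>A vertex lies on a cycle iff it is the source of one of its edges.\<close>

definition connects_to_cycle :: "('v, 'e) pre_digraph \<Rightarrow> 'v \<Rightarrow> bool" where
  "connects_to_cycle G v \<longleftrightarrow>
     (\<exists>c e. pre_digraph.cycle G c \<and> e \<in> set c \<and> v \<rightarrow>\<^sup>*\<^bsub>G\<^esub> tail G e)"

definition no_cycle_verts :: "('v, 'e) pre_digraph \<Rightarrow> 'v set" where
  "no_cycle_verts G = {v \<in> verts G. \<not> connects_to_cycle G v}"

text \<open>The quotient graph; it is well-formed for hereditary \<open>H\<close>.\<close>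

definition quotient_graph :: "('v, 'e) pre_digraph \<Rightarrow> 'v set \<Rightarrow> ('v, 'e) pre_digraph" where
  "quotient_graph G H =
     \<lparr>verts = verts G - H, arcs = {e \<in> arcs G. head G e \<notin> H}, tail = tail G, head = head G\<rparr>"

locale sandpile_graph = fin_digraph E for E :: "('v, 'e) pre_digraph" +
  fixes s :: 'v
  assumes unique_sink: "sinks E = {s}"
    and reaches_sink: "v \<in> verts E \<Longrightarrow> v \<rightarrow>\<^sup>*\<^bsub>E\<^esub> s"


section \<open>The sandpile monoid\<close>

text \<open>The free commutative monoid on the vertices consists of the multisets of vertices.\<close>

definition sandpile_relations ::
    "('v, 'e) pre_digraph \<Rightarrow> 'v \<Rightarrow> ('v multiset \<times> 'v multiset) set" where
  "sandpile_relations E s =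
     {({#s#}, {#})} \<union>
     {(replicate_mset (card (out_arcs E v)) v, image_mset (head E) (mset_set (out_arcs E v))) | v.
        v \<in> verts E - {s}}"

inductive_set sandpile_cong :: "('v, 'e) pre_digraph \<Rightarrow> 'v \<Rightarrow> ('v multiset \<times> 'v multiset) set"
  for E s where
    rel: "(a, b) \<in> sandpile_relations E s \<Longrightarrow> (a, b) \<in> sandpile_cong E s"
  | refl: "set_mset a \<subseteq> verts E \<Longrightarrow> (a, a) \<in> sandpile_cong E s"
  | sym: "(a, b) \<in> sandpile_cong E s \<Longrightarrow> (b, a) \<in> sandpile_cong E s"
  | trans: "(a, b) \<in> sandpile_cong E s \<Longrightarrow> (b, c) \<in> sandpile_cong E s \<Longrightarrow> (a, c) \<in> sandpile_cong E s"
  | add: "(a, b) \<in> sandpile_cong E s \<Longrightarrow> set_mset c \<subseteq> verts E \<Longrightarrow> (a + c, b + c) \<in> sandpile_cong E s"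

definition SP :: "('v, 'e) pre_digraph \<Rightarrow> 'v \<Rightarrow> 'v multiset set monoid" where
  "SP E s =
     \<lparr>carrier = {a. set_mset a \<subseteq> verts E} // sandpile_cong E s,
      monoid.mult = (\<lambda>A B. \<Union>a\<in>A. \<Union>b\<in>B. sandpile_cong E s `` {a + b}),
      one = sandpile_cong E s `` {{#}}\<rparr>"

definition idempotents :: "('a, 'b) monoid_scheme \<Rightarrow> 'a set" where
  "idempotents M = {x \<in> carrier M. x \<otimes>\<^bsub>M\<^esub> x = x}"


section \<open>Algebras given by generators and relations\<close>

text \<open>Words over an alphabet form a monoid under concatenation. Hence
  \<open>'g fword \<Rightarrow>\<^sub>0 'k\<close> with the convolution product is the free unital algebra on \<open>'g\<close>,
  and its elements supported on nonempty words form the free (non-unital) algebra.\<close>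

datatype 'g fword = FWord (letters: "'g list")

instantiation fword :: (type) monoid_add
begin
definition zero_fword :: "'a fword" where "0 = FWord []"
definition plus_fword :: "'a fword \<Rightarrow> 'a fword \<Rightarrow> 'a fword" where
  "u + v = FWord (letters u @ letters v)"
instance by standard (simp_all add: zero_fword_def plus_fword_def)
end

definition free_alg :: "'g set \<Rightarrow> ('g fword \<Rightarrow>\<^sub>0 'k::field) set" where
  "free_alg X = {p. \<forall>u \<in> Poly_Mapping.keys p. u \<noteq> 0 \<and> set (letters u) \<subseteq> X}"

text \<open>The ideal generated by \<open>R\<close> in the algebra \<open>free_alg X\<close>.\<close>

inductive_set rel_ideal :: "'g set \<Rightarrow> ('g fword \<Rightarrow>\<^sub>0 'k::field) set \<Rightarrow> ('g fword \<Rightarrow>\<^sub>0 'k) set"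
  for X R where
    base: "r \<in> R \<Longrightarrow> r \<in> rel_ideal X R"
  | zero: "0 \<in> rel_ideal X R"
  | add: "p \<in> rel_ideal X R \<Longrightarrow> q \<in> rel_ideal X R \<Longrightarrow> p + q \<in> rel_ideal X R"
  | scale: "p \<in> rel_ideal X R \<Longrightarrow> Poly_Mapping.single 0 c * p \<in> rel_ideal X R"
  | left: "p \<in> rel_ideal X R \<Longrightarrow> a \<in> free_alg X \<Longrightarrow> a * p \<in> rel_ideal X R"
  | right: "p \<in> rel_ideal X R \<Longrightarrow> a \<in> free_alg X \<Longrightarrow> p * a \<in> rel_ideal X R"

definition alg_coset :: "('g fword \<Rightarrow>\<^sub>0 'k::field) set \<Rightarrow> ('g fword \<Rightarrow>\<^sub>0 'k) \<Rightarrow> ('g fword \<Rightarrow>\<^sub>0 'k) set" where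
  "alg_coset I p = {q. q - p \<in> I}"

text \<open>The algebra with generators \<open>X\<close> and relations \<open>r = 0\<close> for \<open>r \<in> R\<close>. The
  construction is non-unital; as the library's rings carry a unit, the class of \<open>u\<close> is recorded as
  such, and \<open>u\<close> has to be chosen as a representative of the unit.\<close>

definition presented_alg ::
    "'g set \<Rightarrow> ('g fword \<Rightarrow>\<^sub>0 'k::field) set \<Rightarrow> ('g fword \<Rightarrow>\<^sub>0 'k) \<Rightarrow> ('k, ('g fword \<Rightarrow>\<^sub>0 'k) set) module" where
  "presented_alg X R u = (let cl = alg_coset (rel_ideal X R) in
     \<lparr>carrier = cl ` free_alg X,
      monoid.mult = (\<lambda>A B. \<Union>a\<in>A. \<Union>b\<in>B. cl (a * b)),
      one = cl u,
      zero = cl 0,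
      add = (\<lambda>A B. \<Union>a\<in>A. \<Union>b\<in>B. cl (a + b)),
      smult = (\<lambda>c A. \<Union>a\<in>A. cl (Poly_Mapping.single 0 c * a))\<rparr>)"


section \<open>Weighted Leavitt path algebras\<close>

text \<open>\<open>Edg e i\<close> and \<open>Gst e i\<close> stand for \<open>e\<^sub>i\<close> and \<open>e\<^sub>i\<^sup>*\<close>.\<close>

datatype ('v, 'e) lpa_gen = Vtx 'v | Edg 'e nat | Gst 'e nat

definition lpa_gens :: "('v, 'e) pre_digraph \<Rightarrow> ('e \<Rightarrow> nat) \<Rightarrow> ('v, 'e) lpa_gen set" where
  "lpa_gens G w =
     Vtx ` verts G \<union>
     {Edg e i | e i. e \<in> arcs G \<and> 1 \<le> i \<and> i \<le> w e} \<union>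
     {Gst e i | e i. e \<in> arcs G \<and> 1 \<le> i \<and> i \<le> w e}"

definition vx :: "'v \<Rightarrow> ('v, 'e) lpa_gen fword \<Rightarrow>\<^sub>0 'k::field" where
  "vx v = Poly_Mapping.single (FWord [Vtx v]) 1"

text \<open>\<open>e\<^sub>i\<close> and \<open>e\<^sub>i\<^sup>*\<close> are set to \<open>0\<close> for \<open>i > w e\<close>.\<close>

definition ed :: "('e \<Rightarrow> nat) \<Rightarrow> 'e \<Rightarrow> nat \<Rightarrow> ('v, 'e) lpa_gen fword \<Rightarrow>\<^sub>0 'k::field" where
  "ed w e i = (if i \<le> w e then Poly_Mapping.single (FWord [Edg e i]) 1 else 0)"

definition gh :: "('e \<Rightarrow> nat) \<Rightarrow> 'e \<Rightarrow> nat \<Rightarrow> ('v, 'e) lpa_gen fword \<Rightarrow>\<^sub>0 'k::field" where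
  "gh w e i = (if i \<le> w e then Poly_Mapping.single (FWord [Gst e i]) 1 else 0)"

definition vertex_weight :: "('v, 'e) pre_digraph \<Rightarrow> ('e \<Rightarrow> nat) \<Rightarrow> 'v \<Rightarrow> nat" where
  "vertex_weight G w v = Max (w ` out_arcs G v)"

definition lpa_rels ::
    "('v, 'e) pre_digraph \<Rightarrow> ('e \<Rightarrow> nat) \<Rightarrow> (('v, 'e) lpa_gen fword \<Rightarrow>\<^sub>0 'k::field) set" where
  "lpa_rels G w =
     {vx u * vx v - (if u = v then vx u else 0) | u v. u \<in> verts G \<and> v \<in> verts G} \<union>
     {vx (tail G e) * ed w e i - ed w e i | e i. e \<in> arcs G \<and> 1 \<le> i \<and> i \<le> w e} \<union>
     {ed w e i * vx (head G e) - ed w e i | e i. e \<in> arcs G \<and> 1 \<le> i \<and> i \<le> w e} \<union>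
     {vx (head G e) * gh w e i - gh w e i | e i. e \<in> arcs G \<and> 1 \<le> i \<and> i \<le> w e} \<union>
     {gh w e i * vx (tail G e) - gh w e i | e i. e \<in> arcs G \<and> 1 \<le> i \<and> i \<le> w e} \<union>
     {(\<Sum>e\<in>out_arcs G v. ed w e i * gh w e j) - (if i = j then vx v else 0) | v i j.
        v \<in> regular_verts G \<and> i \<in> {1..vertex_weight G w v} \<and> j \<in> {1..vertex_weight G w v}} \<union>
     {(\<Sum>i\<in>{1..vertex_weight G w v}. gh w e i * ed w f i) - (if e = f then vx (head G e) else 0) | v e f.
        v \<in> regular_verts G \<and> e \<in> out_arcs G v \<and> f \<in> out_arcs G v}"

text \<open>For a finite graph the sum of all vertices is the unit, and the algebra is a ring in
  the sense of the library (\<open>ring_wlpa\<close> below).\<close>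

definition wlpa ::
    "'k::field itself \<Rightarrow> ('v, 'e) pre_digraph \<Rightarrow> ('e \<Rightarrow> nat) \<Rightarrow>
     ('k, (('v, 'e) lpa_gen fword \<Rightarrow>\<^sub>0 'k) set) module" where
  "wlpa _ G w = presented_alg (lpa_gens G w) (lpa_rels G w) (\<Sum>v\<in>verts G. vx v)"

definition lpa ::
    "'k::field itself \<Rightarrow> ('v, 'e) pre_digraph \<Rightarrow> ('k, (('v, 'e) lpa_gen fword \<Rightarrow>\<^sub>0 'k) set) module" where
  "lpa K G = wlpa K G (\<lambda>_. 1)"

definition wlpa_vertex ::
    "'k::field itself \<Rightarrow> ('v, 'e) pre_digraph \<Rightarrow> ('e \<Rightarrow> nat) \<Rightarrow> 'v \<Rightarrow>
     (('v, 'e) lpa_gen fword \<Rightarrow>\<^sub>0 'k) set" where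
  "wlpa_vertex _ G w v = alg_coset (rel_ideal (lpa_gens G w) (lpa_rels G w)) (vx v)"

definition balanced_weight :: "('v, 'e) pre_digraph \<Rightarrow> 'e \<Rightarrow> nat" where
  "balanced_weight G e = card (out_arcs G (tail G e))"

definition vertex_ideals ::
    "'k::field itself \<Rightarrow> ('v, 'e) pre_digraph \<Rightarrow> ('e \<Rightarrow> nat) \<Rightarrow>
     (('v, 'e) lpa_gen fword \<Rightarrow>\<^sub>0 'k) set set set" where
  "vertex_ideals K G w =
     {Idl\<^bsub>wlpa K G w\<^esub> (wlpa_vertex K G w ` V) | V. V \<subseteq> verts G \<and> V \<noteq> {}}"

definition vertex_simple :: "'k::field itself \<Rightarrow> ('v, 'e) pre_digraph \<Rightarrow> ('e \<Rightarrow> nat) \<Rightarrow> bool" where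
  "vertex_simple K G w \<longleftrightarrow> vertex_ideals K G w = {carrier (wlpa K G w)}"


section \<open>Purely infinite simple rings\<close>

definition simple_ring :: "('a, 'm) ring_scheme \<Rightarrow> bool" where
  "simple_ring R \<longleftrightarrow>
     carrier R \<noteq> {\<zero>\<^bsub>R\<^esub>} \<and> (\<forall>I. ideal I R \<longrightarrow> I = {\<zero>\<^bsub>R\<^esub>} \<or> I = carrier R)"

definition right_ideal :: "'a set \<Rightarrow> ('a, 'm) ring_scheme \<Rightarrow> bool" where
  "right_ideal J R \<longleftrightarrow>
     additive_subgroup J R \<and> (\<forall>a\<in>J. \<forall>x\<in>carrier R. a \<otimes>\<^bsub>R\<^esub> x \<in> J)"

definition right_module_iso :: "('a, 'm) ring_scheme \<Rightarrow> 'a set \<Rightarrow> 'a set \<Rightarrow> bool" where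
  "right_module_iso R A B \<longleftrightarrow>
     (\<exists>h. bij_betw h A B \<and>
          (\<forall>a\<in>A. \<forall>b\<in>A. h (a \<oplus>\<^bsub>R\<^esub> b) = h a \<oplus>\<^bsub>R\<^esub> h b) \<and>
          (\<forall>a\<in>A. \<forall>x\<in>carrier R. h (a \<otimes>\<^bsub>R\<^esub> x) = h a \<otimes>\<^bsub>R\<^esub> x))"

text \<open>An idempotent \<open>e\<close> is infinite if \<open>eR\<close> is isomorphic, as a right module, to a proper direct
  summand of itself. (The submodules of \<open>eR\<close> are the right ideals contained in it.)\<close>

definition infinite_idempotent :: "('a, 'm) ring_scheme \<Rightarrow> 'a \<Rightarrow> bool" where
  "infinite_idempotent R e \<longleftrightarrow>
     e \<in> carrier R \<and> e \<otimes>\<^bsub>R\<^esub> e = e \<and>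
     (\<exists>A B. right_ideal A R \<and> right_ideal B R \<and> A \<inter> B = {\<zero>\<^bsub>R\<^esub>} \<and> B \<noteq> {\<zero>\<^bsub>R\<^esub>} \<and>
            A <+>\<^bsub>R\<^esub> B = (\<lambda>x. e \<otimes>\<^bsub>R\<^esub> x) ` carrier R \<and>
            right_module_iso R ((\<lambda>x. e \<otimes>\<^bsub>R\<^esub> x) ` carrier R) A)"

definition purely_infinite_simple :: "('a, 'm) ring_scheme \<Rightarrow> bool" where
  "purely_infinite_simple R \<longleftrightarrow>
     simple_ring R \<and>
     (\<forall>J. right_ideal J R \<and> J \<noteq> {\<zero>\<^bsub>R\<^esub>} \<longrightarrow> (\<exists>e\<in>J. infinite_idempotent R e))"


section \<open>Matrices over Laurent polynomials\<close>

text \<open>\<open>int \<Rightarrow>\<^sub>0 'k\<close> with the convolution product is the ring of Laurent polynomials;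
  \<open>Poly_Mapping.single 0 c\<close> is the constant \<open>c\<close>.\<close>

definition laurent_matrix_alg :: "nat \<Rightarrow> ('k::field, (int \<Rightarrow>\<^sub>0 'k) mat) module" where
  "laurent_matrix_alg n =
     \<lparr>carrier = carrier_mat n n, monoid.mult = (*), one = 1\<^sub>m n, zero = 0\<^sub>m n n, add = (+),
      smult = (\<lambda>c A. Poly_Mapping.single 0 c \<cdot>\<^sub>m A)\<rparr>"

definition alg_isomorphic :: "('k, 'a) module \<Rightarrow> ('k, 'b) module \<Rightarrow> bool" where
  "alg_isomorphic A B \<longleftrightarrow>
     (\<exists>h \<in> ring_iso A B. \<forall>c. \<forall>x\<in>carrier A. h (c \<odot>\<^bsub>A\<^esub> x) = c \<odot>\<^bsub>B\<^esub> h x)"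


section \<open>The algebras of finite graphs are rings\<close>

text \<open>The library's notions of ideal and generated ideal presuppose a ring.\<close>

lemma fin_digraph_quotient_graph:
  assumes "fin_digraph E"
  shows "fin_digraph (quotient_graph E (no_cycle_verts E))"
proof -
  interpret fin_digraph E by fact
  have "tail E e \<notin> no_cycle_verts E" if e: "e \<in> arcs E" "head E e \<notin> no_cycle_verts E" for e
  proof -
    obtain c f where cf: "pre_digraph.cycle E c" "f \<in> set c" "head E e \<rightarrow>\<^sup>*\<^bsub>E\<^esub> tail E f"
      using e by (auto simp: no_cycle_verts_def connects_to_cycle_def)
    have "tail E e \<rightarrow>\<^bsub>E\<^esub> head E e"
      using e(1) by (auto simp: arcs_ends_conv)
    then have "tail E e \<rightarrow>\<^sup>*\<^bsub>E\<^esub> tail E f"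
      using cf(3) by (rule adj_reachable_trans)
    then show ?thesis
      using cf(1,2) by (auto simp: no_cycle_verts_def connects_to_cycle_def)
  qed
  then show ?thesis
    by unfold_locales (auto simp: quotient_graph_def)
qed

lemma free_alg_zero: "0 \<in> free_alg X"
  by (simp add: free_alg_def)

lemma free_alg_add: "p \<in> free_alg X \<Longrightarrow> q \<in> free_alg X \<Longrightarrow> p + q \<in> free_alg X"
  using Poly_Mapping.keys_add[of p q] by (auto simp: free_alg_def)

lemma free_alg_uminus: "p \<in> free_alg X \<Longrightarrow> - p \<in> free_alg X"
  by (simp add: free_alg_def)

lemma free_alg_diff: "p \<in> free_alg X \<Longrightarrow> q \<in> free_alg X \<Longrightarrow> p - q \<in> free_alg X"
  using free_alg_add[of p X "- q"] free_alg_uminus[of q X] by simp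

lemma free_alg_mult:
  assumes "p \<in> free_alg X" "q \<in> free_alg X"
  shows "p * q \<in> free_alg X"
proof -
  have "u \<noteq> 0 \<and> set (letters u) \<subseteq> X" if uk: "u \<in> Poly_Mapping.keys (p * q)" for u
  proof -
    obtain a b where u: "u = a + b" and ab: "a \<in> Poly_Mapping.keys p" "b \<in> Poly_Mapping.keys q"
      using uk Poly_Mapping.keys_mult[of p q] by blast
    have "a \<noteq> 0" "set (letters a) \<subseteq> X" "set (letters b) \<subseteq> X"
      using ab assms unfolding free_alg_def by blast+
    then show ?thesis
      unfolding u by (cases a) (simp add: zero_fword_def plus_fword_def)
  qed
  then show ?thesis
    by (simp add: free_alg_def)
qed

lemma free_alg_scale:
  assumes "p \<in> free_alg X"
  shows "Poly_Mapping.single 0 c * p \<in> free_alg X"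
proof -
  have "Poly_Mapping.keys (Poly_Mapping.single 0 c * p) \<subseteq> Poly_Mapping.keys p"
    using Poly_Mapping.keys_mult[of "Poly_Mapping.single 0 c" p] by (cases "c = 0") auto
  then show ?thesis
    using assms unfolding free_alg_def by blast
qed

lemma free_alg_sum: "(\<And>x. x \<in> A \<Longrightarrow> f x \<in> free_alg X) \<Longrightarrow> sum f A \<in> free_alg X"
  by (induction A rule: infinite_finite_induct) (auto simp: free_alg_zero free_alg_add)

lemma free_alg_word: "gs \<noteq> [] \<Longrightarrow> set gs \<subseteq> X \<Longrightarrow> Poly_Mapping.single (FWord gs) c \<in> free_alg X"
  by (auto simp: free_alg_def zero_fword_def)

lemma rel_ideal_subset:
  assumes "R \<subseteq> free_alg X" "p \<in> rel_ideal X R"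
  shows "p \<in> free_alg X"
  using assms(2)
proof induction
  case (base r)
  then show ?case using assms(1) by blast
qed (simp_all add: free_alg_zero free_alg_add free_alg_scale free_alg_mult)

lemma rel_ideal_uminus: "p \<in> rel_ideal X R \<Longrightarrow> - p \<in> rel_ideal X R"
  using rel_ideal.scale[of p X R "-1"] by (simp add: single_uminus)

lemma rel_ideal_diff: "p \<in> rel_ideal X R \<Longrightarrow> q \<in> rel_ideal X R \<Longrightarrow> p - q \<in> rel_ideal X R"
  using rel_ideal.add[of p X R "- q"] rel_ideal_uminus[of q X R] by simp

lemma rel_ideal_sum: "(\<And>x. x \<in> A \<Longrightarrow> f x \<in> rel_ideal X R) \<Longrightarrow> sum f A \<in> rel_ideal X R"
  by (induction A rule: infinite_finite_induct) (auto intro: rel_ideal.zero rel_ideal.add)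

lemma mem_alg_coset: "p \<in> alg_coset (rel_ideal X R) p"
  by (simp add: alg_coset_def rel_ideal.zero)

lemma alg_coset_eq_iff:
  "alg_coset (rel_ideal X R) p = alg_coset (rel_ideal X R) q \<longleftrightarrow> p - q \<in> rel_ideal X R"
proof
  assume "alg_coset (rel_ideal X R) p = alg_coset (rel_ideal X R) q"
  then show "p - q \<in> rel_ideal X R"
    using mem_alg_coset[of p X R] by (simp add: alg_coset_def)
next
  assume *: "p - q \<in> rel_ideal X R"
  have "r - p \<in> rel_ideal X R \<longleftrightarrow> r - q \<in> rel_ideal X R" for r
  proof
    assume "r - p \<in> rel_ideal X R"
    from rel_ideal.add[OF this *] show "r - q \<in> rel_ideal X R" by simp
  next
    assume "r - q \<in> rel_ideal X R"
    from rel_ideal_diff[OF this *] show "r - p \<in> rel_ideal X R" by simp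
  qed
  then show "alg_coset (rel_ideal X R) p = alg_coset (rel_ideal X R) q"
    by (simp add: alg_coset_def)
qed

lemma presented_alg_simps:
  fixes R :: "('g fword \<Rightarrow>\<^sub>0 'k::field) set" and u :: "'g fword \<Rightarrow>\<^sub>0 'k"
  assumes R: "R \<subseteq> free_alg X"
  defines "cl \<equiv> alg_coset (rel_ideal X R)" and "A \<equiv> presented_alg X R u"
  shows "carrier A = cl ` free_alg X"
    and "\<one>\<^bsub>A\<^esub> = cl u"
    and "\<zero>\<^bsub>A\<^esub> = cl 0"
    and "p \<in> free_alg X \<Longrightarrow> q \<in> free_alg X \<Longrightarrow> cl p \<otimes>\<^bsub>A\<^esub> cl q = cl (p * q)"
    and "cl p \<oplus>\<^bsub>A\<^esub> cl q = cl (p + q)"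
    and "c \<odot>\<^bsub>A\<^esub> cl p = cl (Poly_Mapping.single 0 c * p)"
proof -
  let ?I = "rel_ideal X R"
  show "carrier A = cl ` free_alg X" "\<one>\<^bsub>A\<^esub> = cl u" "\<zero>\<^bsub>A\<^esub> = cl 0"
    by (simp_all add: A_def cl_def presented_alg_def Let_def)
  have ne: "cl p \<noteq> {}" for p
    using mem_alg_coset[of p X R] unfolding cl_def by blast
  have eq: "cl p = cl q \<longleftrightarrow> p - q \<in> ?I" for p q
    unfolding cl_def by (rule alg_coset_eq_iff)
  have mem: "a \<in> cl p \<longleftrightarrow> a - p \<in> ?I" for a p
    by (simp add: cl_def alg_coset_def)
  show "cl p \<otimes>\<^bsub>A\<^esub> cl q = cl (p * q)" if pq: "p \<in> free_alg X" "q \<in> free_alg X"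
  proof -
    have *: "cl (a * b) = cl (p * q)" if "a \<in> cl p" "b \<in> cl q" for a b
    proof -
      have i: "a - p \<in> ?I" "b - q \<in> ?I"
        using that unfolding mem by blast+
      have "a - p \<in> free_alg X"
        using R i(1) by (rule rel_ideal_subset)
      from free_alg_add[OF this pq(1)] have "a \<in> free_alg X"
        by simp
      then have "a * (b - q) + (a - p) * q \<in> ?I"
        using i pq by (intro rel_ideal.add rel_ideal.left rel_ideal.right)
      also have "a * (b - q) + (a - p) * q = a * b - p * q"
        by (simp add: algebra_simps)
      finally show ?thesis
        unfolding eq .
    qed
    have "cl p \<otimes>\<^bsub>A\<^esub> cl q = (\<Union>a\<in>cl p. \<Union>b\<in>cl q. cl (a * b))"
      by (simp add: A_def presented_alg_def Let_def cl_def)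
    also have "\<dots> = (\<Union>a\<in>cl p. \<Union>b\<in>cl q. cl (p * q))"
      by (intro SUP_cong HOL.refl *)
    also have "\<dots> = cl (p * q)"
      by (simp add: ne)
    finally show ?thesis .
  qed
  show "cl p \<oplus>\<^bsub>A\<^esub> cl q = cl (p + q)"
  proof -
    have *: "cl (a + b) = cl (p + q)" if "a \<in> cl p" "b \<in> cl q" for a b
    proof -
      have "(a - p) + (b - q) \<in> ?I"
        using that unfolding mem by (rule rel_ideal.add)
      also have "(a - p) + (b - q) = (a + b) - (p + q)"
        by (rule add_diff_add[symmetric])
      finally show ?thesis
        unfolding eq .
    qed
    have "cl p \<oplus>\<^bsub>A\<^esub> cl q = (\<Union>a\<in>cl p. \<Union>b\<in>cl q. cl (a + b))"
      by (simp add: A_def presented_alg_def Let_def cl_def)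
    also have "\<dots> = (\<Union>a\<in>cl p. \<Union>b\<in>cl q. cl (p + q))"
      by (intro SUP_cong HOL.refl *)
    also have "\<dots> = cl (p + q)"
      by (simp add: ne)
    finally show ?thesis .
  qed
  show "c \<odot>\<^bsub>A\<^esub> cl p = cl (Poly_Mapping.single 0 c * p)"
  proof -
    have *: "cl (Poly_Mapping.single 0 c * a) = cl (Poly_Mapping.single 0 c * p)" if "a \<in> cl p" for a
    proof -
      have "Poly_Mapping.single 0 c * (a - p) \<in> ?I"
        using that unfolding mem by (rule rel_ideal.scale)
      then show ?thesis
        unfolding eq right_diff_distrib .
    qed
    have "c \<odot>\<^bsub>A\<^esub> cl p = (\<Union>a\<in>cl p. cl (Poly_Mapping.single 0 c * a))"
      by (simp add: A_def presented_alg_def Let_def cl_def)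
    also have "\<dots> = (\<Union>a\<in>cl p. cl (Poly_Mapping.single 0 c * p))"
      by (intro SUP_cong HOL.refl *)
    also have "\<dots> = cl (Poly_Mapping.single 0 c * p)"
      by (simp add: ne)
    finally show ?thesis .
  qed
qed

lemma poly_mapping_eq_sum_single:
  "p = (\<Sum>w\<in>Poly_Mapping.keys p. Poly_Mapping.single w (Poly_Mapping.lookup p w))"
  by (rule poly_mapping_eqI) (simp add: lookup_sum lookup_single when_def in_keys_iff)

lemma ring_presented_alg:
  fixes R :: "('g fword \<Rightarrow>\<^sub>0 'k::field) set"
  assumes R: "R \<subseteq> free_alg X" and u: "u \<in> free_alg X"
    and unit: "\<And>g. g \<in> X \<Longrightarrow> u * Poly_Mapping.single (FWord [g]) 1 - Poly_Mapping.single (FWord [g]) 1 \<in> rel_ideal X R"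
      "\<And>g. g \<in> X \<Longrightarrow> Poly_Mapping.single (FWord [g]) 1 * u - Poly_Mapping.single (FWord [g]) 1 \<in> rel_ideal X R"
  shows "ring (presented_alg X R u)"
proof -
  let ?A = "presented_alg X R u" and ?I = "rel_ideal X R"
  note simps = presented_alg_simps[OF R, where u = u]
  note closed = free_alg_zero free_alg_add free_alg_mult free_alg_uminus u
  have word: "Poly_Mapping.single (FWord (xs @ ys)) c =
      Poly_Mapping.single 0 c * (Poly_Mapping.single (FWord xs) 1 * Poly_Mapping.single (FWord ys) (1::'k))"
    for xs ys :: "'g list" and c
    by (simp add: mult_single plus_fword_def zero_fword_def)
  have rw: "p * Poly_Mapping.single (FWord gs) 1 \<in> ?I" if "p \<in> ?I" "set gs \<subseteq> X" for p gs
  proof (cases "gs = []")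
    case True
    then show ?thesis
      using that by (metis mult.right_neutral single_one zero_fword_def)
  next
    case False
    then show ?thesis
      using that by (intro rel_ideal.right free_alg_word)
  qed
  have lw: "Poly_Mapping.single (FWord gs) 1 * p \<in> ?I" if "p \<in> ?I" "set gs \<subseteq> X" for p gs
  proof (cases "gs = []")
    case True
    then show ?thesis
      using that by (metis mult.left_neutral single_one zero_fword_def)
  next
    case False
    then show ?thesis
      using that by (intro rel_ideal.left free_alg_word)
  qed
  have comm: "u * Poly_Mapping.single 0 c = Poly_Mapping.single 0 c * u" for c
  proof -
    have "Poly_Mapping.single w d * Poly_Mapping.single 0 c = Poly_Mapping.single 0 c * Poly_Mapping.single w d"
      for w :: "'g fword" and d :: 'k
      by (simp add: mult_single mult.commute)
    then have "(\<Sum>w\<in>Poly_Mapping.keys u. Poly_Mapping.single w (Poly_Mapping.lookup u w)) * Poly_Mapping.single 0 c =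
        Poly_Mapping.single 0 c * (\<Sum>w\<in>Poly_Mapping.keys u. Poly_Mapping.single w (Poly_Mapping.lookup u w))"
      by (simp only: sum_distrib_left sum_distrib_right)
    then show ?thesis
      by (simp only: poly_mapping_eq_sum_single[symmetric])
  qed
  have wl: "u * Poly_Mapping.single w c - Poly_Mapping.single w c \<in> ?I"
    if w0: "w \<noteq> 0" "set (letters w) \<subseteq> X" for w c
  proof -
    obtain g gs where w: "w = FWord ([g] @ gs)" and g: "g \<in> X" "set gs \<subseteq> X"
      using w0 by (cases w; cases "letters w") (auto simp: zero_fword_def)
    have "Poly_Mapping.single 0 c *
        ((u * Poly_Mapping.single (FWord [g]) 1 - Poly_Mapping.single (FWord [g]) 1) * Poly_Mapping.single (FWord gs) 1) \<in> ?I"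
      using unit(1) g rw by (intro rel_ideal.scale) blast
    also have "Poly_Mapping.single 0 c *
        ((u * Poly_Mapping.single (FWord [g]) 1 - Poly_Mapping.single (FWord [g]) 1) * Poly_Mapping.single (FWord gs) 1)
        = (Poly_Mapping.single 0 c * u) * (Poly_Mapping.single (FWord [g]) 1 * Poly_Mapping.single (FWord gs) 1)
          - Poly_Mapping.single 0 c * (Poly_Mapping.single (FWord [g]) 1 * Poly_Mapping.single (FWord gs) 1)"
      by (simp only: algebra_simps)
    also have "\<dots> = u * Poly_Mapping.single w c - Poly_Mapping.single w c"
      unfolding comm[symmetric] w word by (simp only: mult.assoc)
    finally show ?thesis .
  qed
  have wr: "Poly_Mapping.single w c * u - Poly_Mapping.single w c \<in> ?I"
    if w0: "w \<noteq> 0" "set (letters w) \<subseteq> X" for w c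
  proof -
    obtain g gs where w: "w = FWord (gs @ [g])" and g: "g \<in> X" "set gs \<subseteq> X"
      using w0 by (cases w; cases "letters w" rule: rev_cases) (auto simp: zero_fword_def)
    have "Poly_Mapping.single 0 c *
        (Poly_Mapping.single (FWord gs) 1 * (Poly_Mapping.single (FWord [g]) 1 * u - Poly_Mapping.single (FWord [g]) 1)) \<in> ?I"
      using unit(2) g lw by (intro rel_ideal.scale) blast
    also have "Poly_Mapping.single 0 c *
        (Poly_Mapping.single (FWord gs) 1 * (Poly_Mapping.single (FWord [g]) 1 * u - Poly_Mapping.single (FWord [g]) 1))
        = Poly_Mapping.single w c * u - Poly_Mapping.single w c"
      unfolding w word by (simp only: algebra_simps)
    finally show ?thesis .
  qed
  have ul: "u * p - p \<in> ?I" if "p \<in> free_alg X" for p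
  proof -
    have "(\<Sum>w\<in>Poly_Mapping.keys p. u * Poly_Mapping.single w (Poly_Mapping.lookup p w) - Poly_Mapping.single w (Poly_Mapping.lookup p w)) \<in> ?I"
      using that by (intro rel_ideal_sum wl) (auto simp: free_alg_def)
    then show ?thesis
      by (simp only: sum_subtractf sum_distrib_left[symmetric] poly_mapping_eq_sum_single[symmetric])
  qed
  have ur: "p * u - p \<in> ?I" if "p \<in> free_alg X" for p
  proof -
    have "(\<Sum>w\<in>Poly_Mapping.keys p. Poly_Mapping.single w (Poly_Mapping.lookup p w) * u - Poly_Mapping.single w (Poly_Mapping.lookup p w)) \<in> ?I"
      using that by (intro rel_ideal_sum wr) (auto simp: free_alg_def)
    then show ?thesis
      by (simp only: sum_subtractf sum_distrib_right[symmetric] poly_mapping_eq_sum_single[symmetric])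
  qed
  have ul': "alg_coset ?I (u * p) = alg_coset ?I p" if "p \<in> free_alg X" for p
    unfolding alg_coset_eq_iff using that by (rule ul)
  have ur': "alg_coset ?I (p * u) = alg_coset ?I p" if "p \<in> free_alg X" for p
    unfolding alg_coset_eq_iff using that by (rule ur)
  show ?thesis
  proof (rule ringI)
    show "abelian_group ?A"
    proof (rule abelian_groupI)
      fix x assume "x \<in> carrier ?A"
      then obtain p where "p \<in> free_alg X" "x = alg_coset ?I p"
        by (auto simp: simps)
      then show "\<exists>y\<in>carrier ?A. y \<oplus>\<^bsub>?A\<^esub> x = \<zero>\<^bsub>?A\<^esub>"
        by (intro bexI[of _ "alg_coset ?I (- p)"]) (auto simp: simps closed)
    qed (auto simp: simps closed add_ac)
    show "Group.monoid ?A"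
      by (rule monoidI) (auto simp: simps closed mult.assoc ul' ur')
  qed (auto simp: simps closed algebra_simps)
qed

lemma vx_mem: "v \<in> verts G \<Longrightarrow> vx v \<in> free_alg (lpa_gens G w)"
  unfolding vx_def by (rule free_alg_word) (auto simp: lpa_gens_def)

lemma ed_mem: "e \<in> arcs G \<Longrightarrow> 1 \<le> i \<Longrightarrow> ed w e i \<in> free_alg (lpa_gens G w)"
  unfolding ed_def by (auto simp: free_alg_zero lpa_gens_def intro!: free_alg_word)

lemma gh_mem: "e \<in> arcs G \<Longrightarrow> 1 \<le> i \<Longrightarrow> gh w e i \<in> free_alg (lpa_gens G w)"
  unfolding gh_def by (auto simp: free_alg_zero lpa_gens_def intro!: free_alg_word)

lemma lpa_rels_subset:
  assumes "wf_digraph G"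
  shows "lpa_rels G w \<subseteq> free_alg (lpa_gens G w)"
proof -
  interpret wf_digraph G by fact
  show ?thesis
    unfolding lpa_rels_def
    by (auto simp: regular_verts_def
        intro!: free_alg_diff free_alg_mult free_alg_sum vx_mem ed_mem gh_mem free_alg_zero)
qed

lemma ring_wlpa:
  fixes G :: "('v, 'e) pre_digraph" and K :: "'k::field itself"
  assumes "fin_digraph G"
  shows "ring (wlpa K G w)"
proof -
  interpret fin_digraph G by fact
  let ?X = "lpa_gens G w"
  let ?R = "lpa_rels G w :: (('v, 'e) lpa_gen fword \<Rightarrow>\<^sub>0 'k) set"
  let ?I = "rel_ideal ?X ?R"
  let ?u = "\<Sum>v\<in>verts G. vx v :: ('v, 'e) lpa_gen fword \<Rightarrow>\<^sub>0 'k"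
  have vv: "vx u * vx v - (if u = v then vx u else 0) \<in> ?I" if "u \<in> verts G" "v \<in> verts G" for u v
    by (rule rel_ideal.base) (use that in \<open>auto simp: lpa_rels_def\<close>)
  have uv: "?u * vx v - vx v \<in> ?I" if v: "v \<in> verts G" for v
  proof -
    have "(\<Sum>u\<in>verts G. vx u * vx v - (if u = v then vx u else 0)) \<in> ?I"
      using v vv by (intro rel_ideal_sum) auto
    then show ?thesis
      using v by (simp add: sum_subtractf sum_distrib_right)
  qed
  have vu: "vx v * ?u - vx v \<in> ?I" if v: "v \<in> verts G" for v
  proof -
    have "(\<Sum>u\<in>verts G. vx v * vx u - (if v = u then vx v else 0)) \<in> ?I"
      using v vv by (intro rel_ideal_sum) auto
    then show ?thesis
      using v by (simp add: sum_subtractf sum_distrib_left)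
  qed
  have U: "?u \<in> free_alg ?X"
    by (intro free_alg_sum vx_mem)
  have L: "?u * x - x \<in> ?I" if "vx v * x - x \<in> ?I" "v \<in> verts G" "x \<in> free_alg ?X" for x v
  proof -
    have "(vx v * x - x) + (?u * vx v - vx v) * x - ?u * (vx v * x - x) \<in> ?I"
      by (rule rel_ideal_diff[OF rel_ideal.add[OF that(1) rel_ideal.right[OF uv[OF that(2)] that(3)]] rel_ideal.left[OF that(1) U]])
    also have "(vx v * x - x) + (?u * vx v - vx v) * x - ?u * (vx v * x - x) = ?u * x - x"
      by (simp add: algebra_simps)
    finally show ?thesis .
  qed
  have R: "x * ?u - x \<in> ?I" if "x * vx v - x \<in> ?I" "v \<in> verts G" "x \<in> free_alg ?X" for x v
  proof -
    have "(x * vx v - x) + x * (vx v * ?u - vx v) - (x * vx v - x) * ?u \<in> ?I"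
      by (rule rel_ideal_diff[OF rel_ideal.add[OF that(1) rel_ideal.left[OF vu[OF that(2)] that(3)]] rel_ideal.right[OF that(1) U]])
    also have "(x * vx v - x) + x * (vx v * ?u - vx v) - (x * vx v - x) * ?u = x * ?u - x"
      by (simp add: algebra_simps)
    finally show ?thesis .
  qed
  have "?u * Poly_Mapping.single (FWord [g]) 1 - Poly_Mapping.single (FWord [g]) 1 \<in> ?I \<and>
        Poly_Mapping.single (FWord [g]) 1 * ?u - Poly_Mapping.single (FWord [g]) 1 \<in> ?I" if g: "g \<in> ?X" for g
  proof -
    consider (V) v where "g = Vtx v" "v \<in> verts G"
      | (E) e i where "g = Edg e i" "e \<in> arcs G" "1 \<le> i" "i \<le> w e"
      | (S) e i where "g = Gst e i" "e \<in> arcs G" "1 \<le> i" "i \<le> w e"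
      using g unfolding lpa_gens_def by blast
    then show ?thesis
    proof cases
      case V
      then show ?thesis using uv vu by (simp add: vx_def)
    next
      case E
      have "vx (tail G e) * ed w e i - ed w e i \<in> ?I" "ed w e i * vx (head G e) - ed w e i \<in> ?I"
        by (rule rel_ideal.base; use E in \<open>auto simp: lpa_rels_def\<close>)+
      then have "?u * ed w e i - ed w e i \<in> ?I \<and> ed w e i * ?u - ed w e i \<in> ?I"
        using E L R ed_mem[of e G i w] tail_in_verts[of e] head_in_verts[of e] by blast
      then show ?thesis using E by (simp add: ed_def)
    next
      case S
      have "vx (head G e) * gh w e i - gh w e i \<in> ?I" "gh w e i * vx (tail G e) - gh w e i \<in> ?I"
        by (rule rel_ideal.base; use S in \<open>auto simp: lpa_rels_def\<close>)+
      then have "?u * gh w e i - gh w e i \<in> ?I \<and> gh w e i * ?u - gh w e i \<in> ?I"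
        using S L R gh_mem[of e G i w] tail_in_verts[of e] head_in_verts[of e] by blast
      then show ?thesis using S by (simp add: gh_def)
    qed
  qed
  then show ?thesis
    unfolding wlpa_def
    by (intro ring_presented_alg lpa_rels_subset free_alg_sum vx_mem wf_digraph_axioms) auto
qed

end

theory Submission
  imports Defs "Jordan_Normal_Form.Determinant"
begin

text \<open>All three conditions say that \<open>F = E/S\<^sub>E\<close> is nonempty and has no hereditary saturated sets of
  vertices except \<open>{}\<close> and \<open>F\<^sup>0\<close>.

  The idempotents of the finite monoid \<open>SP(E)\<close> correspond to its archimedean components, hence to the
  hereditary saturated sets of \<open>E\<close> that contain the sink; all of these contain \<open>S\<^sub>E\<close>, and removing it
  gives the hereditary saturated sets of \<open>F\<close>.

  For a balanced weighting, the vertices in a given ideal form a hereditary saturated set. Conversely,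
  a representation on a space on which exactly the vertices of \<open>H\<close> act as \<open>0\<close> shows that the ideal
  generated by a hereditary saturated set \<open>H\<close> contains no other vertices.

  If every cycle of \<open>F\<close> has an exit, then every nonzero element of \<open>L(F)\<close> can be multiplied to a
  vertex \<open>w\<close> on a cycle with an exit: first to a combination of distinct real paths, then to a scalar
  multiple of a vertex by cancelling with an aperiodic path. As such a \<open>w\<close> is infinite, \<open>L(F)\<close> is
  purely infinite simple. If some cycle has no exit, then all paths lead to it, and the finitely many
  paths to a vertex \<open>x\<close> of the cycle that meet \<open>x\<close> only at their end give matrix units over
  \<open>x L(F) x = k[c, c\<^sup>-\<^sup>1]\<close>.\<close>

section \<open>Hereditary and saturated sets of vertices\<close>

text \<open>One exchange lies behind all three conditions. A toppling relation equates
  \<open>d\<close> copies of \<open>v\<close> with the sum of its \<open>d\<close> successors. The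
  relations \<open>CK1\<close> and \<open>CK2\<close> make the array of the elements
  \<open>A e i\<close>, for \<open>e\<close> in \<open>out_arcs F v\<close> and \<open>i\<close> up
  to \<open>N v\<close>, invertible, so \<open>N v\<close> copies of the right ideal of
  \<open>v\<close> are isomorphic to the direct sum of the right ideals of the ranges.
  Multiplicities do not affect which vertices generate which others, hence chips, weight 1 and
  balanced weights lead to the same sets.

  Relations by themselves only give upper bounds: they never show that a vertex is nonzero, that an
  ideal is proper or that the powers of a cycle are independent. The representation supplies all of
  this. It needs spaces for which any finite positive number of copies has the same size as one,
  whence a copy of the natural numbers above each vertex.

  Matrices over Laurent polynomials do not form a simple ring, so the way back from the matrix
  alternative cannot use simplicity. It suffices that vertices are idempotents: over a domain a
  nonzero idempotent matrix generates the full matrix ring as an ideal, which a determinant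
  shows.\<close>

definition hered_sat :: "('v, 'e) pre_digraph \<Rightarrow> 'v set \<Rightarrow> bool" where
  "hered_sat G H \<longleftrightarrow> H \<subseteq> verts G \<and>
     (\<forall>e\<in>arcs G. tail G e \<in> H \<longrightarrow> head G e \<in> H) \<and>
     (\<forall>v\<in>verts G. out_arcs G v \<noteq> {} \<longrightarrow> head G ` out_arcs G v \<subseteq> H \<longrightarrow> v \<in> H)"

text \<open>Nonemptiness matters: if \<open>E\<close> has no cycle, the quotient graph is empty, its
  algebra is zero, and each of the three conditions fails.\<close>

definition hered_sat_trivial :: "('v, 'e) pre_digraph \<Rightarrow> bool" where
  "hered_sat_trivial G \<longleftrightarrow> verts G \<noteq> {} \<and> (\<forall>H. hered_sat G H \<longrightarrow> H = {} \<or> H = verts G)"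

lemma hered_satD:
  assumes "hered_sat G H"
  shows "H \<subseteq> verts G"
    and "e \<in> arcs G \<Longrightarrow> tail G e \<in> H \<Longrightarrow> head G e \<in> H"
    and "v \<in> verts G \<Longrightarrow> out_arcs G v \<noteq> {} \<Longrightarrow> (\<And>e. e \<in> arcs G \<Longrightarrow> tail G e = v \<Longrightarrow> head G e \<in> H) \<Longrightarrow> v \<in> H"
  using assms unfolding hered_sat_def by (blast, blast, force)

lemma (in wf_digraph) hered_sat_verts: "hered_sat G (verts G)"
  by (auto simp: hered_sat_def)

lemma hered_sat_empty: "hered_sat G {}"
  by (auto simp: hered_sat_def)

context wf_digraph
begin

text \<open>Keeping the first edge of a closed walk and replacing the rest by an
  \<open>apath\<close> back to the start yields a cycle through the same vertex. So closed walks can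
  stand in for cycles from here on.\<close>

lemma connects_to_cycle_iff: "connects_to_cycle G v \<longleftrightarrow> (\<exists>u. v \<rightarrow>\<^sup>* u \<and> u \<rightarrow>\<^sup>+ u)"
proof
  assume "connects_to_cycle G v"
  then obtain c e where c: "cycle c" "e \<in> set c" "v \<rightarrow>\<^sup>* tail G e"
    by (auto simp: connects_to_cycle_def)
  then obtain u where u: "awalk u c u"
    by (auto simp: cycle_def)
  obtain p q where pq: "c = p @ e # q"
    using c(2) by (meson split_list)
  have "awalk u p (tail G e)" "awalk (tail G e) (e # q) u"
    using u by (auto simp: pq awalk_Cons_iff)
  then have "awalk (tail G e) ((e # q) @ p) (tail G e)"
    by (intro awalk_appendI)
  then have "tail G e \<rightarrow>\<^sup>+ tail G e"
    by (rule reachable1_awalkI) simp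
  then show "\<exists>u. v \<rightarrow>\<^sup>* u \<and> u \<rightarrow>\<^sup>+ u"
    using c(3) by blast
next
  assume "\<exists>u. v \<rightarrow>\<^sup>* u \<and> u \<rightarrow>\<^sup>+ u"
  then obtain u p where u: "v \<rightarrow>\<^sup>* u" "awalk u p u" "p \<noteq> []"
    by (auto simp: reachable1_awalk)
  then obtain e q where e: "p = e # q" "e \<in> arcs G" "tail G e = u" "awalk (head G e) q u"
    by (cases p) (auto simp: awalk_Cons_iff)
  then obtain q' where q': "apath (head G e) q' u"
    using reachable_awalk reachable_apath by blast
  then have "cycle (e # q')"
    using e unfolding cycle_def apath_def
    by (intro exI[of _ u]) (auto simp: awalk_Cons_iff)
  then show "connects_to_cycle G v"
    using u(1) e(3) unfolding connects_to_cycle_def by (intro exI[of _ "e # q'"] exI[of _ e]) auto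
qed

lemma connects_to_cycle_if_reachable:
  "v \<rightarrow>\<^sup>* u \<Longrightarrow> connects_to_cycle G u \<Longrightarrow> connects_to_cycle G v"
  unfolding connects_to_cycle_iff using reachable_trans by blast

end

text \<open>A walk that follows chosen successors inside the finite set \<open>W\<close> must repeat
  a vertex, and the piece between two visits is a closed walk.\<close>

lemma (in fin_digraph) connects_to_cycle_if_successors:
  assumes W: "W \<subseteq> verts G" "\<And>u. u \<in> W \<Longrightarrow> \<exists>e\<in>arcs G. tail G e = u \<and> head G e \<in> W"
    and v: "v \<in> W"
  shows "connects_to_cycle G v"
proof -
  obtain f where f: "\<And>u. u \<in> W \<Longrightarrow> f u \<in> arcs G \<and> tail G (f u) = u \<and> head G (f u) \<in> W"
    using W(2) by metis
  define x where "x n = ((\<lambda>u. head G (f u)) ^^ n) v" for n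
  have xW: "x n \<in> W" for n
    by (induction n) (use v f in \<open>auto simp: x_def\<close>)
  have step: "x n \<rightarrow>\<^bsub>G\<^esub> x (Suc n)" for n
    using f[OF xW[of n]] in_arcs_imp_in_arcs_ends[of "f (x n)"] by (simp add: x_def)
  have reach: "x i \<rightarrow>\<^sup>+ x (i + Suc d)" for i d
  proof (induction d)
    case 0
    show ?case using step[of i] by auto
  next
    case (Suc d)
    then show ?case using step[of "i + Suc d"] by (auto intro: trancl_into_trancl)
  qed
  have "range x \<subseteq> verts G"
    using xW W(1) by blast
  then have "finite (range x)"
    using finite_verts by (rule finite_subset)
  then have "\<not> inj x"
    using finite_imageD[of x UNIV] infinite_UNIV_nat by blast
  then obtain i j where ij: "i < j" "x i = x j"
    by (metis injI linorder_neqE_nat)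
  then have "x i \<rightarrow>\<^sup>+ x i"
    using reach[of i "j - i - 1"] by simp
  moreover have "v \<rightarrow>\<^sup>* x i"
  proof (cases i)
    case 0
    then show ?thesis using v W(1) by (auto simp: x_def intro: reachable_refl)
  next
    case (Suc d)
    then show ?thesis using reach[of 0 d] by (auto simp: x_def)
  qed
  ultimately show ?thesis
    unfolding connects_to_cycle_iff by blast
qed

context fin_digraph
begin

lemma hered_sat_no_cycle_verts: "hered_sat G (no_cycle_verts G)"
proof -
  have "connects_to_cycle G (tail G e)"
    if "e \<in> arcs G" "connects_to_cycle G (head G e)" for e
    using that connects_to_cycle_if_reachable in_arcs_imp_in_arcs_ends by blast
  moreover have "\<exists>e\<in>out_arcs G v. connects_to_cycle G (head G e)"
    if v: "connects_to_cycle G v" for v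
  proof -
    obtain u where u: "v \<rightarrow>\<^sup>* u" "u \<rightarrow>\<^sup>+ u"
      using v connects_to_cycle_iff by blast
    \<comment> \<open>Appending the closed walk at \<open>u\<close> guarantees a first edge even if
      \<open>v = u\<close>.\<close>
    then have "v \<rightarrow>\<^sup>+ u"
      by (meson reachable_reachable1_trans)
    then obtain p where "awalk v p u" "p \<noteq> []"
      by (auto simp: reachable1_awalk)
    then obtain e q where "e \<in> out_arcs G v" "awalk (head G e) q u"
      by (cases p) (auto simp: awalk_Cons_iff)
    then show ?thesis
      using u(2) reachable_awalk connects_to_cycle_iff by blast
  qed
  ultimately show ?thesis
    unfolding hered_sat_def no_cycle_verts_def by (auto simp: image_subset_iff)
qed

text \<open>A vertex without access to a cycle that lies outside \<open>H\<close> is not a sink.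
  Saturation of \<open>H\<close> gives it a successor outside \<open>H\<close>, and heredity keeps
  this successor among the vertices without access to a cycle. Continuing forever in a finite graph
  would reach a cycle.\<close>

lemma no_cycle_verts_subset:
  assumes H: "hered_sat G H" "sinks G \<subseteq> H"
  shows "no_cycle_verts G \<subseteq> H"
proof (rule ccontr)
  let ?W = "no_cycle_verts G - H"
  assume "\<not> no_cycle_verts G \<subseteq> H"
  then obtain v where v: "v \<in> ?W"
    by blast
  have "\<exists>e\<in>arcs G. tail G e = u \<and> head G e \<in> ?W" if u: "u \<in> ?W" for u
  proof -
    have "u \<in> verts G" "out_arcs G u \<noteq> {}"
      using u H(2) by (auto simp: no_cycle_verts_def sinks_def)
    then obtain e where "e \<in> arcs G" "tail G e = u" "head G e \<notin> H"
      using hered_satD(3)[OF H(1), of u] u by blast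
    then show ?thesis
      using hered_satD(2)[OF hered_sat_no_cycle_verts, of e] u by auto
  qed
  then have "connects_to_cycle G v"
    using connects_to_cycle_if_successors[of ?W v] v by (auto simp: no_cycle_verts_def)
  then show False
    using v by (simp add: no_cycle_verts_def)
qed

abbreviation "cyc_part \<equiv> quotient_graph G (no_cycle_verts G)"

lemma cyc_part_simps:
  "verts cyc_part = verts G - no_cycle_verts G"
  "arcs cyc_part = {e \<in> arcs G. head G e \<notin> no_cycle_verts G}"
  "tail cyc_part = tail G" "head cyc_part = head G"
  by (simp_all add: quotient_graph_def)

text \<open>Saturation of the removed set: a vertex outside it that emits an edge also emits one
  ending outside it. Hence every vertex of the quotient graph is regular and can be expanded along
  its edges in the algebra.\<close>

lemma sinks_cyc_part: "sinks cyc_part = {}"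
proof -
  have "out_arcs cyc_part v \<noteq> {}" if v: "v \<in> verts cyc_part" for v
  proof -
    have "connects_to_cycle G v"
      using v unfolding cyc_part_simps by (simp add: no_cycle_verts_def)
    then obtain u where "v \<rightarrow>\<^sup>+ u"
      using connects_to_cycle_iff reachable_reachable1_trans by blast
    then obtain p where "awalk v p u" "p \<noteq> []"
      by (auto simp: reachable1_awalk)
    then have ne: "out_arcs G v \<noteq> {}"
      by (cases p) (auto simp: awalk_Cons_iff)
    then have "\<exists>e\<in>arcs G. tail G e = v \<and> head G e \<notin> no_cycle_verts G"
      using hered_satD(3)[OF hered_sat_no_cycle_verts, of v] v by (auto simp: cyc_part_simps)
    then show ?thesis
      by (auto simp: cyc_part_simps out_arcs_def)
  qed
  then show ?thesis
    by (auto simp: sinks_def)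
qed

text \<open>The deleted edges end in the removed set, which is part of \<open>H\<close>, so they
  never obstruct either closure condition. For the converse, a remaining vertex has to keep some
  edge in the quotient before saturation applies there; this is the absence of sinks.\<close>

lemma hered_sat_cyc_part_iff:
  assumes "no_cycle_verts G \<subseteq> H" "sinks G \<subseteq> H"
  shows "hered_sat G H \<longleftrightarrow> hered_sat cyc_part (H - no_cycle_verts G)"
proof
  assume H: "hered_sat G H"
  show "hered_sat cyc_part (H - no_cycle_verts G)"
    unfolding hered_sat_def
  proof (intro conjI ballI impI)
    show "H - no_cycle_verts G \<subseteq> verts cyc_part"
      using hered_satD(1)[OF H] by (auto simp: cyc_part_simps)
  next
    fix e assume "e \<in> arcs cyc_part" "tail cyc_part e \<in> H - no_cycle_verts G"
    then show "head cyc_part e \<in> H - no_cycle_verts G"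
      using hered_satD(2)[OF H] by (auto simp: cyc_part_simps)
  next
    fix v assume v: "v \<in> verts cyc_part" "out_arcs cyc_part v \<noteq> {}"
      "head cyc_part ` out_arcs cyc_part v \<subseteq> H - no_cycle_verts G"
    have "head G e \<in> H" if "e \<in> arcs G" "tail G e = v" for e
      using that v(3) assms(1) by (cases "head G e \<in> no_cycle_verts G") (auto simp: cyc_part_simps image_subset_iff out_arcs_def)
    moreover have "v \<in> verts G" "out_arcs G v \<noteq> {}"
      using v(1,2) by (auto simp: cyc_part_simps out_arcs_def)
    ultimately have "v \<in> H"
      using hered_satD(3)[OF H, of v] by blast
    then show "v \<in> H - no_cycle_verts G"
      using v(1) by (simp add: cyc_part_simps)
  qed
next
  assume H: "hered_sat cyc_part (H - no_cycle_verts G)"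
  note S = hered_sat_no_cycle_verts
  show "hered_sat G H"
    unfolding hered_sat_def
  proof (intro conjI ballI impI)
    show "H \<subseteq> verts G"
      using hered_satD(1)[OF H] hered_satD(1)[OF S] by (auto simp: cyc_part_simps)
  next
    fix e assume e: "e \<in> arcs G" "tail G e \<in> H"
    show "head G e \<in> H"
      using e assms(1) hered_satD(2)[OF S, of e] hered_satD(2)[OF H, of e] by (auto simp: cyc_part_simps)
  next
    fix v assume v: "v \<in> verts G" "out_arcs G v \<noteq> {}" "head G ` out_arcs G v \<subseteq> H"
    show "v \<in> H"
    proof (cases "v \<in> no_cycle_verts G")
      case False
      then have vF: "v \<in> verts cyc_part"
        using v(1) by (simp add: cyc_part_simps)
      then have "out_arcs cyc_part v \<noteq> {}"
        using sinks_cyc_part by (auto simp: sinks_def)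
      then show ?thesis
        using hered_satD(3)[OF H vF] v(3) by (auto simp: cyc_part_simps image_subset_iff)
    qed (use assms in auto)
  qed
qed

end

section \<open>Idempotents of the sandpile monoid\<close>

text \<open>Serves to compare idempotent classes with vertex sets through their common
  representatives, without first defining a map on classes.\<close>

lemma card_image_eq_if_same_fibres:
  assumes "\<And>a b. a \<in> A \<Longrightarrow> b \<in> A \<Longrightarrow> f a = f b \<longleftrightarrow> g a = g b"
  shows "card (f ` A) = card (g ` A)"
proof -
  define h where "h y = g (inv_into A f y)" for y
  have h: "h (f a) = g a" if "a \<in> A" for a
    using that assms[of "inv_into A f (f a)" a] by (simp add: h_def inv_into_into f_inv_into_f)
  have "inj_on h (f ` A)"
    using assms h by (intro inj_onI) auto
  then have "card (h ` f ` A) = card (f ` A)"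
    by (rule card_image)
  moreover have "h ` f ` A = g ` A"
    using h by (auto simp: image_image)
  ultimately show ?thesis
    by simp
qed

context sandpile_graph
begin

abbreviation "FM \<equiv> {a. set_mset a \<subseteq> verts E}"
abbreviation "R \<equiv> sandpile_cong E s"
abbreviation "cls a \<equiv> R `` {a}"

lemma sink_in_verts: "s \<in> verts E" and out_arcs_sink: "out_arcs E s = {}"
  using unique_sink by (auto simp: sinks_def)

lemma out_arcs_nonsink: "v \<in> verts E \<Longrightarrow> v \<noteq> s \<Longrightarrow> out_arcs E v \<noteq> {}"
  using unique_sink by (auto simp: sinks_def)

lemma sandpile_cong_topple:
  "v \<in> verts E \<Longrightarrow> v \<noteq> s \<Longrightarrow>
    (replicate_mset (card (out_arcs E v)) v, image_mset (head E) (mset_set (out_arcs E v))) \<in> R"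
  by (rule sandpile_cong.rel) (auto simp: sandpile_relations_def)

lemma sandpile_cong_sink: "({#s#}, {#}) \<in> R"
  by (rule sandpile_cong.rel) (auto simp: sandpile_relations_def)

lemma sandpile_cong_FM: "(a, b) \<in> R \<Longrightarrow> a \<in> FM \<and> b \<in> FM"
proof (induction rule: sandpile_cong.induct)
  case (rel a b)
  then show ?case
    using sink_in_verts
    by (auto simp: sandpile_relations_def set_mset_replicate_mset_subset out_arcs_def split: if_splits)
qed auto

lemma equiv_sandpile_cong: "equiv FM R"
  by (rule equivI) (auto simp: refl_on_def sym_def trans_def dest: sandpile_cong_FM
      intro: sandpile_cong.refl sandpile_cong.sym sandpile_cong.trans)

lemma cls_eq_iff: "a \<in> FM \<Longrightarrow> b \<in> FM \<Longrightarrow> cls a = cls b \<longleftrightarrow> (a, b) \<in> R"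
  using eq_equiv_class_iff[OF equiv_sandpile_cong] by blast

lemma sandpile_cong_add2:
  assumes "(a, b) \<in> R" "(c, d) \<in> R"
  shows "(a + c, b + d) \<in> R"
proof -
  have "(a + c, b + c) \<in> R"
    using assms sandpile_cong_FM by (blast intro: sandpile_cong.add)
  moreover have "(c + b, d + b) \<in> R"
    using assms sandpile_cong_FM by (blast intro: sandpile_cong.add)
  ultimately show ?thesis
    by (metis add.commute sandpile_cong.trans)
qed

lemma sandpile_cong_repeat: "(a, b) \<in> R \<Longrightarrow> (repeat_mset n a, repeat_mset n b) \<in> R"
  by (induction n) (auto intro: sandpile_cong.refl sandpile_cong_add2)

lemma idempotents_SP: "idempotents (SP E s) = cls ` {a \<in> FM. (a + a, a) \<in> R}"
proof -
  have "(\<Union>a\<in>cls a. \<Union>b\<in>cls b. cls (a + b)) = cls (a + b)" if "a \<in> FM" "b \<in> FM" for a b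
  proof -
    have ab: "a \<in> cls a" "b \<in> cls b"
      using that by (auto intro: sandpile_cong.refl)
    have "cls (a' + b') = cls (a + b)" if "a' \<in> cls a" "b' \<in> cls b" for a' b'
      using sandpile_cong_add2[of a a' b b'] that equiv_class_eq[OF equiv_sandpile_cong] by blast
    then show ?thesis
      using ab by blast
  qed
  then have mult: "cls a \<otimes>\<^bsub>SP E s\<^esub> cls a = cls (a + a)" if "a \<in> FM" for a
    using that by (simp add: SP_def)
  then have idem: "cls a \<otimes>\<^bsub>SP E s\<^esub> cls a = cls a \<longleftrightarrow> (a + a, a) \<in> R" if "a \<in> FM" for a
    using that cls_eq_iff[of "a + a" a] by simp
  have "carrier (SP E s) = cls ` FM"
    by (auto simp: SP_def quotient_def)
  then have "idempotents (SP E s) = {x \<in> cls ` FM. x \<otimes>\<^bsub>SP E s\<^esub> x = x}"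
    by (simp add: idempotents_def)
  also have "\<dots> = cls ` {a \<in> FM. cls a \<otimes>\<^bsub>SP E s\<^esub> cls a = cls a}"
    by blast
  also have "{a \<in> FM. cls a \<otimes>\<^bsub>SP E s\<^esub> cls a = cls a} = {a \<in> FM. (a + a, a) \<in> R}"
    using idem by blast
  finally show ?thesis .
qed

subsection \<open>Finiteness\<close>

definition sink_dist :: "'v \<Rightarrow> nat" where
  "sink_dist v = (LEAST n. \<exists>p. awalk v p s \<and> length p = n)"

lemma sink_dist_walk:
  assumes "v \<in> verts E"
  obtains p where "awalk v p s" "length p = sink_dist v"
proof -
  obtain p where "awalk v p s"
    using reaches_sink[OF assms] by (auto simp: reachable_awalk)
  then have "\<exists>n p. awalk v p s \<and> length p = n"
    by blast
  then show ?thesis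
    using LeastI_ex[of "\<lambda>n. \<exists>p. awalk v p s \<and> length p = n"] that unfolding sink_dist_def by blast
qed

lemma sink_dist_le: "awalk v p s \<Longrightarrow> sink_dist v \<le> length p"
  unfolding sink_dist_def by (rule Least_le) blast

lemma sink_dist_step:
  assumes "v \<in> verts E" "v \<noteq> s"
  obtains e where "e \<in> out_arcs E v" "sink_dist v = Suc (sink_dist v - 1)" "sink_dist (head E e) \<le> sink_dist v - 1"
proof -
  obtain p where p: "awalk v p s" "length p = sink_dist v"
    using sink_dist_walk[OF assms(1)] .
  obtain e q where e: "p = e # q" "e \<in> arcs E" "tail E e = v" "awalk (head E e) q s"
    using p assms(2) by (cases p) (auto simp: awalk_Cons_iff awalk_Nil_iff)
  show ?thesis
    using that[of e] sink_dist_le[OF e(4)] e p(2) by simp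
qed

text \<open>\<open>1 - B ^ (- dist)\<close> is strictly superharmonic for large \<open>B\<close>; scaling by \<open>B ^ N\<close> makes it
  integral. Hence toppling terminates.\<close>

definition potential :: "'v \<Rightarrow> int" where
  "potential v = (let B = int (card (arcs E)) + 2; N = Max (sink_dist ` verts E)
     in B ^ N - B ^ (N - sink_dist v))"

lemma potential_nonneg: "potential v \<ge> 0"
  by (simp add: potential_def Let_def power_increasing)

text \<open>With \<open>y = B ^ (N - sink_dist v)\<close>, the successor closer to the sink has
  potential at most \<open>B ^ N - B * y\<close>, and any other at most \<open>B ^ N - 1\<close>.
  The loss \<open>B * y\<close> exceeds the \<open>d * y\<close> available on the right, for
  outdegree \<open>d\<close>, because \<open>B\<close> is larger than the number of all
  edges.\<close>

lemma potential_topple: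
  assumes v: "v \<in> verts E" "v \<noteq> s"
  shows "(\<Sum>e\<in>out_arcs E v. potential (head E e)) < int (card (out_arcs E v)) * potential v"
proof -
  define B where "B = int (card (arcs E)) + 2"
  define N where "N = Max (sink_dist ` verts E)"
  have pot: "potential u = B ^ N - B ^ (N - sink_dist u)" for u
    by (simp add: potential_def B_def N_def Let_def)
  obtain e where e: "e \<in> out_arcs E v" "sink_dist v = Suc (sink_dist v - 1)"
      "sink_dist (head E e) \<le> sink_dist v - 1"
    using sink_dist_step[OF v] .
  \<comment> \<open>This makes the truncated subtraction \<open>N - sink_dist v\<close> exact, so
    that a factor \<open>B\<close> corresponds to one step towards the sink.\<close>
  have N: "sink_dist v \<le> N"
    unfolding N_def using v by (intro Max_ge) auto
  define y where "y = B ^ (N - sink_dist v)"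
  have B1: "B > 1"
    by (simp add: B_def)
  have "B * y = B ^ (N - (sink_dist v - 1))"
    unfolding y_def power_Suc[symmetric] using e(2) N by (intro arg_cong[of _ _ "(^) B"]) linarith
  also have "\<dots> \<le> B ^ (N - sink_dist (head E e))"
    using e(3) B1 by (intro power_increasing) auto
  finally have 1: "potential (head E e) \<le> B ^ N - B * y"
    by (simp add: pot)
  have "(\<Sum>f\<in>out_arcs E v - {e}. potential (head E f)) \<le> (\<Sum>f\<in>out_arcs E v - {e}. B ^ N - 1)"
    using B1 by (intro sum_mono) (simp add: pot)
  also have "\<dots> = (int (card (out_arcs E v)) - 1) * (B ^ N - 1)"
  proof -
    have "card (out_arcs E v) > 0"
      using e(1) finite_out_arcs[of v] card_gt_0_iff by blast
    then show ?thesis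
      using e(1) by (simp add: card_Diff_singleton of_nat_diff Suc_leI)
  qed
  finally have 2: "(\<Sum>f\<in>out_arcs E v - {e}. potential (head E f)) \<le> (int (card (out_arcs E v)) - 1) * (B ^ N - 1)" .
  have "card (out_arcs E v) \<le> card (arcs E)"
    by (intro card_mono) (auto simp: out_arcs_def)
  then have "int (card (out_arcs E v)) + 1 \<le> B"
    by (simp add: B_def)
  moreover have y1: "y \<ge> 1"
    using B1 by (simp add: y_def)
  ultimately have 3: "(int (card (out_arcs E v)) + 1) * y \<le> B * y"
    by (intro mult_right_mono) auto
  have "(\<Sum>e\<in>out_arcs E v. potential (head E e)) =
      potential (head E e) + (\<Sum>f\<in>out_arcs E v - {e}. potential (head E f))"
    using e(1) by (intro sum.remove) auto
  also have "\<dots> \<le> B ^ N - B * y + (int (card (out_arcs E v)) - 1) * (B ^ N - 1)"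
    using 1 2 by linarith
  also have "\<dots> < int (card (out_arcs E v)) * (B ^ N - y)"
  proof -
    have "card (out_arcs E v) > 0"
      using e(1) finite_out_arcs[of v] card_gt_0_iff by blast
    then show ?thesis
      using 3 y1 by (simp add: algebra_simps)
  qed
  finally show ?thesis
    by (simp add: pot y_def)
qed

text \<open>Stabilization: an overfull vertex is toppled, which lowers the total potential. What
  remains is a representative in a finite box, so the monoid is finite.\<close>

lemma sandpile_cong_stable:
  assumes "a \<in> FM"
  shows "\<exists>b. (a, b) \<in> R \<and> (\<forall>v. count b v \<le> card (arcs E))"
  using assms
proof (induction a rule: measure_induct_rule[of "\<lambda>a. nat (\<Sum>v\<in>#a. potential v)"])
  case (less a)
  show ?case
  proof (cases "\<exists>v. v \<noteq> s \<and> card (out_arcs E v) < count a v")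
    case True
    then obtain v where v: "v \<noteq> s" "card (out_arcs E v) < count a v"
      by blast
    define d where "d = card (out_arcs E v)"
    have "v \<in># a"
      using v(2) by (metis count_greater_zero_iff gr_implies_not0 gr_zeroI)
    then have vE: "v \<in> verts E"
      using less.prems by auto
    define a' where "a' = a - replicate_mset d v"
    have a: "a = replicate_mset d v + a'"
      using v(2) unfolding a'_def d_def
    by (intro multiset_eqI) auto
    have a'FM: "set_mset a' \<subseteq> verts E"
      using less.prems a by auto
    define b where "b = image_mset (head E) (mset_set (out_arcs E v)) + a'"
    have ab: "(a, b) \<in> R"
      unfolding a b_def d_def using vE v(1) a'FM by (intro sandpile_cong.add sandpile_cong_topple)
    have nn: "(\<Sum>v\<in>#c. potential v) \<ge> 0" for c
      by (induction c) (auto simp: potential_nonneg)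
    have "(\<Sum>v\<in>#b. potential v) < (\<Sum>v\<in>#a. potential v)"
      using potential_topple[OF vE v(1)]
      by (simp add: a b_def d_def sum_unfold_sum_mset image_mset.compositionality comp_def)
    then have "nat (\<Sum>v\<in>#b. potential v) < nat (\<Sum>v\<in>#a. potential v)"
      using nn[of b] by linarith
    then show ?thesis
      using less.IH[of b] ab sandpile_cong_FM by (meson sandpile_cong.trans)
  next
    case False
    \<comment> \<open>Chips on the sink are never toppled and may be arbitrarily many; they are
      dropped because the sink is zero in the monoid.\<close>
    define b where "b = filter_mset (\<lambda>v. v \<noteq> s) a"
    have a: "a = repeat_mset (count a s) {#s#} + b"
      by (rule multiset_eqI) (simp add: b_def)
    have "(repeat_mset (count a s) {#s#} + b, repeat_mset (count a s) {#} + b) \<in> R"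
      using less.prems sandpile_cong_sink
      by (intro sandpile_cong.add sandpile_cong_repeat) (auto simp: b_def)
    then have "(a, b) \<in> R"
      using a by simp
    moreover have "count b v \<le> card (arcs E)" for v
    proof (cases "v = s")
      case False
      have "card (out_arcs E v) \<le> card (arcs E)"
        by (intro card_mono) (auto simp: out_arcs_def)
      then show ?thesis
        using False \<open>\<not> (\<exists>v. v \<noteq> s \<and> card (out_arcs E v) < count a v)\<close> by (force simp: b_def)
    qed (simp add: b_def)
    ultimately show ?thesis
      by blast
  qed
qed

lemma finite_classes: "finite (cls ` FM)"
proof -
  define T where "T = {b. set_mset b \<subseteq> verts E \<and> (\<forall>v. count b v \<le> card (arcs E))}"
  have "inj_on (\<lambda>b. restrict (count b) (verts E)) T"
  proof (rule inj_onI)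
    fix a b assume *: "a \<in> T" "b \<in> T" "restrict (count a) (verts E) = restrict (count b) (verts E)"
    show "a = b"
    proof (rule multiset_eqI)
      fix v show "count a v = count b v"
      proof (cases "v \<in> verts E")
        case True
        then show ?thesis using *(3) by (metis restrict_apply')
      next
        case False
        then show ?thesis using *(1,2) by (metis (no_types, lifting) T_def mem_Collect_eq not_in_iff subsetD)
      qed
    qed
  qed
  moreover have "(\<lambda>b. restrict (count b) (verts E)) ` T \<subseteq> (verts E \<rightarrow>\<^sub>E {..card (arcs E)})"
    by (auto simp: T_def)
  ultimately have "finite T"
    by (meson finite_PiE finite_atMost finite_imageD finite_subset finite_verts)
  moreover have "cls ` FM \<subseteq> cls ` T"
  proof
    fix x assume "x \<in> cls ` FM"
    then obtain a where a: "a \<in> FM" "x = cls a"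
      by blast
    then obtain b where "(a, b) \<in> R" "\<forall>v. count b v \<le> card (arcs E)"
      using sandpile_cong_stable by blast
    then show "x \<in> cls ` T"
      using a sandpile_cong_FM[of a b] cls_eq_iff[of a b] by (auto simp: T_def)
  qed
  ultimately show ?thesis
    using finite_subset by blast
qed

text \<open>The multiples of an element of a finite monoid are eventually periodic, and a positive
  multiple of the period that is beyond the preperiod gives an idempotent.\<close>

lemma idempotent_multiple:
  assumes a: "a \<in> FM"
  obtains m where "m > 0" "(repeat_mset m a + repeat_mset m a, repeat_mset m a) \<in> R"
proof -
  have FM: "repeat_mset n a \<in> FM" for n
    using a by (induction n) auto
  have "range (\<lambda>n. cls (repeat_mset n a)) \<subseteq> cls ` FM"
    using FM by blast
  then have "\<not> inj (\<lambda>n. cls (repeat_mset n a))"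
    using finite_classes finite_imageD[of "\<lambda>n. cls (repeat_mset n a)" UNIV] finite_subset infinite_UNIV_nat by blast
  then obtain i j where ij: "i < j" "cls (repeat_mset i a) = cls (repeat_mset j a)"
    by (metis (mono_tags, lifting) injI linorder_neqE_nat)
  define p where "p = j - i"
  have per: "(repeat_mset (n + k * p) a, repeat_mset n a) \<in> R" if "n \<ge> i" for n k
  proof (induction k)
    case 0
    show ?case using FM by (auto intro: sandpile_cong.refl)
  next
    case (Suc k)
    define l where "l = n + k * p - i"
    have "(repeat_mset j a + repeat_mset l a, repeat_mset i a + repeat_mset l a) \<in> R"
      using FM[of l] FM[of j] FM[of i] ij(2) cls_eq_iff[of "repeat_mset j a" "repeat_mset i a"]
      by (intro sandpile_cong.add) auto
    moreover have "j + l = n + Suc k * p" "i + l = n + k * p"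
      using that ij(1) by (auto simp: l_def p_def)
    ultimately have "(repeat_mset (n + Suc k * p) a, repeat_mset (n + k * p) a) \<in> R"
      using repeat_mset_distrib[of j l a] repeat_mset_distrib[of i l a] by simp
    then show ?case
      using Suc by (rule sandpile_cong.trans)
  qed
  have "p > 0"
    using ij(1) by (simp add: p_def)
  \<comment> \<open>A multiple of the period \<open>p\<close> that is at least the preperiod
    \<open>i\<close>; the factor \<open>Suc i\<close> keeps it positive also for
    \<open>i = 0\<close>. Doubling it adds \<open>Suc i\<close> whole periods.\<close>
  define m where "m = Suc i * p"
  have "m \<ge> i" "m > 0"
    using \<open>p > 0\<close> mult_le_mono2[of 1 p "Suc i"] by (auto simp: m_def)
  then have "(repeat_mset (m + m) a, repeat_mset m a) \<in> R"
    using per[of m "Suc i"] unfolding m_def by blast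
  then have "(repeat_mset m a + repeat_mset m a, repeat_mset m a) \<in> R"
    by (simp add: repeat_mset_distrib)
  then show ?thesis
    using that \<open>m > 0\<close> by blast
qed

subsection \<open>Idempotents and hereditary saturated sets\<close>

text \<open>The sink is always included: being zero in the monoid, it is absorbed by every
  element.\<close>

definition hs_closure :: "'v multiset \<Rightarrow> 'v set" where
  "hs_closure a = \<Inter> {H. hered_sat E H \<and> s \<in> H \<and> set_mset a \<subseteq> H}"

lemma hs_closure_subset: "hered_sat E H \<Longrightarrow> s \<in> H \<Longrightarrow> set_mset a \<subseteq> H \<Longrightarrow> hs_closure a \<subseteq> H"
  by (auto simp: hs_closure_def)

lemma set_mset_hs_closure: "set_mset a \<subseteq> hs_closure a"
  by (auto simp: hs_closure_def)

lemma hered_sat_hs_closure: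
  assumes "a \<in> FM"
  shows "hered_sat E (hs_closure a)" "s \<in> hs_closure a"
proof -
  show "s \<in> hs_closure a"
    by (auto simp: hs_closure_def)
  show "hered_sat E (hs_closure a)"
    unfolding hered_sat_def
  proof (intro conjI ballI impI)
    \<comment> \<open>Here \<open>a\<close> has to live on \<open>verts E\<close>: then
      \<open>verts E\<close> belongs to the family, which is therefore not empty.\<close>
    show "hs_closure a \<subseteq> verts E"
      using hs_closure_subset[OF hered_sat_verts sink_in_verts, of a] assms by simp
  next
    fix e assume e: "e \<in> arcs E" "tail E e \<in> hs_closure a"
    have "head E e \<in> H" if "hered_sat E H" "s \<in> H" "set_mset a \<subseteq> H" for H
      using hered_satD(2)[OF that(1) e(1)] hs_closure_subset[OF that] e(2) by blast
    then show "head E e \<in> hs_closure a"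
      unfolding hs_closure_def by blast
  next
    fix v assume v: "v \<in> verts E" "out_arcs E v \<noteq> {}" "head E ` out_arcs E v \<subseteq> hs_closure a"
    have "v \<in> H" if H: "hered_sat E H" "s \<in> H" "set_mset a \<subseteq> H" for H
    proof -
      have "head E ` out_arcs E v \<subseteq> H"
        using hs_closure_subset[OF H] v(3) by (rule subset_trans[rotated])
      then show ?thesis
        using v(1,2) H(1) unfolding hered_sat_def by blast
    qed
    then show "v \<in> hs_closure a"
      unfolding hs_closure_def by blast
  qed
qed

text \<open>A toppling relation has support \<open>{v}\<close> on one side and the successors of
  \<open>v\<close> on the other. Heredity and saturation are precisely the two directions of the
  equivalence between \<open>v\<close> lying in \<open>H\<close> and all its successors lying in
  \<open>H\<close>.\<close>

lemma sandpile_cong_hered_sat: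
  assumes "(a, b) \<in> R" "hered_sat E H" "s \<in> H"
  shows "set_mset a \<subseteq> H \<longleftrightarrow> set_mset b \<subseteq> H"
  using assms(1)
proof (induction rule: sandpile_cong.induct)
  case (rel a b)
  then consider "a = {#s#}" "b = {#}"
    | v where "v \<in> verts E" "v \<noteq> s" "a = replicate_mset (card (out_arcs E v)) v"
        "b = image_mset (head E) (mset_set (out_arcs E v))"
    by (auto simp: sandpile_relations_def)
  then show ?case
  proof cases
    case 2
    have "card (out_arcs E v) > 0"
      using out_arcs_nonsink[OF 2(1,2)] card_gt_0_iff[of "out_arcs E v"] by auto
    then have "set_mset a = {v}"
      by (simp add: 2)
    moreover have "set_mset b = head E ` out_arcs E v"
      by (simp add: 2 finite_out_arcs)
    moreover have "v \<in> H \<longleftrightarrow> head E ` out_arcs E v \<subseteq> H"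
    proof
      assume "v \<in> H"
      then show "head E ` out_arcs E v \<subseteq> H"
        using hered_satD(2)[OF assms(2)] by auto
    next
      assume "head E ` out_arcs E v \<subseteq> H"
      then show "v \<in> H"
        using assms(2) 2(1) out_arcs_nonsink[OF 2(1,2)] unfolding hered_sat_def by blast
    qed
    ultimately show ?thesis
      by simp
  qed (use assms(3) in auto)
qed auto

lemma hs_closure_cong: "(a, b) \<in> R \<Longrightarrow> hs_closure a = hs_closure b"
  unfolding hs_closure_def by (intro arg_cong[of _ _ Inter] Collect_cong) (use sandpile_cong_hered_sat in blast)

text \<open>The algebraic preorder of the monoid, on representatives. Two elements belong to the
  same archimedean component when each is below a multiple of the other.\<close>

definition absorbed :: "'v multiset \<Rightarrow> 'v multiset \<Rightarrow> bool" where
  "absorbed x y \<longleftrightarrow> (\<exists>z\<in>FM. (x + z, y) \<in> R)"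

lemma absorbed_refl: "x \<in> FM \<Longrightarrow> absorbed x x"
  unfolding absorbed_def by (intro bexI[of _ "{#}"]) (auto intro: sandpile_cong.refl)

lemma absorbed_add: "x \<in> FM \<Longrightarrow> y \<in> FM \<Longrightarrow> absorbed x (x + y)"
  unfolding absorbed_def by (intro bexI[of _ y] sandpile_cong.refl) auto

lemma absorbed_cong: "absorbed x y \<Longrightarrow> (y, y') \<in> R \<Longrightarrow> absorbed x y'"
  unfolding absorbed_def by (meson sandpile_cong.trans)

lemma absorbed_cong':
  assumes "absorbed x y" "(x', x) \<in> R"
  shows "absorbed x' y"
proof -
  obtain z where z: "z \<in> FM" "(x + z, y) \<in> R"
    using assms(1) by (auto simp: absorbed_def)
  have "(x' + z, x + z) \<in> R"
    using assms(2) z(1) by (intro sandpile_cong.add) auto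
  then show ?thesis
    unfolding absorbed_def using z(1) sandpile_cong.trans[OF _ z(2)] by (intro bexI[of _ z])
qed

lemma absorbed_trans:
  assumes "absorbed x y" "absorbed y z"
  shows "absorbed x z"
proof -
  obtain u v where uv: "u \<in> FM" "v \<in> FM" "(x + u, y) \<in> R" "(y + v, z) \<in> R"
    using assms by (auto simp: absorbed_def)
  have "(x + u + v, y + v) \<in> R"
    using uv by (intro sandpile_cong.add) auto
  from sandpile_cong.trans[OF this uv(4)] have "(x + (u + v), z) \<in> R"
    by (simp add: add.assoc)
  then show ?thesis
    unfolding absorbed_def using uv by (intro bexI[of _ "u + v"]) auto
qed

lemma absorbed_add2:
  assumes "absorbed x y" "absorbed x' y'"
  shows "absorbed (x + x') (y + y')"
proof -
  obtain u v where uv: "u \<in> FM" "v \<in> FM" "(x + u, y) \<in> R" "(x' + v, y') \<in> R"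
    using assms by (auto simp: absorbed_def)
  then have "((x + x') + (u + v), y + y') \<in> R"
    using sandpile_cong_add2[OF uv(3,4)] by (simp add: ac_simps)
  then show ?thesis
    unfolding absorbed_def using uv by (intro bexI[of _ "u + v"]) auto
qed

lemma absorbed_repeat: "absorbed x y \<Longrightarrow> absorbed (repeat_mset n x) (repeat_mset n y)"
  by (induction n) (auto intro: absorbed_add2 absorbed_refl)

lemma absorbed_member: "x \<in> FM \<Longrightarrow> v \<in># x \<Longrightarrow> absorbed {#v#} x"
  using absorbed_add[of "{#v#}" "x - {#v#}"] by (auto dest: in_diffD)

text \<open>A successor of \<open>v\<close> is a summand of the outdegree times \<open>v\<close>, so
  a bound for \<open>v\<close> gives one for it after multiplication by the outdegree. Conversely
  \<open>v\<close> is below its outdegree times itself, that is below the sum of its successors, and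
  their bounds add up.\<close>

lemma hered_sat_absorbed:
  assumes a: "a \<in> FM"
  shows "hered_sat E {u \<in> verts E. \<exists>k. absorbed {#u#} (repeat_mset k a)}" (is "hered_sat E ?H")
  unfolding hered_sat_def
proof (intro conjI ballI impI)
  fix e assume e: "e \<in> arcs E" "tail E e \<in> ?H"
  then obtain k where k: "absorbed {#tail E e#} (repeat_mset k a)"
    by blast
  let ?v = "tail E e" and ?d = "card (out_arcs E (tail E e))"
  have v: "?v \<in> verts E" "?v \<noteq> s"
    using e out_arcs_sink by (auto simp: out_arcs_def)
  let ?b = "image_mset (head E) (mset_set (out_arcs E ?v))"
  have *: "(replicate_mset ?d ?v, ?b) \<in> R"
    using v by (rule sandpile_cong_topple)
  have "absorbed {#head E e#} ?b"
    using e(1) sandpile_cong_FM[OF *] by (intro absorbed_member) (auto simp: finite_out_arcs)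
  moreover have "absorbed ?b (repeat_mset ?d (repeat_mset k a))"
  proof (rule absorbed_cong'[OF absorbed_repeat[OF k] sandpile_cong.sym])
    show "(repeat_mset ?d {#?v#}, ?b) \<in> R"
      using * by simp
  qed
  ultimately have "absorbed {#head E e#} (repeat_mset (?d * k) a)"
    unfolding repeat_mset_right by (rule absorbed_trans)
  then show "head E e \<in> ?H"
    using e(1) by auto
next
  fix v assume v: "v \<in> verts E" "out_arcs E v \<noteq> {}" "head E ` out_arcs E v \<subseteq> ?H"
  have *: "\<exists>k. absorbed (image_mset (head E) (mset_set X)) (repeat_mset k a)"
    if "finite X" "head E ` X \<subseteq> ?H" for X
    using that
  proof (induction X rule: finite_induct)
    case empty
    show ?case using absorbed_refl[of "{#}"] by (intro exI[of _ 0]) auto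
  next
    case (insert e X)
    from insert.IH insert.prems obtain k where k: "absorbed (image_mset (head E) (mset_set X)) (repeat_mset k a)"
      by blast
    from insert.prems obtain l where l: "absorbed {#head E e#} (repeat_mset l a)"
      by blast
    have "absorbed ({#head E e#} + image_mset (head E) (mset_set X)) (repeat_mset (l + k) a)"
      unfolding repeat_mset_distrib using l k by (rule absorbed_add2)
    then show ?case
      using insert(1,2) by auto
  qed
  obtain k where k: "absorbed (image_mset (head E) (mset_set (out_arcs E v))) (repeat_mset k a)"
    using *[OF finite_out_arcs v(3)] by blast
  have "v \<noteq> s"
    using v(2) out_arcs_sink by auto
  then have *: "(replicate_mset (card (out_arcs E v)) v, image_mset (head E) (mset_set (out_arcs E v))) \<in> R"
    using v(1) sandpile_cong_topple by blast
  have "card (out_arcs E v) > 0"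
    using v(2) card_gt_0_iff[of "out_arcs E v"] by auto
  then have "absorbed {#v#} (replicate_mset (card (out_arcs E v)) v)"
    using v(1) by (intro absorbed_member) (auto split: if_splits)
  then have "absorbed {#v#} (repeat_mset k a)"
    using absorbed_trans[OF absorbed_cong[OF _ *] k] by blast
  then show "v \<in> ?H"
    using v(1) by blast
qed auto

text \<open>The vertices below some multiple of \<open>a\<close> form a hereditary saturated set
  containing \<open>a\<close> and the sink, hence all of the closure. As \<open>a\<close> is
  idempotent, the multiples that bound \<open>b\<close> collapse to \<open>a\<close>.\<close>

lemma idempotent_absorbs:
  assumes a: "a \<in> FM" "(a + a, a) \<in> R" and b: "set_mset b \<subseteq> hs_closure a"
  shows "absorbed b a"
proof -
  let ?H = "{u \<in> verts E. \<exists>k. absorbed {#u#} (repeat_mset k a)}"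
  have "absorbed {#s#} (repeat_mset 0 a)"
    unfolding absorbed_def using sandpile_cong_sink by (intro bexI[of _ "{#}"]) auto
  then have "s \<in> ?H"
    using sink_in_verts by blast
  moreover have "absorbed {#u#} (repeat_mset 1 a)" if "u \<in># a" for u
    using absorbed_member[OF a(1) that] by simp
  then have "set_mset a \<subseteq> ?H"
    using a(1) by (intro subsetI CollectI conjI exI[of _ "1::nat"]) auto
  ultimately have "hs_closure a \<subseteq> ?H"
    using hered_sat_absorbed[OF a(1)] by (intro hs_closure_subset)
  with b have "\<exists>k. absorbed b (repeat_mset k a)"
  proof (induction b)
    case empty
    show ?case using absorbed_refl[of "{#}"] by (intro exI[of _ 0]) auto
  next
    case (add u b)
    from add.IH add.prems obtain k where k: "absorbed b (repeat_mset k a)"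
      by auto
    from add.prems obtain l where l: "absorbed {#u#} (repeat_mset l a)"
      by auto
    have "absorbed ({#u#} + b) (repeat_mset (l + k) a)"
      unfolding repeat_mset_distrib using l k by (rule absorbed_add2)
    then show ?case
      by auto
  qed
  then obtain k where "absorbed b (repeat_mset k a)"
    by blast
  moreover have FM: "repeat_mset k a \<in> FM"
    using a(1) by (induction k) auto
  \<comment> \<open>One more copy of \<open>a\<close> is added because \<open>k\<close> may be 0,
    and the empty multiple need not be congruent to \<open>a\<close>.\<close>
  ultimately have "absorbed b (repeat_mset k a + a)"
    using absorbed_trans absorbed_add[OF FM a(1)] by blast
  moreover have "(repeat_mset n a + a, a) \<in> R" for n
  proof (induction n)
    case 0
    show ?case using a(1) by (auto intro: sandpile_cong.refl)
  next
    case (Suc n)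
    then have "(a + (repeat_mset n a + a), a + a) \<in> R"
      using a(1) by (intro sandpile_cong_add2) (auto intro: sandpile_cong.refl)
    then have "(repeat_mset (Suc n) a + a, a + a) \<in> R"
      by (simp add: ac_simps)
    then show ?case
      using a(2) by (rule sandpile_cong.trans)
  qed
  ultimately show ?thesis
    by (rule absorbed_cong)
qed

text \<open>If \<open>x\<close> is idempotent and \<open>y = x + z\<close>, then
  \<open>x + y = y\<close>. For two idempotents below each other, \<open>a + b\<close> therefore
  equals both.\<close>

lemma idempotents_eq_if_absorbed:
  assumes "(a + a, a) \<in> R" "(b + b, b) \<in> R" "absorbed a b" "absorbed b a"
  shows "(a, b) \<in> R"
proof -
  have *: "(x + y, y) \<in> R" if xx: "(x + x, x) \<in> R" and ab: "absorbed x y" for x y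
  proof -
    obtain z where z: "z \<in> FM" "(x + z, y) \<in> R"
      using ab by (auto simp: absorbed_def)
    have x: "x \<in> FM"
      using xx sandpile_cong_FM by blast
    have "(x + y, x + (x + z)) \<in> R"
      using z x by (intro sandpile_cong_add2 sandpile_cong.sym[OF z(2)]) (auto intro: sandpile_cong.refl)
    moreover have "((x + x) + z, x + z) \<in> R"
      using xx z(1) by (intro sandpile_cong.add) auto
    ultimately have "(x + y, x + z) \<in> R"
      unfolding add.assoc by (rule sandpile_cong.trans)
    then show ?thesis
      using z(2) by (rule sandpile_cong.trans)
  qed
  have "(a + b, a) \<in> R" "(a + b, b) \<in> R"
    using *[of a b] *[of b a] assms by (simp_all add: add.commute)
  then show ?thesis
    by (rule sandpile_cong.trans[OF sandpile_cong.sym])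
qed

text \<open>Closures classify the idempotents. Each set \<open>H\<close> arises from an idempotent
  multiple of the sum of its elements, and two idempotents with the same closure absorb each
  other.\<close>

lemma card_idempotents: "card (idempotents (SP E s)) = card {H. hered_sat E H \<and> s \<in> H}"
proof -
  let ?I = "{a \<in> FM. (a + a, a) \<in> R}"
  have "hs_closure ` ?I = {H. hered_sat E H \<and> s \<in> H}"
  proof (intro equalityI subsetI)
    fix H assume "H \<in> hs_closure ` ?I"
    then obtain a where "a \<in> FM" "H = hs_closure a"
      by auto
    then show "H \<in> {H. hered_sat E H \<and> s \<in> H}"
      using hered_sat_hs_closure[of a] by simp
  next
    fix H assume H: "H \<in> {H. hered_sat E H \<and> s \<in> H}"
    then have HE: "H \<subseteq> verts E" "finite H"
      using hered_satD(1)[of E H] finite_subset[of H, OF _ finite_verts] by auto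
    let ?a = "mset_set H"
    have aFM: "?a \<in> FM"
      using HE by simp
    obtain m where m: "m > 0" "(repeat_mset m ?a + repeat_mset m ?a, repeat_mset m ?a) \<in> R"
      using idempotent_multiple[OF aFM] .
    \<comment> \<open>Positivity of \<open>m\<close> enters here: the zero multiple would have empty
      support.\<close>
    have set: "set_mset (repeat_mset m ?a) = H"
      using m(1) HE(2) unfolding set_mset_def by simp
    have "hs_closure (repeat_mset m ?a) \<subseteq> H"
      using H by (intro hs_closure_subset) (simp_all only: set mem_Collect_eq order_refl)
    moreover have "H \<subseteq> hs_closure (repeat_mset m ?a)"
      using set_mset_hs_closure[of "repeat_mset m ?a"] unfolding set .
    moreover have "repeat_mset m ?a \<in> ?I"
      using m(2) HE(1) by (simp only: mem_Collect_eq set)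
    ultimately show "H \<in> hs_closure ` ?I"
      by (metis (no_types, lifting) image_eqI subset_antisym)
  qed
  moreover have "(hs_closure a = hs_closure b) \<longleftrightarrow> cls a = cls b" if "a \<in> ?I" "b \<in> ?I" for a b
  proof -
    have ab: "a \<in> FM" "b \<in> FM" "(a + a, a) \<in> R" "(b + b, b) \<in> R"
      using that by auto
    show ?thesis
      unfolding cls_eq_iff[OF ab(1,2)]
    proof
      assume eq: "hs_closure a = hs_closure b"
      have "absorbed a b"
        using idempotent_absorbs[OF ab(2,4), of a] set_mset_hs_closure[of a] eq by simp
      moreover have "absorbed b a"
        using idempotent_absorbs[OF ab(1,3), of b] set_mset_hs_closure[of b] eq by simp
      ultimately show "(a, b) \<in> R"
        by (rule idempotents_eq_if_absorbed[OF ab(3,4)])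
    qed (rule hs_closure_cong)
  qed
  then have "card (hs_closure ` ?I) = card (cls ` ?I)"
    by (rule card_image_eq_if_same_fibres)
  ultimately show ?thesis
    by (simp add: idempotents_SP)
qed

text \<open>The empty set and the full vertex set are always hereditary and saturated, so the number
  two means that they differ and that there is no third one.\<close>

theorem two_idempotents_iff: "card (idempotents (SP E s)) = 2 \<longleftrightarrow> hered_sat_trivial cyc_part"
proof -
  let ?S = "no_cycle_verts E"
  let ?A = "{H. hered_sat E H \<and> s \<in> H}" and ?B = "{H. hered_sat cyc_part H}"
  have SA: "?S \<subseteq> H" if "H \<in> ?A" for H
    using that no_cycle_verts_subset[of H] unique_sink by simp
  have sS: "s \<in> ?S"
  proof -
    have "\<not> s \<rightarrow>\<^sup>+\<^bsub>E\<^esub> u" for u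
    proof
      assume "s \<rightarrow>\<^sup>+\<^bsub>E\<^esub> u"
      then obtain p where "awalk s p u" "p \<noteq> []"
        by (auto simp: reachable1_awalk)
      then show False
        using out_arcs_sink by (cases p) (auto simp: awalk_Cons_iff out_arcs_def)
    qed
    then have "\<not> connects_to_cycle E s"
      unfolding connects_to_cycle_iff using reachable_reachable1_trans by blast
    then show ?thesis
      using sink_in_verts by (simp add: no_cycle_verts_def)
  qed
  have "bij_betw (\<lambda>H. H - ?S) ?A ?B"
  proof (rule bij_betwI[where g = "\<lambda>H. H \<union> ?S"])
    show "(\<lambda>H. H - ?S) \<in> ?A \<rightarrow> ?B"
    proof
      fix H assume H: "H \<in> ?A"
      then show "H - ?S \<in> ?B"
        using hered_sat_cyc_part_iff[OF SA[OF H]] unique_sink by simp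
    qed
    show "(\<lambda>H. H \<union> ?S) \<in> ?B \<rightarrow> ?A"
    proof
      fix H assume H: "H \<in> ?B"
      then have "H \<union> ?S - ?S = H"
        using hered_satD(1)[of cyc_part H] unfolding cyc_part_simps by blast
      then show "H \<union> ?S \<in> ?A"
        using hered_sat_cyc_part_iff[of "H \<union> ?S"] H sS unique_sink by simp
    qed
    show "H - ?S \<union> ?S = H" if "H \<in> ?A" for H
      using SA[OF that] by blast
    show "H \<union> ?S - ?S = H" if "H \<in> ?B" for H
      using that hered_satD(1)[of cyc_part H] unfolding cyc_part_simps by blast
  qed
  then have "card (idempotents (SP E s)) = card ?B"
    unfolding card_idempotents by (rule bij_betw_same_card)
  moreover have "card ?B = 2 \<longleftrightarrow> hered_sat_trivial cyc_part"
  proof -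
    interpret F: fin_digraph cyc_part
      using fin_digraph_quotient_graph fin_digraph_axioms by blast
    have V: "verts cyc_part \<in> ?B" "{} \<in> ?B"
      using F.hered_sat_verts hered_sat_empty by blast+
    show ?thesis
    proof
      assume "card ?B = 2"
      then obtain X Y where XY: "?B = {X, Y}" "X \<noteq> Y"
        by (auto simp: card_2_iff)
      have "verts cyc_part \<noteq> {}"
      proof
        assume "verts cyc_part = {}"
        then have "?B \<subseteq> {{}}"
          using hered_satD(1)[of cyc_part] by auto
        then show False
          using XY by auto
      qed
      then show "hered_sat_trivial cyc_part"
        using XY V unfolding hered_sat_trivial_def by auto
    next
      assume "hered_sat_trivial cyc_part"
      then have "?B = {{}, verts cyc_part}" "verts cyc_part \<noteq> {}"
        using V unfolding hered_sat_trivial_def by auto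
      then show "card ?B = 2"
        by (auto simp: card_2_iff)
    qed
  qed
  ultimately show ?thesis
    by simp
qed

end

section \<open>Purely infinite rings\<close>

context ring
begin

lemma right_ideal_image:
  assumes p: "p \<in> carrier R"
  shows "right_ideal ((\<lambda>x. p \<otimes> x) ` carrier R) R"
  unfolding right_ideal_def
proof (intro conjI ballI)
  show "additive_subgroup ((\<lambda>x. p \<otimes> x) ` carrier R) R"
  proof (rule additive_subgroupI, rule add.subgroupI)
    fix a assume "a \<in> (\<lambda>x. p \<otimes> x) ` carrier R"
    then obtain x where x: "x \<in> carrier R" "a = p \<otimes> x"
      by blast
    then have "\<ominus> a = p \<otimes> (\<ominus> x)"
      using p by (simp add: r_minus)
    then show "\<ominus> a \<in> (\<lambda>x. p \<otimes> x) ` carrier R"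
      using x by blast
    fix b assume "b \<in> (\<lambda>x. p \<otimes> x) ` carrier R"
    then obtain y where y: "y \<in> carrier R" "b = p \<otimes> y"
      by blast
    then have "a \<oplus> b = p \<otimes> (x \<oplus> y)"
      using x p by (simp add: r_distr)
    then show "a \<oplus> b \<in> (\<lambda>x. p \<otimes> x) ` carrier R"
      using x y by blast
  qed (use p in auto)
next
  fix a x assume "a \<in> (\<lambda>x. p \<otimes> x) ` carrier R" "x \<in> carrier R"
  then show "a \<otimes> x \<in> (\<lambda>x. p \<otimes> x) ` carrier R"
    using p by (force simp: m_assoc)
qed

text \<open>Put \<open>p = s t\<close>, an idempotent with \<open>e p = p = p e\<close>, and
  \<open>q = e - p\<close>, which is not zero. Then \<open>eR\<close> is the direct sum of
  \<open>pR\<close> and \<open>qR\<close>, and left multiplication by \<open>s\<close> maps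
  \<open>eR\<close> isomorphically onto \<open>pR\<close>, with inverse \<open>t\<close>.\<close>

lemma infinite_idempotentI:
  assumes C: "e \<in> carrier R" "s \<in> carrier R" "t \<in> carrier R"
    and ee: "e \<otimes> e = e" and ts: "t \<otimes> s = e"
    and es: "e \<otimes> s = s" "s \<otimes> e = s" and et: "e \<otimes> t = t" "t \<otimes> e = t"
    and ne: "s \<otimes> t \<noteq> e"
  shows "infinite_idempotent R e"
proof -
  define p where "p = s \<otimes> t"
  define q where "q = e \<ominus> p"
  have pC: "p \<in> carrier R" and qC: "q \<in> carrier R"
    using C by (auto simp: p_def q_def)
  have ep: "e \<otimes> p = p"
    unfolding p_def using C es m_assoc[of e s t] by simp
  have pe: "p \<otimes> e = p"
    unfolding p_def using C et m_assoc[of s t e] by simp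
  have ps: "p \<otimes> s = s"
    unfolding p_def using C es ts m_assoc[of s t s] by simp
  have pp: "p \<otimes> p = p"
    using ps C m_assoc[of p s t] pC by (simp add: p_def)
  have pq: "p \<otimes> q = \<zero>"
    unfolding q_def using pC C pe pp by (simp add: minus_eq r_distr r_minus r_neg)
  have eq: "e \<otimes> q = q"
    unfolding q_def using pC C ep ee by (simp add: minus_eq r_distr r_minus)
  have split: "p \<oplus> q = e"
    unfolding q_def minus_eq using pC C by (metis a_assoc a_comm a_inv_closed r_neg r_zero)
  let ?A = "(\<lambda>x. p \<otimes> x) ` carrier R" and ?B = "(\<lambda>x. q \<otimes> x) ` carrier R"
    and ?E = "(\<lambda>x. e \<otimes> x) ` carrier R"
  have "?A \<inter> ?B = {\<zero>}"
  proof (intro equalityI subsetI)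
    fix z assume "z \<in> ?A \<inter> ?B"
    then obtain x y where xy: "x \<in> carrier R" "z = p \<otimes> x" "y \<in> carrier R" "z = q \<otimes> y"
      by blast
    have "p \<otimes> z = z"
      using xy(1,2) pC pp by (simp add: m_assoc[symmetric])
    moreover have "p \<otimes> z = \<zero>"
      using xy(3,4) pC qC pq by (simp add: m_assoc[symmetric])
    ultimately show "z \<in> {\<zero>}"
      by simp
  next
    fix z assume "z \<in> {\<zero>}"
    then show "z \<in> ?A \<inter> ?B"
      using pC qC by (auto intro!: image_eqI[of _ _ \<zero>])
  qed
  moreover have "?B \<noteq> {\<zero>}"
  proof
    assume "?B = {\<zero>}"
    moreover have "q \<in> ?B"
      using qC by (intro image_eqI[of _ _ \<one>]) auto
    ultimately have "q = \<zero>"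
      by blast
    then show False
      using split pC ne by (simp add: p_def)
  qed
  moreover have "?A <+>\<^bsub>R\<^esub> ?B = ?E"
  proof (intro equalityI subsetI)
    fix z assume "z \<in> ?A <+>\<^bsub>R\<^esub> ?B"
    then obtain x y where xy: "x \<in> carrier R" "y \<in> carrier R" "z = p \<otimes> x \<oplus> q \<otimes> y"
      by (auto simp: set_add_def')
    then have "z = e \<otimes> z"
      using pC qC C ep eq by (simp add: r_distr m_assoc[symmetric])
    moreover have "z \<in> carrier R"
      using xy pC qC by simp
    ultimately show "z \<in> ?E"
      by blast
  next
    fix z assume "z \<in> ?E"
    then obtain x where x: "x \<in> carrier R" "z = e \<otimes> x"
      by blast
    then have "z = p \<otimes> x \<oplus> q \<otimes> x"
      using pC qC by (simp add: split[symmetric] l_distr)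
    then show "z \<in> ?A <+>\<^bsub>R\<^esub> ?B"
      using x(1) by (auto simp: set_add_def')
  qed
  moreover have "right_module_iso R ?E ?A"
    unfolding right_module_iso_def
  proof (intro exI conjI ballI)
    show "bij_betw (\<lambda>z. s \<otimes> z) ?E ?A"
    proof (rule bij_betwI[where g = "\<lambda>z. t \<otimes> z"])
      show "(\<lambda>z. s \<otimes> z) \<in> ?E \<rightarrow> ?A"
      proof
        fix z assume "z \<in> ?E"
        then have "z \<in> carrier R"
          using C by auto
        then have "s \<otimes> z = p \<otimes> (s \<otimes> z)"
          using ps C pC by (simp add: m_assoc[symmetric])
        then show "s \<otimes> z \<in> ?A"
          using C \<open>z \<in> carrier R\<close> by blast
      qed
      show "(\<lambda>z. t \<otimes> z) \<in> ?A \<rightarrow> ?E"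
      proof
        fix z assume "z \<in> ?A"
        then have "z \<in> carrier R"
          using pC by auto
        then have "t \<otimes> z = e \<otimes> (t \<otimes> z)"
          using et C by (simp add: m_assoc[symmetric])
        then show "t \<otimes> z \<in> ?E"
          using C \<open>z \<in> carrier R\<close> by blast
      qed
      show "t \<otimes> (s \<otimes> z) = z" if z: "z \<in> ?E" for z
      proof -
        obtain x where x: "x \<in> carrier R" "z = e \<otimes> x"
          using z by blast
        have "t \<otimes> (s \<otimes> z) = e \<otimes> z"
          using C x ts by (simp add: m_assoc[symmetric])
        then show ?thesis
          using C x ee by (simp add: m_assoc[symmetric])
      qed
      show "s \<otimes> (t \<otimes> z) = z" if z: "z \<in> ?A" for z
      proof -
        obtain x where x: "x \<in> carrier R" "z = p \<otimes> x"
          using z by blast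
        have "s \<otimes> (t \<otimes> z) = p \<otimes> z"
          using C x pC by (simp add: m_assoc[symmetric] p_def[symmetric])
        then show ?thesis
          using pC x pp by (simp add: m_assoc[symmetric])
      qed
    qed
    fix a assume a: "a \<in> ?E"
    then have aC: "a \<in> carrier R"
      using C by auto
    show "s \<otimes> (a \<oplus> b) = s \<otimes> a \<oplus> s \<otimes> b" if "b \<in> ?E" for b
      using that aC C by (auto simp: r_distr)
    show "s \<otimes> (a \<otimes> x) = s \<otimes> a \<otimes> x" if "x \<in> carrier R" for x
      using that aC C by (simp add: m_assoc)
  qed
  ultimately show ?thesis
    unfolding infinite_idempotent_def using C(1) ee right_ideal_image[OF pC] right_ideal_image[OF qC] by blast
qed

text \<open>For \<open>X = w x\<close> and \<open>Y = a y w\<close> one has \<open>X Y = w\<close>,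
  so mapping \<open>u\<close> to \<open>Y u X\<close> is multiplicative on the corner
  \<open>wRw\<close> and takes values in \<open>aR\<close>, hence in \<open>J\<close>. It is
  injective there because \<open>X (Y u X) Y = w u w\<close>. Thus the proper isometry
  \<open>c\<close>, \<open>d\<close> of \<open>w\<close> is transported to an idempotent inside
  \<open>J\<close>.\<close>

lemma right_ideal_infinite_idempotent:
  assumes J: "right_ideal J R" "a \<in> J"
    and C: "x \<in> carrier R" "y \<in> carrier R" "c \<in> carrier R" "d \<in> carrier R" "w \<in> carrier R"
    and w: "x \<otimes> a \<otimes> y = w" "w \<otimes> w = w"
    and cd: "d \<otimes> c = w" "c \<otimes> w = c" "w \<otimes> c = c" "d \<otimes> w = d" "w \<otimes> d = d" "c \<otimes> d \<noteq> w"
  shows "\<exists>e\<in>J. infinite_idempotent R e"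
proof -
  have aC: "a \<in> carrier R"
    using J additive_subgroup.a_subset unfolding right_ideal_def by blast
  define X Y where "X = w \<otimes> x" and "Y = a \<otimes> (y \<otimes> w)"
  have XC: "X \<in> carrier R" and YC: "Y \<in> carrier R"
    using C aC by (auto simp: X_def Y_def)
  have "X \<otimes> Y = w \<otimes> ((x \<otimes> a \<otimes> y) \<otimes> w)"
    unfolding X_def Y_def using C aC by (simp add: m_assoc)
  then have XY: "X \<otimes> Y = w"
    by (simp add: w)
  have wX: "w \<otimes> X = X"
    unfolding X_def using C w by (simp add: m_assoc[symmetric])
  have mid: "(Y \<otimes> u \<otimes> X) \<otimes> (Y \<otimes> v \<otimes> X) = Y \<otimes> (u \<otimes> w \<otimes> v) \<otimes> X"
    if uv: "u \<in> carrier R" "v \<in> carrier R" for u v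
  proof -
    have "(Y \<otimes> u \<otimes> X) \<otimes> (Y \<otimes> v \<otimes> X) = Y \<otimes> (u \<otimes> (X \<otimes> Y) \<otimes> v) \<otimes> X"
      using uv XC YC by (simp add: m_assoc)
    then show ?thesis
      by (simp add: XY)
  qed
  let ?e = "Y \<otimes> w \<otimes> X" and ?s = "Y \<otimes> c \<otimes> X" and ?t = "Y \<otimes> d \<otimes> X"
  have "infinite_idempotent R ?e"
  proof (rule infinite_idempotentI)
    show "?e \<in> carrier R" "?s \<in> carrier R" "?t \<in> carrier R"
      using XC YC C by auto
    show "?e \<otimes> ?e = ?e" "?t \<otimes> ?s = ?e" "?e \<otimes> ?s = ?s" "?s \<otimes> ?e = ?s" "?e \<otimes> ?t = ?t" "?t \<otimes> ?e = ?t"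
      using C by (simp_all add: mid cd w)
    show "?s \<otimes> ?t \<noteq> ?e"
    proof
      assume "?s \<otimes> ?t = ?e"
      then have eq: "Y \<otimes> (c \<otimes> d) \<otimes> X = Y \<otimes> w \<otimes> X"
        using C by (simp add: mid cd)
      have "X \<otimes> (Y \<otimes> u \<otimes> X) \<otimes> Y = w \<otimes> u \<otimes> w" if "u \<in> carrier R" for u
      proof -
        have "X \<otimes> (Y \<otimes> u \<otimes> X) \<otimes> Y = (X \<otimes> Y) \<otimes> u \<otimes> (X \<otimes> Y)"
          using that XC YC by (simp add: m_assoc)
        then show ?thesis
          by (simp add: XY)
      qed
      from this[of "c \<otimes> d"] this[of w] have "w \<otimes> (c \<otimes> d) \<otimes> w = w \<otimes> w \<otimes> w"
        using C eq by simp
      moreover have "w \<otimes> (c \<otimes> d) \<otimes> w = (w \<otimes> c) \<otimes> (d \<otimes> w)"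
        using C by (simp add: m_assoc)
      ultimately show False
        using cd w by simp
    qed
  qed
  moreover have "?e = a \<otimes> (y \<otimes> w \<otimes> w \<otimes> X)"
    unfolding Y_def using C aC XC by (simp add: m_assoc)
  then have "?e \<in> J"
    using J C XC unfolding right_ideal_def by simp
  ultimately show ?thesis
    by blast
qed

end

section \<open>Ideals of matrix rings generated by idempotents\<close>

text \<open>The Leibniz formula is polynomial in the entries, so congruence modulo the ideal
  \<open>D\<close> passes from entries to determinants.\<close>

lemma det_cong_ideal:
  fixes P Q :: "'a::comm_ring_1 mat"
  assumes D: "0 \<in> D" "\<And>a b. a \<in> D \<Longrightarrow> b \<in> D \<Longrightarrow> a + b \<in> D" "\<And>a b. a \<in> D \<Longrightarrow> b * a \<in> D"
    and P: "P \<in> carrier_mat n n" and Q: "Q \<in> carrier_mat n n"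
    and PQ: "\<And>i j. i < n \<Longrightarrow> j < n \<Longrightarrow> P $$ (i, j) - Q $$ (i, j) \<in> D"
  shows "det P - det Q \<in> D"
proof -
  have prod: "(\<Prod>i\<in>X. f i) - (\<Prod>i\<in>X. g i) \<in> D" if "finite X" "\<And>i. i \<in> X \<Longrightarrow> f i - g i \<in> D"
    for X :: "nat set" and f g :: "nat \<Rightarrow> 'a"
    using that
  proof (induction X rule: finite_induct)
    case (insert i X)
    have "prod g X * (f i - g i) + f i * (prod f X - prod g X) \<in> D"
      using insert by (intro D) auto
    also have "prod g X * (f i - g i) + f i * (prod f X - prod g X) = prod f (insert i X) - prod g (insert i X)"
      using insert by (simp add: algebra_simps)
    finally show ?case .
  qed (simp add: D)
  have sum: "sum f X \<in> D" if "\<And>i. i \<in> X \<Longrightarrow> f i \<in> D" for f :: "(nat \<Rightarrow> nat) \<Rightarrow> 'a" and X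
    using that by (induction X rule: infinite_finite_induct) (auto intro: D)
  have "det P - det Q = (\<Sum>p | p permutes {0..<n}. signof p * ((\<Prod>i = 0..<n. P $$ (i, p i)) - (\<Prod>i = 0..<n. Q $$ (i, p i))))"
    by (simp add: det_def'[OF P] det_def'[OF Q] sum_subtractf right_diff_distrib)
  also have "\<dots> \<in> D"
  proof (intro sum D(3) prod)
    fix p i assume "p \<in> {p. p permutes {0..<n}}" "i \<in> {0..<n}"
    then show "P $$ (i, p i) - Q $$ (i, p i) \<in> D"
      using permutes_in_image[of p "{0..<n}" i] by (intro PQ) auto
  qed simp
  finally show ?thesis .
qed

text \<open>From \<open>(1 - P) * P = 0\<close> one gets \<open>det (1 - P) = 0\<close>, while \<open>det (1 - P)\<close> is \<open>1\<close> modulo the entries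
  of \<open>P\<close>.\<close>

lemma idempotent_matrix_ideal:
  fixes P :: "'a::idom mat"
  assumes I: "\<And>A B. A \<in> I \<Longrightarrow> B \<in> I \<Longrightarrow> A + B \<in> I"
      "\<And>A B. A \<in> I \<Longrightarrow> B \<in> carrier_mat n n \<Longrightarrow> A * B \<in> I \<and> B * A \<in> I" "I \<subseteq> carrier_mat n n"
    and P: "P \<in> I" "P * P = P" "P \<noteq> 0\<^sub>m n n"
  shows "1\<^sub>m n \<in> I"
proof -
  have PC: "P \<in> carrier_mat n n"
    using P I by blast
  \<comment> \<open>The scalars whose scalar matrices lie in \<open>I\<close>. They form an ideal of
    the coefficient ring, and the goal is that this ideal contains 1.\<close>
  define D where "D = {a. a \<cdot>\<^sub>m 1\<^sub>m n \<in> I}"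
  have scal: "b \<cdot>\<^sub>m A \<in> I" if "A \<in> I" for A b
  proof -
    have "A \<in> carrier_mat n n"
      using that I(3) by blast
    then have "(b \<cdot>\<^sub>m 1\<^sub>m n) * A = b \<cdot>\<^sub>m A"
      by (simp add: smult_carrier_mat mult_smult_assoc_mat[of "1\<^sub>m n" n n A n])
    then show ?thesis
      using I(2)[OF that, of "b \<cdot>\<^sub>m 1\<^sub>m n"] by simp
  qed
  have D0: "0 \<in> D"
  proof -
    have "0 \<cdot>\<^sub>m 1\<^sub>m n = 0 \<cdot>\<^sub>m P"
      by (rule eq_matI) (use PC in auto)
    then show ?thesis
      using scal[OF P(1), of 0] by (simp only: D_def mem_Collect_eq)
  qed
  have Dadd: "a + b \<in> D" if "a \<in> D" "b \<in> D" for a b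
  proof -
    have "(a + b) \<cdot>\<^sub>m 1\<^sub>m n = a \<cdot>\<^sub>m 1\<^sub>m n + b \<cdot>\<^sub>m 1\<^sub>m n"
      by (rule eq_matI) (auto simp: distrib_right)
    then show ?thesis
      using that I(1) by (simp add: D_def)
  qed
  have Dmult: "b * a \<in> D" if "a \<in> D" for a b
  proof -
    have "(b * a) \<cdot>\<^sub>m 1\<^sub>m n = b \<cdot>\<^sub>m (a \<cdot>\<^sub>m 1\<^sub>m n)"
      by (rule eq_matI) auto
    then show ?thesis
      using scal[of "a \<cdot>\<^sub>m 1\<^sub>m n" b] that by (simp only: D_def mem_Collect_eq)
  qed
  have entry: "P $$ (i, j) \<in> D" if ij: "i < n" "j < n" for i j
  proof -
    \<comment> \<open>Matrix units: \<open>?E k i * P * ?E j k\<close> moves the entry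
      \<open>(i, j)\<close> of \<open>P\<close> to the diagonal place \<open>(k, k)\<close>, and
      summing over \<open>k\<close> gives the scalar matrix of that entry.\<close>
    let ?E = "\<lambda>k l. mat n n (\<lambda>(a, b). if a = k \<and> b = l then 1 else 0) :: 'a mat"
    have E: "?E k i * P * ?E j k \<in> I" for k
      using I(2) P(1) by simp
    have eq: "?E k i * P * ?E j k = mat n n (\<lambda>(a, b). if a = k \<and> b = k then P $$ (i, j) else 0)" if "k < n" for k
    proof (rule eq_matI)
      fix a b assume "a < dim_row (mat n n (\<lambda>(a, b). if a = k \<and> b = k then P $$ (i, j) else 0))"
        "b < dim_col (mat n n (\<lambda>(a, b). if a = k \<and> b = k then P $$ (i, j) else 0))"
      then have ab: "a < n" "b < n"
        by auto
      have 1: "(?E k i * P) $$ (a, l) = (if a = k then P $$ (i, l) else 0)" if "l < n" for l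
      proof -
        have "(?E k i * P) $$ (a, l) = (\<Sum>m\<in>{0..<n}. (if a = k \<and> m = i then 1 else 0) * P $$ (m, l))"
          using ab that PC by (simp add: scalar_prod_def)
        also have "\<dots> = (\<Sum>m\<in>{0..<n}. if m = i then (if a = k then P $$ (m, l) else 0) else 0)"
          by (intro sum.cong HOL.refl) auto
        finally show ?thesis
          using ij by simp
      qed
      have "(?E k i * P * ?E j k) $$ (a, b) = (\<Sum>l\<in>{0..<n}. (?E k i * P) $$ (a, l) * ?E j k $$ (l, b))"
        using ab PC by (simp add: scalar_prod_def)
      also have "\<dots> = (\<Sum>l\<in>{0..<n}. if l = j then (if a = k \<and> b = k then P $$ (i, l) else 0) else 0)"
        using ab by (intro sum.cong HOL.refl) (auto simp: 1)
      finally show "(?E k i * P * ?E j k) $$ (a, b) = mat n n (\<lambda>(a, b). if a = k \<and> b = k then P $$ (i, j) else 0) $$ (a, b)"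
        using ab ij by simp
    qed (use PC in auto)
    have "mat n n (\<lambda>(a, b). if a = b \<and> a < k then P $$ (i, j) else 0) \<in> I" if "k \<le> n" for k
      using that
    proof (induction k)
      case 0
      have "mat n n (\<lambda>(a, b). if a = b \<and> a < 0 then P $$ (i, j) else 0) = 0 \<cdot>\<^sub>m 1\<^sub>m n"
        by (rule eq_matI) auto
      then show ?case
        using D0 by (simp only: D_def mem_Collect_eq)
    next
      case (Suc k)
      have "mat n n (\<lambda>(a, b). if a = b \<and> a < k then P $$ (i, j) else 0) + ?E k i * P * ?E j k \<in> I"
        using Suc E by (intro I(1)) auto
      also have "mat n n (\<lambda>(a, b). if a = b \<and> a < k then P $$ (i, j) else 0) + ?E k i * P * ?E j k
          = mat n n (\<lambda>(a, b). if a = b \<and> a < Suc k then P $$ (i, j) else 0)"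
        using eq[of k] Suc.prems by (intro eq_matI) auto
      finally show ?case .
    qed
    from this[of n] have "mat n n (\<lambda>(a, b). if a = b \<and> a < n then P $$ (i, j) else 0) \<in> I"
      by simp
    also have "mat n n (\<lambda>(a, b). if a = b \<and> a < n then P $$ (i, j) else 0) = P $$ (i, j) \<cdot>\<^sub>m 1\<^sub>m n"
      by (rule eq_matI) auto
    finally show ?thesis
      by (simp add: D_def)
  qed
  let ?Q = "1\<^sub>m n - P"
  have Q: "?Q \<in> carrier_mat n n"
    using PC by (rule minus_carrier_mat)
  have "?Q * P = 0\<^sub>m n n"
    using PC P(2) by (simp add: minus_mult_distrib_mat[of "1\<^sub>m n" n n P P n])
  then have "adj_mat ?Q * ?Q * P = 0\<^sub>m n n"
    using assoc_mult_mat[OF adj_mat(1)[OF Q] Q PC] adj_mat(1)[OF Q] by simp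
  then have zero: "det ?Q \<cdot>\<^sub>m P = 0\<^sub>m n n"
    using PC by (simp add: adj_mat(3)[OF Q] mult_smult_assoc_mat[of "1\<^sub>m n" n n P n])
  obtain i j where ij: "i < n" "j < n" "P $$ (i, j) \<noteq> 0"
  proof (rule ccontr)
    assume "\<not> thesis"
    then have "P = 0\<^sub>m n n"
      using that PC by (intro eq_matI) auto
    then show False
      using P(3) by simp
  qed
  \<comment> \<open>Some entry of \<open>P\<close> is nonzero and the coefficients have no zero
    divisors, so the determinant vanishes.\<close>
  have "det ?Q * P $$ (i, j) = 0"
    using arg_cong[OF zero, of "\<lambda>M. M $$ (i, j)"] ij PC by simp
  then have "det ?Q = 0"
    using ij by simp
  moreover have "det ?Q - det (1\<^sub>m n) \<in> D"
  proof (rule det_cong_ideal[OF D0 Dadd Dmult Q])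
    fix i j assume ij: "i < n" "j < n"
    then have "?Q $$ (i, j) - 1\<^sub>m n $$ (i, j) = (- 1) * P $$ (i, j)"
      using PC by simp
    then show "?Q $$ (i, j) - 1\<^sub>m n $$ (i, j) \<in> D"
      using Dmult[OF entry[OF ij], of "- 1"] by simp
  qed simp_all
  ultimately have "- 1 \<in> D"
    by simp
  from Dmult[OF this, of "- 1"] have "1 \<in> D"
    by simp
  moreover have "1 \<cdot>\<^sub>m 1\<^sub>m n = (1\<^sub>m n :: 'a mat)"
    by (rule eq_matI) auto
  ultimately show ?thesis
    by (simp add: D_def)
qed

section \<open>Quotients of a ring as elements of one type\<close>

text \<open>The product of all quotients \<open>'a/I\<close>, over all two-sided ideals \<open>I\<close> of \<open>'a\<close>, is a ring on a
  type of its own, so that a presented algebra can be studied with type class reasoning: it embeds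
  (not unitally) as the factor at its ideal of relations.\<close>

definition two_sided_ideal :: "'a::ring_1 set \<Rightarrow> bool" where
  "two_sided_ideal I \<longleftrightarrow>
     0 \<in> I \<and> (\<forall>x\<in>I. \<forall>y\<in>I. x - y \<in> I) \<and> (\<forall>x\<in>I. \<forall>a. a * x \<in> I \<and> x * a \<in> I)"

lemma two_sided_idealD:
  assumes "two_sided_ideal I"
  shows "0 \<in> I"
    and "x \<in> I \<Longrightarrow> y \<in> I \<Longrightarrow> x - y \<in> I"
    and "x \<in> I \<Longrightarrow> y \<in> I \<Longrightarrow> x + y \<in> I"
    and "x \<in> I \<Longrightarrow> a * x \<in> I"
    and "x \<in> I \<Longrightarrow> x * a \<in> I"
proof -
  show zero: "0 \<in> I"
    using assms unfolding two_sided_ideal_def by blast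
  have diff: "x - y \<in> I" if "x \<in> I" "y \<in> I" for x y
    using assms that unfolding two_sided_ideal_def by blast
  then show "x \<in> I \<Longrightarrow> y \<in> I \<Longrightarrow> x - y \<in> I" .
  show "x + y \<in> I" if "x \<in> I" "y \<in> I"
    using diff[OF that(1) diff[OF zero that(2)]] by simp
  show "x \<in> I \<Longrightarrow> a * x \<in> I" "x \<in> I \<Longrightarrow> x * a \<in> I"
    using assms unfolding two_sided_ideal_def by blast+
qed

\<comment> \<open>A type cannot depend on an ideal given as a term. Functions of all ideals,
  compared modulo each of them, remove this dependency; values at sets that are not two-sided ideals
  are ignored by the relation.\<close>
quotient_type (overloaded) 'a ideal_quotients = "'a::ring_1 set \<Rightarrow> 'a" /
  "\<lambda>f g. \<forall>I. two_sided_ideal I \<longrightarrow> f I - g I \<in> I"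
proof (intro equivpI reflpI sympI transpI)
  fix f g h :: "'a set \<Rightarrow> 'a"
  show "\<forall>I. two_sided_ideal I \<longrightarrow> f I - f I \<in> I"
    by (simp add: two_sided_idealD)
  show "\<forall>I. two_sided_ideal I \<longrightarrow> g I - f I \<in> I" if "\<forall>I. two_sided_ideal I \<longrightarrow> f I - g I \<in> I"
    using that two_sided_idealD(2)[of I 0 "f I - g I" for I] by (simp add: two_sided_idealD(1))
  show "\<forall>I. two_sided_ideal I \<longrightarrow> f I - h I \<in> I"
    if "\<forall>I. two_sided_ideal I \<longrightarrow> f I - g I \<in> I" "\<forall>I. two_sided_ideal I \<longrightarrow> g I - h I \<in> I"
    using that two_sided_idealD(3)[of I "f I - g I" "g I - h I" for I] by simp
qed

instantiation ideal_quotients :: (ring_1) ring_1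
begin

lift_definition zero_ideal_quotients :: "'a ideal_quotients" is "\<lambda>_. 0" .
lift_definition one_ideal_quotients :: "'a ideal_quotients" is "\<lambda>_. 1" .

lift_definition plus_ideal_quotients :: "'a ideal_quotients \<Rightarrow> 'a ideal_quotients \<Rightarrow> 'a ideal_quotients"
  is "\<lambda>f g I. f I + g I"
  by (simp add: add_diff_add two_sided_idealD(3))

lift_definition uminus_ideal_quotients :: "'a ideal_quotients \<Rightarrow> 'a ideal_quotients"
  is "\<lambda>f I. - f I"
proof -
  fix f g :: "'a set \<Rightarrow> 'a" and I :: "'a set"
  assume "\<And>I. two_sided_ideal I \<Longrightarrow> f I - g I \<in> I" and I: "two_sided_ideal I"
  then show "- f I - - g I \<in> I"
    using two_sided_idealD(2)[OF I two_sided_idealD(1)[OF I], of "f I - g I"] by simp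
qed

lift_definition minus_ideal_quotients :: "'a ideal_quotients \<Rightarrow> 'a ideal_quotients \<Rightarrow> 'a ideal_quotients"
  is "\<lambda>f g I. f I - g I"
proof -
  fix f f' g g' :: "'a set \<Rightarrow> 'a" and I :: "'a set"
  assume *: "\<And>I. two_sided_ideal I \<Longrightarrow> f I - f' I \<in> I" "\<And>I. two_sided_ideal I \<Longrightarrow> g I - g' I \<in> I"
    and I: "two_sided_ideal I"
  have "(f I - f' I) - (g I - g' I) \<in> I"
    by (rule two_sided_idealD(2)[OF I *(1)[OF I] *(2)[OF I]])
  then show "f I - g I - (f' I - g' I) \<in> I"
    by (simp add: algebra_simps)
qed

lift_definition times_ideal_quotients :: "'a ideal_quotients \<Rightarrow> 'a ideal_quotients \<Rightarrow> 'a ideal_quotients"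
  is "\<lambda>f g I. f I * g I"
proof -
  fix f f' g g' :: "'a set \<Rightarrow> 'a" and I :: "'a set"
  assume "\<And>I. two_sided_ideal I \<Longrightarrow> f I - f' I \<in> I" "\<And>I. two_sided_ideal I \<Longrightarrow> g I - g' I \<in> I"
    and I: "two_sided_ideal I"
  then have "f I * (g I - g' I) + (f I - f' I) * g' I \<in> I"
    by (intro two_sided_idealD(3-5)[OF I]) auto
  then show "f I * g I - f' I * g' I \<in> I"
    by (simp add: algebra_simps)
qed

instance
proof
  fix a b c :: "'a ideal_quotients"
  show "a + b + c = a + (b + c)" "a + b = b + a" "0 + a = a" "- a + a = 0" "a - b = a + - b"
    "a * b * c = a * (b * c)" "1 * a = a" "a * 1 = a"
    "(a + b) * c = a * c + b * c" "a * (b + c) = a * b + a * c"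
    by (transfer; simp add: algebra_simps two_sided_idealD)+
  \<comment> \<open>The factor at the zero ideal is the original ring, in which 0 and 1 differ; some
    other factors are trivial.\<close>
  have "two_sided_ideal {0::'a}"
    by (simp add: two_sided_ideal_def)
  then show "(0::'a ideal_quotients) \<noteq> 1"
    by transfer (auto intro!: exI[of _ "{0}"])
qed

end

text \<open>Scalars are embedded diagonally, because \<open>scalar_hom\<close> asks that 1 be sent
  to 1, whereas the unit of a single factor is not the unit of the product.\<close>

lift_definition const_iq :: "'a::ring_1 \<Rightarrow> 'a ideal_quotients" is "\<lambda>a _. a" .

lift_definition iq_at :: "'a::ring_1 set \<Rightarrow> 'a \<Rightarrow> 'a ideal_quotients" is "\<lambda>J a I. if I = J then a else 0" .

lemma const_iq_simps:
  "const_iq 0 = 0" "const_iq 1 = 1"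
  "const_iq (a + b) = const_iq a + const_iq b" "const_iq (a * b) = const_iq a * const_iq b"
  by (transfer; simp add: two_sided_idealD)+

lemma const_iq_commute:
  assumes "\<And>b. a * b = b * a"
  shows "const_iq a * x = x * const_iq a"
  using assms by transfer (simp add: two_sided_idealD)

lemma iq_at_simps:
  "iq_at I 0 = 0"
  "iq_at I (a + b) = iq_at I a + iq_at I b"
  "iq_at I (a - b) = iq_at I a - iq_at I b"
  "iq_at I (a * b) = iq_at I a * iq_at I b"
  "const_iq a * iq_at I b = iq_at I (a * b)"
  by (transfer; simp add: two_sided_idealD)+

lemma iq_at_sum: "iq_at I (sum f A) = (\<Sum>x\<in>A. iq_at I (f x))"
  by (induction A rule: infinite_finite_induct) (auto simp: iq_at_simps)

lemma iq_at_eq_0_iff: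
  assumes "two_sided_ideal I"
  shows "iq_at I a = 0 \<longleftrightarrow> a \<in> I"
  using assms by transfer (auto simp: two_sided_idealD)

lemma iq_at_eq_iff:
  assumes "two_sided_ideal I"
  shows "iq_at I a = iq_at I b \<longleftrightarrow> a - b \<in> I"
  using iq_at_eq_0_iff[OF assms, of "a - b"] by (simp add: iq_at_simps)

section \<open>Linear extension from monoid algebras\<close>

text \<open>Linear extension from a monoid basis. It serves for restricting words to an alphabet,
  for letting the free algebra act on functions, and for evaluating Laurent polynomials at a
  cycle.\<close>

definition pm_extend :: "('k \<Rightarrow> 'b) \<Rightarrow> ('m \<Rightarrow> 'b) \<Rightarrow> ('m \<Rightarrow>\<^sub>0 'k::semiring_0) \<Rightarrow> 'b::semiring_0" where
  "pm_extend K f p = (\<Sum>m\<in>Poly_Mapping.keys p. K (Poly_Mapping.lookup p m) * f m)"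

lemma poly_mapping_mult_expand:
  "p * q = (\<Sum>m\<in>Poly_Mapping.keys p. \<Sum>n\<in>Poly_Mapping.keys q.
     Poly_Mapping.single (m + n) (Poly_Mapping.lookup p m * Poly_Mapping.lookup q n))"
proof -
  have "p * q = (\<Sum>m\<in>Poly_Mapping.keys p. Poly_Mapping.single m (Poly_Mapping.lookup p m)) *
      (\<Sum>n\<in>Poly_Mapping.keys q. Poly_Mapping.single n (Poly_Mapping.lookup q n))"
    by (simp only: poly_mapping_eq_sum_single[symmetric])
  then show ?thesis
    by (simp add: sum_product mult_single)
qed

locale scalar_hom =
  fixes K :: "'k::field \<Rightarrow> 'b::ring_1"
  assumes K_add: "K (c + d) = K c + K d"
    and K_mult: "K (c * d) = K c * K d"
    and K_1: "K 1 = 1"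
    and K_commute: "K c * x = x * K c"
begin

lemma K_0: "K 0 = 0"
  using K_add[of 0 0] by simp

lemma pm_extend_superset:
  assumes "finite M" "Poly_Mapping.keys p \<subseteq> M"
  shows "pm_extend K f p = (\<Sum>m\<in>M. K (Poly_Mapping.lookup p m) * f m)"
  unfolding pm_extend_def
  using assms by (intro sum.mono_neutral_left) (auto simp: in_keys_iff K_0)

lemma pm_extend_0: "pm_extend K f 0 = 0"
  by (simp add: pm_extend_def)

lemma pm_extend_single: "pm_extend K f (Poly_Mapping.single m c) = K c * f m"
  by (subst pm_extend_superset[of "{m}"]) auto

lemma pm_extend_add: "pm_extend K f (p + q) = pm_extend K f p + pm_extend K f q"
proof -
  let ?M = "Poly_Mapping.keys p \<union> Poly_Mapping.keys q"
  have "pm_extend K f (p + q) = (\<Sum>m\<in>?M. K (Poly_Mapping.lookup (p + q) m) * f m)"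
    using Poly_Mapping.keys_add[of p q] by (intro pm_extend_superset) auto
  also have "\<dots> = (\<Sum>m\<in>?M. K (Poly_Mapping.lookup p m) * f m) + (\<Sum>m\<in>?M. K (Poly_Mapping.lookup q m) * f m)"
    by (simp add: lookup_add K_add distrib_right sum.distrib)
  also have "\<dots> = pm_extend K f p + pm_extend K f q"
    by (simp add: pm_extend_superset[symmetric])
  finally show ?thesis .
qed

lemma pm_extend_sum: "pm_extend K f (sum g A) = (\<Sum>a\<in>A. pm_extend K f (g a))"
  by (induction A rule: infinite_finite_induct) (auto simp: pm_extend_0 pm_extend_add)

text \<open>The condition on \<open>f\<close> concerns products only: for Laurent polynomials below,
  the image of 0 is a vertex, the unit of a corner and not of the ring. Centrality of the scalars
  lets them move past \<open>f m\<close>.\<close>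

lemma pm_extend_mult:
  assumes f: "\<And>m n. f (m + n) = f m * f n"
  shows "pm_extend K f (p * q) = pm_extend K f p * pm_extend K f q"
proof -
  have "pm_extend K f (p * q) = (\<Sum>m\<in>Poly_Mapping.keys p. \<Sum>n\<in>Poly_Mapping.keys q.
      K (Poly_Mapping.lookup p m * Poly_Mapping.lookup q n) * f (m + n))"
    by (subst poly_mapping_mult_expand) (simp add: pm_extend_sum pm_extend_single)
  also have "\<dots> = (\<Sum>m\<in>Poly_Mapping.keys p. \<Sum>n\<in>Poly_Mapping.keys q.
      (K (Poly_Mapping.lookup p m) * f m) * (K (Poly_Mapping.lookup q n) * f n))"
  proof (intro sum.cong HOL.refl)
    fix m n
    show "K (Poly_Mapping.lookup p m * Poly_Mapping.lookup q n) * f (m + n) =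
        (K (Poly_Mapping.lookup p m) * f m) * (K (Poly_Mapping.lookup q n) * f n)"
      unfolding K_mult f using K_commute[of "Poly_Mapping.lookup q n" "f m"] by (metis mult.assoc)
  qed
  also have "\<dots> = pm_extend K f p * pm_extend K f q"
    by (simp add: pm_extend_def sum_product)
  finally show ?thesis .
qed

end

lemma single_0_commute:
  fixes p :: "'m::monoid_add \<Rightarrow>\<^sub>0 'k::field"
  shows "Poly_Mapping.single 0 c * p = p * Poly_Mapping.single 0 c"
  by (subst (1 2) poly_mapping_eq_sum_single[of p])
     (simp add: sum_distrib_left sum_distrib_right mult_single mult.commute)

lemma scalar_hom_single: "scalar_hom (Poly_Mapping.single 0 :: 'k::field \<Rightarrow> 'm::monoid_add \<Rightarrow>\<^sub>0 'k)"
  by unfold_locales (auto simp: single_add mult_single single_one single_0_commute)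

lemma scalar_hom_const_iq:
  "scalar_hom (\<lambda>c :: 'k::field. const_iq (Poly_Mapping.single 0 c :: 'm::monoid_add \<Rightarrow>\<^sub>0 'k))"
proof
  fix c d :: 'k and x :: "('m \<Rightarrow>\<^sub>0 'k) ideal_quotients"
  let ?s = "\<lambda>c. Poly_Mapping.single 0 c :: 'm \<Rightarrow>\<^sub>0 'k"
  show "const_iq (?s (c + d)) = const_iq (?s c) + const_iq (?s d)"
    by (simp only: single_add const_iq_simps)
  have "?s (c * d) = ?s c * ?s d"
    by (simp add: mult_single)
  then show "const_iq (?s (c * d)) = const_iq (?s c) * const_iq (?s d)"
    by (simp only: const_iq_simps)
  show "const_iq (?s 1) = 1"
    by (simp only: single_one const_iq_simps)
  show "const_iq (?s c) * x = x * const_iq (?s c)"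
    by (intro const_iq_commute single_0_commute)
qed

section \<open>Presented algebras inside a type\<close>

definition word_restrict :: "'g set \<Rightarrow> ('g fword \<Rightarrow>\<^sub>0 'k::field) \<Rightarrow> 'g fword \<Rightarrow>\<^sub>0 'k" where
  "word_restrict X = pm_extend (Poly_Mapping.single 0)
     (\<lambda>w. if set (letters w) \<subseteq> X then Poly_Mapping.single w 1 else 0)"

lemma word_restrict_add: "word_restrict X (p + q) = word_restrict X p + word_restrict X q"
  unfolding word_restrict_def by (rule scalar_hom.pm_extend_add[OF scalar_hom_single])

lemma word_restrict_mult: "word_restrict X (p * q) = word_restrict X p * word_restrict X q"
  unfolding word_restrict_def
  by (rule scalar_hom.pm_extend_mult[OF scalar_hom_single]) (auto simp: plus_fword_def mult_single)

lemma word_restrict_free_alg: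
  assumes "p \<in> free_alg X"
  shows "word_restrict X p = p"
proof -
  have "word_restrict X p = (\<Sum>w\<in>Poly_Mapping.keys p. Poly_Mapping.single w (Poly_Mapping.lookup p w))"
    unfolding word_restrict_def pm_extend_def
    using assms by (intro sum.cong) (auto simp: free_alg_def mult_single)
  then show ?thesis
    by (simp only: poly_mapping_eq_sum_single[symmetric])
qed

text \<open>The relations only generate an ideal of the free algebra on \<open>X\<close>, whereas \<open>'g\<close> may have further
  letters; sending these to \<open>0\<close> extends it to an ideal of the whole monoid algebra.\<close>

definition extended_ideal :: "'g set \<Rightarrow> ('g fword \<Rightarrow>\<^sub>0 'k::field) set \<Rightarrow> ('g fword \<Rightarrow>\<^sub>0 'k) set" where
  "extended_ideal X R = {p. word_restrict X p \<in> rel_ideal X R}"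

text \<open>\<open>rel_ideal\<close> is closed under multiplication by combinations of nonempty
  words and by scalars. A restricted element may also involve the empty word, which is covered by
  the scalars.\<close>

lemma rel_ideal_word_restrict:
  assumes "q \<in> rel_ideal X R"
  shows "word_restrict X p * q \<in> rel_ideal X R" "q * word_restrict X p \<in> rel_ideal X R"
proof -
  have *: "Poly_Mapping.single w 1 * q \<in> rel_ideal X R \<and> q * Poly_Mapping.single w 1 \<in> rel_ideal X R"
    if "set (letters w) \<subseteq> X" for w
  proof (cases "w = 0")
    case False
    then have "Poly_Mapping.single w 1 \<in> free_alg X"
      using that by (auto simp: free_alg_def)
    then show ?thesis
      using assms by (auto intro: rel_ideal.left rel_ideal.right)
  qed (use assms in simp)
  have "Poly_Mapping.single 0 c * (if set (letters w) \<subseteq> X then Poly_Mapping.single w 1 else 0) * q \<in> rel_ideal X R" for c w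
    using * by (auto simp: mult.assoc intro: rel_ideal.scale rel_ideal.zero)
  then show "word_restrict X p * q \<in> rel_ideal X R"
    unfolding word_restrict_def pm_extend_def sum_distrib_right by (rule rel_ideal_sum)
  have "q * (Poly_Mapping.single 0 c * (if set (letters w) \<subseteq> X then Poly_Mapping.single w 1 else 0)) \<in> rel_ideal X R" for c w
  proof -
    have "q * (Poly_Mapping.single 0 c * (if set (letters w) \<subseteq> X then Poly_Mapping.single w 1 else 0)) =
      Poly_Mapping.single 0 c * (q * (if set (letters w) \<subseteq> X then Poly_Mapping.single w 1 else 0))"
      by (simp only: mult.assoc[symmetric] single_0_commute[of c q])
    then show ?thesis
      using * by (auto intro: rel_ideal.scale rel_ideal.zero)
  qed
  then show "q * word_restrict X p \<in> rel_ideal X R"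
    unfolding word_restrict_def pm_extend_def sum_distrib_left by (rule rel_ideal_sum)
qed

lemma two_sided_extended_ideal:
  fixes R :: "('g fword \<Rightarrow>\<^sub>0 'k::field) set"
  shows "two_sided_ideal (extended_ideal X R)"
proof -
  have "word_restrict X (p - q) = word_restrict X p - word_restrict X q" for p q :: "'g fword \<Rightarrow>\<^sub>0 'k"
    using word_restrict_add[of X "p - q" q] by simp
  moreover have "word_restrict X 0 = (0 :: 'g fword \<Rightarrow>\<^sub>0 'k)"
    by (simp add: word_restrict_free_alg free_alg_zero)
  ultimately show ?thesis
    unfolding two_sided_ideal_def extended_ideal_def
    by (simp add: word_restrict_mult rel_ideal_word_restrict rel_ideal_diff rel_ideal.zero)
qed

definition alg_elem :: "'g set \<Rightarrow> ('g fword \<Rightarrow>\<^sub>0 'k::field) set \<Rightarrow> ('g fword \<Rightarrow>\<^sub>0 'k) \<Rightarrow> ('g fword \<Rightarrow>\<^sub>0 'k) ideal_quotients" where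
  "alg_elem X R = iq_at (extended_ideal X R)"

definition alg_scalar :: "'k::field \<Rightarrow> ('g fword \<Rightarrow>\<^sub>0 'k) ideal_quotients" where
  "alg_scalar c = const_iq (Poly_Mapping.single 0 c)"

lemma scalar_hom_alg_scalar: "scalar_hom alg_scalar"
  unfolding alg_scalar_def by (rule scalar_hom_const_iq)

lemma alg_elem_simps:
  "alg_elem X R 0 = 0"
  "alg_elem X R (p + q) = alg_elem X R p + alg_elem X R q"
  "alg_elem X R (p - q) = alg_elem X R p - alg_elem X R q"
  "alg_elem X R (p * q) = alg_elem X R p * alg_elem X R q"
  "alg_elem X R (Poly_Mapping.single 0 c * p) = alg_scalar c * alg_elem X R p"
  "alg_elem X R (sum f A) = (\<Sum>x\<in>A. alg_elem X R (f x))"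
  by (simp_all add: alg_elem_def alg_scalar_def iq_at_simps iq_at_sum)

lemma alg_elem_eq_iff:
  assumes "p \<in> free_alg X" "q \<in> free_alg X"
  shows "alg_elem X R p = alg_elem X R q \<longleftrightarrow> alg_coset (rel_ideal X R) p = alg_coset (rel_ideal X R) q"
proof -
  have "p - q \<in> free_alg X"
    using assms by (rule free_alg_diff)
  then show ?thesis
    unfolding alg_elem_def iq_at_eq_iff[OF two_sided_extended_ideal] alg_coset_eq_iff
    by (simp add: extended_ideal_def word_restrict_free_alg)
qed

definition alg_embed :: "'g set \<Rightarrow> ('g fword \<Rightarrow>\<^sub>0 'k::field) set \<Rightarrow> ('g fword \<Rightarrow>\<^sub>0 'k) set \<Rightarrow> ('g fword \<Rightarrow>\<^sub>0 'k) ideal_quotients" where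
  "alg_embed X R C = alg_elem X R (SOME p. p \<in> C)"

lemma alg_embed_coset:
  assumes R: "R \<subseteq> free_alg X" and p: "p \<in> free_alg X"
  shows "alg_embed X R (alg_coset (rel_ideal X R) p) = alg_elem X R p"
proof -
  let ?q = "SOME q. q \<in> alg_coset (rel_ideal X R) p"
  have "?q \<in> alg_coset (rel_ideal X R) p"
    using mem_alg_coset by (rule someI)
  then have q: "?q - p \<in> rel_ideal X R"
    by (simp add: alg_coset_def)
  then have "(?q - p) + p \<in> free_alg X"
    using rel_ideal_subset[OF R q] p by (intro free_alg_add)
  then have "?q \<in> free_alg X"
    by simp
  then show ?thesis
    unfolding alg_embed_def using alg_elem_eq_iff[OF _ p, of ?q R] q by (simp add: alg_coset_eq_iff)
qed

section \<open>Representations by partial maps\<close>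

primrec word_act :: "('g \<Rightarrow> 'p \<Rightarrow> 'p option) \<Rightarrow> 'g list \<Rightarrow> 'p \<Rightarrow> 'p option" where
  "word_act \<sigma> [] x = Some x"
| "word_act \<sigma> (g # gs) x = Option.bind (\<sigma> g x) (word_act \<sigma> gs)"

lemma word_act_append: "word_act \<sigma> (gs @ hs) x = Option.bind (word_act \<sigma> gs x) (word_act \<sigma> hs)"
  by (induction gs arbitrary: x) (auto split: Option.bind_splits)

definition pull :: "('p \<Rightarrow> 'k::zero) \<Rightarrow> 'p option \<Rightarrow> 'k" where
  "pull f = case_option 0 f"

lemma pull_simps [simp]: "pull f None = 0" "pull f (Some x) = f x"
  by (simp_all add: pull_def)

lemma pull_zero_fun [simp]: "pull (\<lambda>_. 0) y = 0"
  by (cases y) simp_all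

text \<open>Words move points by partial maps, read from left to right, and functions are pulled
  back along them, with value 0 where the map is undefined. Pulling back reverses the order once
  more, so a product acts as the composite of the two actions in the same order.\<close>

definition alg_act :: "('g \<Rightarrow> 'p \<Rightarrow> 'p option) \<Rightarrow> ('g fword \<Rightarrow>\<^sub>0 'k::field) \<Rightarrow> ('p \<Rightarrow> 'k) \<Rightarrow> 'p \<Rightarrow> 'k" where
  "alg_act \<sigma> p f x = pm_extend (\<lambda>c. c) (\<lambda>w. pull f (word_act \<sigma> (letters w) x)) p"

lemma scalar_hom_id: "scalar_hom (\<lambda>c :: 'k::field. c)"
  by unfold_locales (auto simp: mult.commute)

lemma alg_act_simps:
  "alg_act \<sigma> 0 f x = 0"
  "alg_act \<sigma> (p + q) f x = alg_act \<sigma> p f x + alg_act \<sigma> q f x"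
  "alg_act \<sigma> (Poly_Mapping.single u c) f x = c * pull f (word_act \<sigma> (letters u) x)"
  "alg_act \<sigma> (sum g A) f x = (\<Sum>a\<in>A. alg_act \<sigma> (g a) f x)"
  unfolding alg_act_def
  by (rule scalar_hom.pm_extend_0[OF scalar_hom_id] scalar_hom.pm_extend_add[OF scalar_hom_id]
      scalar_hom.pm_extend_single[OF scalar_hom_id] scalar_hom.pm_extend_sum[OF scalar_hom_id])+

lemma alg_act_diff: "alg_act \<sigma> (p - q) f x = alg_act \<sigma> p f x - alg_act \<sigma> q f x"
  using alg_act_simps(2)[of \<sigma> "p - q" q f x] by simp

lemma alg_act_mult: "alg_act \<sigma> (p * q) f x = alg_act \<sigma> p (alg_act \<sigma> q f) x"
proof -
  have pull: "pull (alg_act \<sigma> q f) y = (\<Sum>n\<in>Poly_Mapping.keys q. Poly_Mapping.lookup q n *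
      pull f (Option.bind y (word_act \<sigma> (letters n))))" for y
    by (cases y) (simp_all add: alg_act_def pm_extend_def)
  have "alg_act \<sigma> (p * q) f x = (\<Sum>m\<in>Poly_Mapping.keys p. \<Sum>n\<in>Poly_Mapping.keys q.
      Poly_Mapping.lookup p m * Poly_Mapping.lookup q n * pull f (word_act \<sigma> (letters (m + n)) x))"
    by (subst poly_mapping_mult_expand) (simp add: alg_act_simps)
  also have "\<dots> = (\<Sum>m\<in>Poly_Mapping.keys p. Poly_Mapping.lookup p m *
      pull (alg_act \<sigma> q f) (word_act \<sigma> (letters m) x))"
    unfolding pull sum_distrib_left
    by (simp add: plus_fword_def word_act_append mult.assoc)
  finally show ?thesis
    by (simp add: alg_act_def[of \<sigma> p] pm_extend_def)
qed

lemma alg_act_zero_fun: "alg_act \<sigma> p (\<lambda>_. 0) x = 0"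
  by (simp add: alg_act_def pm_extend_def)

lemma alg_act_rel_ideal:
  assumes R: "\<And>r f x. r \<in> R \<Longrightarrow> alg_act \<sigma> r f x = 0" and p: "p \<in> rel_ideal X R"
  shows "alg_act \<sigma> p f x = 0"
  using p
proof (induction arbitrary: f x)
  case (left p a)
  then have "alg_act \<sigma> p f = (\<lambda>_. 0)" for f
    by blast
  then show ?case
    by (simp add: alg_act_mult alg_act_zero_fun)
qed (auto simp: R alg_act_mult alg_act_simps zero_fword_def)

section \<open>Leavitt path algebras of balanced weighted graphs\<close>

text \<open>The weight depends on the source alone, but \<open>N\<close> need not be the outdegree
  in \<open>G\<close>: for the quotient graph it remains the outdegree in the original graph, and
  \<open>N = 1\<close> gives the ordinary Leavitt path algebra.\<close>

locale balanced_graph = fin_digraph G for G :: "('v, 'e) pre_digraph" +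
  fixes N :: "'v \<Rightarrow> nat" and w :: "'e \<Rightarrow> nat"
  assumes weight: "e \<in> arcs G \<Longrightarrow> w e = N (tail G e)"
    and weight_pos: "e \<in> arcs G \<Longrightarrow> N (tail G e) > 0"
begin

lemma vertex_weight: "out_arcs G v \<noteq> {} \<Longrightarrow> vertex_weight G w v = N v"
proof -
  assume ne: "out_arcs G v \<noteq> {}"
  then have "w ` out_arcs G v = {N v}"
    by (auto simp: weight)
  then show ?thesis
    by (simp add: vertex_weight_def)
qed

lemma regular_verts: "v \<in> regular_verts G \<longleftrightarrow> v \<in> verts G \<and> out_arcs G v \<noteq> {}"
  by (auto simp: regular_verts_def)

end

text \<open>The points are triples \<open>(v, m, z)\<close>. The vertex \<open>v\<close> acts on the copy of \<open>\<nat>\<close> above it, which is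
  empty for \<open>v \<in> H\<close>, and \<open>\<phi> v\<close> identifies \<open>N v\<close> copies of that set with the union of the sets above the
  ranges of the edges of \<open>v\<close>. The integer \<open>z\<close> records the degree.\<close>

locale leavitt_rep = balanced_graph G N w for G :: "('v, 'e) pre_digraph" and N w +
  fixes H :: "'v set" and \<phi> :: "'v \<Rightarrow> nat \<times> nat \<Rightarrow> 'e \<times> nat"
  assumes hered_sat: "hered_sat G H"
    and bij: "v \<in> verts G - H \<Longrightarrow> out_arcs G v \<noteq> {} \<Longrightarrow>
      bij_betw (\<phi> v) ({1..N v} \<times> UNIV) ({e \<in> out_arcs G v. head G e \<notin> H} \<times> UNIV)"
begin

definition \<psi> :: "'v \<Rightarrow> 'e \<times> nat \<Rightarrow> nat \<times> nat" where
  "\<psi> v = inv_into ({1..N v} \<times> UNIV) (\<phi> v)"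

text \<open>The point \<open>m\<close> above \<open>u\<close>, placed in copy \<open>i\<close>, is
  sent by \<open>\<phi> u\<close> to a point over exactly one edge. The generator \<open>e_i\<close>
  follows this map where the edge is \<open>e\<close> and is undefined elsewhere;
  \<open>e_i^*\<close> is the inverse partial map. Thus \<open>CK1\<close> and \<open>CK2\<close>
  express that \<open>\<phi>\<close> and \<open>\<psi>\<close> are mutually inverse.\<close>

fun rep :: "('v, 'e) lpa_gen \<Rightarrow> 'v \<times> nat \<times> int \<Rightarrow> ('v \<times> nat \<times> int) option" where
  "rep (Vtx v) (u, m, z) = (if u = v \<and> u \<notin> H then Some (u, m, z) else None)"
| "rep (Edg e i) (u, m, z) =
     (if u = tail G e \<and> u \<notin> H \<and> fst (\<phi> u (i, m)) = e then Some (head G e, snd (\<phi> u (i, m)), z + 1) else None)"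
| "rep (Gst e i) (u, m, z) =
     (if u = head G e \<and> u \<notin> H \<and> fst (\<psi> (tail G e) (e, m)) = i
      then Some (tail G e, snd (\<psi> (tail G e) (e, m)), z - 1) else None)"

lemma phi:
  assumes "v \<in> verts G" "v \<notin> H" "out_arcs G v \<noteq> {}" "i \<in> {1..N v}"
  shows "fst (\<phi> v (i, m)) \<in> arcs G" "tail G (fst (\<phi> v (i, m))) = v" "head G (fst (\<phi> v (i, m))) \<notin> H"
    "\<psi> v (\<phi> v (i, m)) = (i, m)"
proof -
  have b: "bij_betw (\<phi> v) ({1..N v} \<times> UNIV) ({e \<in> out_arcs G v. head G e \<notin> H} \<times> UNIV)"
    using assms by (intro bij) auto
  have "(i, m) \<in> {1..N v} \<times> UNIV"
    using assms by auto
  then have "\<phi> v (i, m) \<in> {e \<in> out_arcs G v. head G e \<notin> H} \<times> UNIV" "\<psi> v (\<phi> v (i, m)) = (i, m)"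
    unfolding \<psi>_def by (rule bij_betw_apply[OF b], rule bij_betw_inv_into_left[OF b])
  then show "fst (\<phi> v (i, m)) \<in> arcs G" "tail G (fst (\<phi> v (i, m))) = v" "head G (fst (\<phi> v (i, m))) \<notin> H"
    "\<psi> v (\<phi> v (i, m)) = (i, m)"
    by auto
qed

lemma psi:
  assumes "e \<in> arcs G" "head G e \<notin> H"
  shows "tail G e \<notin> H" "fst (\<psi> (tail G e) (e, m)) \<in> {1..N (tail G e)}"
    "\<phi> (tail G e) (\<psi> (tail G e) (e, m)) = (e, m)"
proof -
  let ?v = "tail G e"
  show v: "?v \<notin> H"
    using assms hered_satD(2)[OF hered_sat] by blast
  have b: "bij_betw (\<phi> ?v) ({1..N ?v} \<times> UNIV) ({e \<in> out_arcs G ?v. head G e \<notin> H} \<times> UNIV)"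
    using assms v by (intro bij) auto
  have "(e, m) \<in> {e \<in> out_arcs G ?v. head G e \<notin> H} \<times> UNIV"
    using assms by auto
  then have "\<psi> ?v (e, m) \<in> {1..N ?v} \<times> UNIV" "\<phi> ?v (\<psi> ?v (e, m)) = (e, m)"
    unfolding \<psi>_def by (rule bij_betw_apply[OF bij_betw_inv_into[OF b]], rule bij_betw_inv_into_right[OF b])
  then show "fst (\<psi> ?v (e, m)) \<in> {1..N ?v}" "\<phi> ?v (\<psi> ?v (e, m)) = (e, m)"
    by auto
qed

abbreviation "act \<equiv> alg_act rep"

lemma act_vx: "act (vx v) f (u, m, z) = (if u = v \<and> u \<notin> H then f (u, m, z) else 0)"
  by (auto simp: vx_def alg_act_simps)

lemma act_ed: "e \<in> arcs G \<Longrightarrow> i \<in> {1..N (tail G e)} \<Longrightarrow> act (ed w e i) f (u, m, z) =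
    (if u = tail G e \<and> u \<notin> H \<and> fst (\<phi> u (i, m)) = e then f (head G e, snd (\<phi> u (i, m)), z + 1) else 0)"
  by (auto simp: ed_def alg_act_simps weight)

lemma act_gh: "e \<in> arcs G \<Longrightarrow> i \<in> {1..N (tail G e)} \<Longrightarrow> act (gh w e i) f (u, m, z) =
    (if u = head G e \<and> u \<notin> H \<and> fst (\<psi> (tail G e) (e, m)) = i
      then f (tail G e, snd (\<psi> (tail G e) (e, m)), z - 1) else 0)"
  by (auto simp: gh_def alg_act_simps weight)

lemma act_lpa_rels:
  assumes "r \<in> lpa_rels G w"
  shows "act r f x = 0"
proof -
  obtain u m z where x: "x = (u, m, z)"
    by (cases x)
  note s = alg_act_simps alg_act_diff alg_act_mult act_vx
  consider (VV) a b where "r = vx a * vx b - (if a = b then vx a else 0)" "a \<in> verts G" "b \<in> verts G"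
    | (VE) e i where "r = vx (tail G e) * ed w e i - ed w e i" "e \<in> arcs G" "1 \<le> i" "i \<le> w e"
    | (EV) e i where "r = ed w e i * vx (head G e) - ed w e i" "e \<in> arcs G" "1 \<le> i" "i \<le> w e"
    | (VG) e i where "r = vx (head G e) * gh w e i - gh w e i" "e \<in> arcs G" "1 \<le> i" "i \<le> w e"
    | (GV) e i where "r = gh w e i * vx (tail G e) - gh w e i" "e \<in> arcs G" "1 \<le> i" "i \<le> w e"
    | (CK1) v i j where "r = (\<Sum>e\<in>out_arcs G v. ed w e i * gh w e j) - (if i = j then vx v else 0)"
        "v \<in> regular_verts G" "i \<in> {1..vertex_weight G w v}" "j \<in> {1..vertex_weight G w v}"
    | (CK2) v e g where "r = (\<Sum>i\<in>{1..vertex_weight G w v}. gh w e i * ed w g i) - (if e = g then vx (head G e) else 0)"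
        "v \<in> regular_verts G" "e \<in> out_arcs G v" "g \<in> out_arcs G v"
    using assms unfolding lpa_rels_def by blast
  then show ?thesis
  proof cases
    case VV
    then show ?thesis by (auto simp: s x)
  next
    case VE
    then have i: "i \<in> {1..N (tail G e)}"
      by (simp add: weight)
    show ?thesis using VE by (auto simp: s x act_ed[OF VE(2) i])
  next
    case EV
    then have i: "i \<in> {1..N (tail G e)}"
      by (simp add: weight)
    have "out_arcs G (tail G e) \<noteq> {}"
      using EV(2) by auto
    then show ?thesis
      using EV phi(3)[of "tail G e" i m] i by (auto simp: s x act_ed[OF EV(2) i])
  next
    case VG
    then have i: "i \<in> {1..N (tail G e)}"
      by (simp add: weight)
    show ?thesis using VG by (auto simp: s x act_gh[OF VG(2) i])
  next
    case GV
    then have i: "i \<in> {1..N (tail G e)}"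
      by (simp add: weight)
    show ?thesis
      using GV psi(1)[of e] by (auto simp: s x act_gh[OF GV(2) i])
  next
    case CK1
    have v: "v \<in> verts G" "out_arcs G v \<noteq> {}" and ij: "i \<in> {1..N v}" "j \<in> {1..N v}"
      using CK1 by (auto simp: regular_verts vertex_weight)
    \<comment> \<open>Only the edge chosen by \<open>\<phi> v (i, m)\<close> is defined at the
      point, and the ghost edge brings the point back with index \<open>i\<close>, which forces
      \<open>j = i\<close>.\<close>
    have arc: "act (ed w e i * gh w e j) f x =
        (if u = v \<and> u \<notin> H \<and> e = fst (\<phi> v (i, m)) \<and> i = j then f x else 0)" if "e \<in> out_arcs G v" for e
    proof -
      have e: "e \<in> arcs G" "tail G e = v"
        using that by auto
      show ?thesis
      proof (cases "u = v \<and> u \<notin> H \<and> e = fst (\<phi> v (i, m))")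
        case True
        then have p: "head G e \<notin> H" "\<psi> v (e, snd (\<phi> v (i, m))) = (i, m)"
          using phi(3,4)[of v i m] v ij by auto
        then show ?thesis
          using True e ij by (auto simp: s x act_ed act_gh)
      next
        case False
        then show ?thesis
          using e ij by (auto simp: s x act_ed)
      qed
    qed
    have "act (\<Sum>e\<in>out_arcs G v. ed w e i * gh w e j) f x =
        (\<Sum>e\<in>out_arcs G v. if u = v \<and> u \<notin> H \<and> e = fst (\<phi> v (i, m)) \<and> i = j then f x else 0)"
      unfolding alg_act_simps using arc by (rule sum.cong[OF HOL.refl])
    also have "\<dots> = (if u = v \<and> u \<notin> H \<and> i = j then f x else 0)"
    proof (cases "u = v \<and> u \<notin> H \<and> i = j")
      case True
      then have "fst (\<phi> v (i, m)) \<in> out_arcs G v"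
        using phi(1,2)[of v i m] v ij by auto
      then show ?thesis
        using True by (simp add: sum.delta[OF finite_out_arcs] sum.delta'[OF finite_out_arcs])
    qed (auto intro!: sum.neutral)
    finally show ?thesis
      using CK1(1) by (auto simp: s x)
  next
    case CK2
    have v: "v \<in> verts G" "out_arcs G v \<noteq> {}" and e: "e \<in> arcs G" "tail G e = v" and g: "g \<in> arcs G" "tail G g = v"
      using CK2 by (auto simp: regular_verts)
    have arc: "act (gh w e i * ed w g i) f x =
        (if u = head G e \<and> u \<notin> H \<and> i = fst (\<psi> v (e, m)) \<and> e = g then f x else 0)" if "i \<in> {1..N v}" for i
    proof (cases "u = head G e \<and> u \<notin> H \<and> i = fst (\<psi> v (e, m))")
      case True
      then have p: "v \<notin> H" "\<phi> v (i, snd (\<psi> v (e, m))) = (e, m)"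
        using psi(1)[of e] psi(3)[of e m] e by auto
      then show ?thesis
        using True e g that by (auto simp: s x act_ed act_gh)
    next
      case False
      then show ?thesis
        using e g that by (auto simp: s x act_gh)
    qed
    have "act (\<Sum>i\<in>{1..N v}. gh w e i * ed w g i) f x =
        (\<Sum>i\<in>{1..N v}. if u = head G e \<and> u \<notin> H \<and> i = fst (\<psi> v (e, m)) \<and> e = g then f x else 0)"
      unfolding alg_act_simps using arc by (rule sum.cong[OF HOL.refl])
    also have "\<dots> = (if u = head G e \<and> u \<notin> H \<and> e = g then f x else 0)"
    proof (cases "u = head G e \<and> u \<notin> H \<and> e = g")
      case True
      then have "fst (\<psi> v (e, m)) \<in> {1..N v}"
        using psi(2)[of e m] e by auto
      then show ?thesis
        using True by (simp add: sum.delta sum.delta')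
    qed (auto intro!: sum.neutral)
    finally show ?thesis
      using CK2(1) v by (auto simp: s x vertex_weight)
  qed
qed

lemma act_rel_ideal: "p \<in> rel_ideal (lpa_gens G w) (lpa_rels G w) \<Longrightarrow> act p f x = 0"
  using act_lpa_rels by (rule alg_act_rel_ideal)

end

text \<open>Both sides are a finite nonempty set times the natural numbers, hence countably
  infinite. On the edge side nonemptiness is saturation of \<open>H\<close>: a vertex outside
  \<open>H\<close> that emits edges emits one ending outside \<open>H\<close>.\<close>

lemma (in balanced_graph) leavitt_rep_exists:
  assumes "hered_sat G H"
  shows "\<exists>\<phi>. leavitt_rep G N w H \<phi>"
proof -
  let ?P = "\<lambda>v b. bij_betw b ({1..N v} \<times> (UNIV :: nat set)) ({e \<in> out_arcs G v. head G e \<notin> H} \<times> (UNIV :: nat set))"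
  have "\<exists>b. ?P v b" if v: "v \<in> verts G - H" "out_arcs G v \<noteq> {}" for v
  proof -
    have *: "bij_betw (to_nat_on (A \<times> UNIV)) (A \<times> (UNIV :: nat set)) UNIV" if "finite A" "A \<noteq> {}" for A :: "'x set"
    proof (rule to_nat_on_infinite)
      show "countable (A \<times> (UNIV :: nat set))"
        by (rule countable_SIGMA[OF countable_finite[OF that(1)] countableI_type])
      show "infinite (A \<times> (UNIV :: nat set))"
        using that(2) infinite_UNIV_nat by (simp add: finite_cartesian_product_iff)
    qed
    have "{e \<in> out_arcs G v. head G e \<notin> H} \<noteq> {}"
      using v hered_satD(3)[OF assms, of v] by auto
    moreover have "finite {e \<in> out_arcs G v. head G e \<notin> H}"
      using finite_out_arcs[of v] by simp
    ultimately have 1: "bij_betw (to_nat_on ({e \<in> out_arcs G v. head G e \<notin> H} \<times> UNIV))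
        ({e \<in> out_arcs G v. head G e \<notin> H} \<times> (UNIV :: nat set)) UNIV"
      by (intro *)
    obtain e where "e \<in> out_arcs G v"
      using v by blast
    then have "{1..N v} \<noteq> {}"
      using weight_pos[of e] by auto
    then have 2: "bij_betw (to_nat_on ({1..N v} \<times> UNIV)) ({1..N v} \<times> (UNIV :: nat set)) UNIV"
      by (intro *) auto
    show ?thesis
      using bij_betw_trans[OF 2 bij_betw_inv_into[OF 1]] by blast
  qed
  then have "?P v (SOME b. ?P v b)" if "v \<in> verts G - H" "out_arcs G v \<noteq> {}" for v
    using that by (intro someI_ex[of "?P v"])
  then show ?thesis
    using assms by (intro exI[of _ "\<lambda>v. SOME b. ?P v b"] leavitt_rep.intro balanced_graph_axioms leavitt_rep_axioms.intro)
qed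

text \<open>\<open>J\<close> is the annihilator of the representation. A vertex \<open>v\<close>
  outside \<open>H\<close> fixes the value 1 of the constant function at the point
  \<open>(v, 0, 0)\<close>, whereas vertices of \<open>H\<close> act as zero.\<close>

theorem (in balanced_graph) hered_sat_ideal:
  fixes K :: "'k::field itself"
  assumes "hered_sat G H"
  shows "\<exists>J. ideal J (wlpa K G w) \<and> (\<forall>v\<in>verts G. wlpa_vertex K G w v \<in> J \<longleftrightarrow> v \<in> H)"
proof -
  obtain \<phi> where "leavitt_rep G N w H \<phi>"
    using leavitt_rep_exists[OF assms] by blast
  then interpret leavitt_rep G N w H \<phi> .
  let ?X = "lpa_gens G w"
  let ?R = "lpa_rels G w :: (('v, 'e) lpa_gen fword \<Rightarrow>\<^sub>0 'k) set"
  let ?A = "wlpa K G w"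
  let ?cl = "alg_coset (rel_ideal ?X ?R)"
  define Z where "Z = {p \<in> free_alg ?X. \<forall>f x. act p f x = (0::'k)}"
  have R: "?R \<subseteq> free_alg ?X"
    by (rule lpa_rels_subset) unfold_locales
  have simps: "carrier ?A = ?cl ` free_alg ?X" "\<zero>\<^bsub>?A\<^esub> = ?cl 0"
    "\<And>p q. p \<in> free_alg ?X \<Longrightarrow> q \<in> free_alg ?X \<Longrightarrow> ?cl p \<otimes>\<^bsub>?A\<^esub> ?cl q = ?cl (p * q)"
    "\<And>p q. ?cl p \<oplus>\<^bsub>?A\<^esub> ?cl q = ?cl (p + q)"
    using presented_alg_simps[OF R, where u = "\<Sum>v\<in>verts G. vx v"] by (simp_all add: wlpa_def)
  interpret A: ring ?A
    by (rule ring_wlpa) unfold_locales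
  have mem: "?cl p \<in> ?cl ` Z \<longleftrightarrow> p \<in> Z" if "p \<in> free_alg ?X" for p
  proof
    assume "?cl p \<in> ?cl ` Z"
    then obtain q where q: "q \<in> Z" "?cl p = ?cl q"
      by blast
    then have "act (p - q) f x = 0" for f x
      by (intro act_rel_ideal) (simp add: alg_coset_eq_iff)
    then show "p \<in> Z"
      using q(1) that by (simp add: Z_def alg_act_diff)
  qed auto
  have Zsub: "Z \<subseteq> free_alg ?X"
    by (auto simp: Z_def)
  have Z0: "0 \<in> Z"
    by (simp add: Z_def free_alg_zero alg_act_simps)
  have Zadd: "p + q \<in> Z" if "p \<in> Z" "q \<in> Z" for p q
    using that by (simp add: Z_def free_alg_add alg_act_simps)
  have Zneg: "- p \<in> Z" if "p \<in> Z" for p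
    using that alg_act_diff[of rep 0 p] by (simp add: Z_def free_alg_uminus alg_act_simps)
  have Zmult: "a * p \<in> Z" "p * a \<in> Z" if "p \<in> Z" "a \<in> free_alg ?X" for a p
  proof -
    have "act p f = (\<lambda>_. 0)" for f
      using that(1) by (auto simp: Z_def)
    then show "a * p \<in> Z"  "p * a \<in> Z"
      using that by (simp_all add: Z_def alg_act_mult free_alg_mult alg_act_zero_fun)
  qed
  have "ideal (?cl ` Z) ?A"
  proof (rule idealI)
    show "ring ?A"
      by (rule A.ring_axioms)
    show "subgroup (?cl ` Z) (add_monoid ?A)"
    proof (rule A.add.subgroupI)
      show "?cl ` Z \<subseteq> carrier ?A"
        using Zsub by (auto simp: simps)
      show "?cl ` Z \<noteq> {}"
        using Z0 by blast
    next
      fix a assume "a \<in> ?cl ` Z"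
      then obtain p where p: "p \<in> Z" "a = ?cl p"
        by blast
      have "\<ominus>\<^bsub>?A\<^esub> a = ?cl (- p)"
        using p Zsub Zneg[OF p(1)]
        by (intro A.minus_equality) (auto simp: simps)
      then show "\<ominus>\<^bsub>?A\<^esub> a \<in> ?cl ` Z"
        using Zneg[OF p(1)] by auto
    next
      fix a b assume "a \<in> ?cl ` Z" "b \<in> ?cl ` Z"
      then show "a \<oplus>\<^bsub>?A\<^esub> b \<in> ?cl ` Z"
        using Zadd by (auto simp: simps)
    qed
  next
    fix a x assume "a \<in> ?cl ` Z" "x \<in> carrier ?A"
    then obtain p q where pq: "p \<in> Z" "a = ?cl p" "q \<in> free_alg ?X" "x = ?cl q"
      by (auto simp: simps)
    show "x \<otimes>\<^bsub>?A\<^esub> a \<in> ?cl ` Z" "a \<otimes>\<^bsub>?A\<^esub> x \<in> ?cl ` Z"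
      using pq Zsub Zmult[OF pq(1,3)] by (auto simp: simps subset_iff)
  qed
  moreover have "wlpa_vertex K G w v \<in> ?cl ` Z \<longleftrightarrow> v \<in> H" if v: "v \<in> verts G" for v
  proof -
    have "wlpa_vertex K G w v \<in> ?cl ` Z \<longleftrightarrow> vx v \<in> Z"
      unfolding wlpa_vertex_def using vx_mem[OF v] by (rule mem)
    also have "\<dots> \<longleftrightarrow> v \<in> H"
    proof
      assume "vx v \<in> Z"
      then have "act (vx v) (\<lambda>_. 1) (v, 0, 0) = (0::'k)"
        by (simp add: Z_def)
      then show "v \<in> H"
        by (simp add: act_vx split: if_splits)
    qed (simp add: Z_def vx_mem[OF v] act_vx)
    finally show ?thesis .
  qed
  ultimately show ?thesis
    by blast
qed

definition exit_free :: "('v, 'e) pre_digraph \<Rightarrow> 'e list \<Rightarrow> bool" where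
  "exit_free G p \<longleftrightarrow> (\<forall>e\<in>set p. out_arcs G (tail G e) = {e})"

lemma exit_free_Cons: "exit_free G (e # p) \<longleftrightarrow> out_arcs G (tail G e) = {e} \<and> exit_free G p"
  by (simp add: exit_free_def)

text \<open>The leading vertex letter keeps the word nonempty for \<open>k = 0\<close>, where it
  stands for \<open>x\<close>, the zeroth power in the corner at \<open>x\<close>.\<close>

definition cycle_word :: "'v \<Rightarrow> 'e list \<Rightarrow> nat \<Rightarrow> ('v, 'e) lpa_gen fword" where
  "cycle_word x p k = FWord (Vtx x # concat (replicate k (map (\<lambda>e. Edg e 1) p)))"

text \<open>Without exits the partial maps along \<open>p\<close> are defined everywhere above
  \<open>x\<close>, since each vertex on the way offers only one edge. The \<open>k\<close>-th power
  returns to \<open>x\<close> and raises the degree by \<open>k * length p\<close>, so a function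
  supported in one degree isolates one coefficient.\<close>

lemma cycle_words_independent:
  fixes c :: "nat \<Rightarrow> 'k::field"
  assumes "fin_digraph G"
    and p: "pre_digraph.awalk G x p x" "p \<noteq> []" "exit_free G p"
    and T: "finite T" "(\<Sum>k\<in>T. Poly_Mapping.single (cycle_word x p k) (c k)) \<in> rel_ideal (lpa_gens G (\<lambda>_. 1)) (lpa_rels G (\<lambda>_. 1))"
    and k: "k \<in> T"
  shows "c k = 0"
proof -
  interpret balanced_graph G "\<lambda>_. 1" "\<lambda>_. 1"
    using assms(1) by (intro balanced_graph.intro balanced_graph_axioms.intro) auto
  obtain \<phi> where "leavitt_rep G (\<lambda>_. 1) (\<lambda>_. 1) {} \<phi>"
    using leavitt_rep_exists[OF hered_sat_empty] by blast
  then interpret leavitt_rep G "\<lambda>_. 1" "\<lambda>_. 1" "{}" \<phi> .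
  have walk: "\<exists>m'. word_act rep (map (\<lambda>e. Edg e 1) q) (u, m, z) = Some (v, m', z + int (length q))"
    if "awalk u q v" "set q \<subseteq> set p" for u q v m z
    using that
  proof (induction q arbitrary: u m z)
    case Nil
    then show ?case by (simp add: awalk_Nil_iff)
  next
    case (Cons e q)
    then have e: "e \<in> arcs G" "u = tail G e" "awalk (head G e) q v" "out_arcs G u = {e}"
      using p(3) by (auto simp: awalk_Cons_iff exit_free_def)
    have "u \<in> verts G" "out_arcs G u \<noteq> {}" "1 \<in> {1..(1::nat)}"
      using e by auto
    from phi(1,2)[OF this(1) _ this(2,3), of m] have "fst (\<phi> u (1, m)) \<in> out_arcs G u"
      by simp
    then have "fst (\<phi> u (1, m)) = e"
      using e(4) by simp
    then show ?case
      using Cons.IH[OF e(3), of "snd (\<phi> u (1, m))" "z + 1"] Cons.prems(2) e(2) by (simp add: algebra_simps del: One_nat_def)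
  qed
  have power: "\<exists>m'. word_act rep (concat (replicate j (map (\<lambda>e. Edg e 1) p))) (x, m, z) = Some (x, m', z + int (j * length p))"
    for j m z
  proof (induction j arbitrary: m z)
    case (Suc j)
    obtain m' where "word_act rep (map (\<lambda>e. Edg e 1) p) (x, m, z) = Some (x, m', z + int (length p))"
      using walk[OF p(1) order_refl] by blast
    then show ?case
      using Suc[of m' "z + int (length p)"] by (simp add: word_act_append algebra_simps del: One_nat_def)
  qed simp
  define f :: "'a \<times> nat \<times> int \<Rightarrow> 'k" where "f = (\<lambda>(u, m, z). if z = int (k * length p) then 1 else 0)"
  have summand: "act (Poly_Mapping.single (cycle_word x p j) (c j)) f (x, 0, 0) = (if j = k then c j else 0)" for j
  proof -
    obtain m' where "word_act rep (concat (replicate j (map (\<lambda>e. Edg e 1) p))) (x, 0, 0) = Some (x, m', 0 + int (j * length p))"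
      using power by blast
    then have "act (Poly_Mapping.single (cycle_word x p j) (c j)) f (x, 0, 0) = c j * f (x, m', int (j * length p))"
      by (simp add: alg_act_simps cycle_word_def del: One_nat_def)
    also have "int (j * length p) = int (k * length p) \<longleftrightarrow> j = k"
      using p(2) by (simp del: of_nat_mult)
    then have "c j * f (x, m', int (j * length p)) = (if j = k then c j else 0)"
      by (simp add: f_def del: of_nat_mult)
    finally show ?thesis .
  qed
  have "0 = act (\<Sum>k\<in>T. Poly_Mapping.single (cycle_word x p k) (c k)) f (x, 0, 0)"
    using act_rel_ideal[OF T(2)] by simp
  also have "\<dots> = (\<Sum>j\<in>T. if j = k then c j else 0)"
    unfolding alg_act_simps using summand by (intro sum.cong HOL.refl) (simp only: alg_act_simps)
  also have "\<dots> = c k"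
    using T(1) k by simp
  finally show ?thesis
    by simp
qed

section \<open>Aperiodic paths\<close>

lemma nth_concat_replicate:
  assumes "k < m" "xs \<noteq> []"
  shows "concat (replicate m xs) ! (k * length xs) = hd xs"
proof -
  have m: "m = k + Suc (m - k - 1)"
    using assms(1) by simp
  have "length (concat (replicate k xs)) = k * length xs"
    by (induction k) auto
  then show ?thesis
    using assms(2) by (subst m, subst replicate_add) (simp add: nth_append hd_conv_nth)
qed

text \<open>If \<open>g\<close> is a prefix of \<open>q @ g\<close>, then \<open>g\<close> has period \<open>length q\<close>, hence also the period
  \<open>length q * length c\<close>; but its last letter leaves the cycle \<open>c\<close> that all earlier ones follow.\<close>

lemma aperiodic:
  assumes c: "c \<noteq> []" "f \<noteq> hd c" and g: "g = d @ concat (replicate m c) @ [f]"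
    and q: "q \<noteq> []" "length q \<le> m"
  shows "take (length g) (q @ g) \<noteq> g"
proof
  assume prefix: "take (length g) (q @ g) = g"
  let ?P = "length q" and ?n = "length c"
  have step: "g ! (j + ?P) = g ! j" if "j + ?P < length g" for j
  proof -
    have "g ! (j + ?P) = take (length g) (q @ g) ! (j + ?P)"
      by (simp only: prefix)
    also have "\<dots> = g ! j"
      using that by (simp add: nth_append)
    finally show ?thesis .
  qed
  have iter: "g ! (j + l * ?P) = g ! j" if "j + l * ?P < length g" for j l
    using that
  proof (induction l)
    case (Suc l)
    then show ?case using step[of "j + l * ?P"] by (simp add: algebra_simps)
  qed simp
  have less: "m - ?P < m"
    using q length_greater_0_conv[of q] by linarith
  have len: "length (concat (replicate m c)) = m * ?n"
    by (induction m) auto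
  \<comment> \<open>From the position of the last letter \<open>f\<close>, going back
    \<open>?n\<close> times the period \<open>?P\<close> means going back \<open>?P\<close> whole
    copies of \<open>c\<close>. This lands on the first letter of a copy, because \<open>?P\<close>
    is at most \<open>m\<close>.\<close>
  have "m * ?n = (m - ?P) * ?n + ?n * ?P"
    using q(2) by (simp add: mult.commute[of ?n] flip: add_mult_distrib)
  then have "g ! (length d + m * ?n) = g ! ((length d + (m - ?P) * ?n) + ?n * ?P)"
    by (simp add: add.assoc)
  also have "\<dots> = g ! (length d + (m - ?P) * ?n)"
    using \<open>m * ?n = (m - ?P) * ?n + ?n * ?P\<close> by (intro iter) (simp add: g len)
  also have "\<dots> = concat (replicate m c) ! ((m - ?P) * ?n)"
  proof -
    have "(m - ?P) * ?n < m * ?n"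
      using less c(1) by (intro mult_strict_right_mono) auto
    then show ?thesis
      by (simp add: g nth_append len)
  qed
  also have "\<dots> = hd c"
    using less c(1) by (intro nth_concat_replicate) auto
  finally have "g ! (length d + m * ?n) = hd c" .
  moreover have "g ! (length d + m * ?n) = f"
    by (simp add: g nth_append len)
  ultimately show False
    using c(2) by simp
qed

context fin_digraph
begin

lemma awalk_concat_replicate: "awalk x c x \<Longrightarrow> awalk x (concat (replicate m c)) x"
  by (induction m) (auto simp: awalk_Nil_iff intro: awalk_appendI simp del: awalk_append_iff)

text \<open>Without sinks every vertex reaches a closed walk, and some edge \<open>e\<close> of that
  walk has a sibling \<open>f\<close>. Rotating the walk so that it begins with \<open>e\<close>
  puts the exit at its base point.\<close>

lemma exit_reachable:
  assumes no_sinks: "sinks G = {}"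
    and exits: "\<forall>x c. awalk x c x \<longrightarrow> c \<noteq> [] \<longrightarrow> \<not> exit_free G c"
    and v: "v \<in> verts G"
  obtains d x c f where "awalk v d x" "awalk x c x" "c \<noteq> []" "f \<in> arcs G" "tail G f = x" "f \<noteq> hd c"
proof -
  have "\<exists>e\<in>arcs G. tail G e = u \<and> head G e \<in> verts G" if "u \<in> verts G" for u
  proof -
    have "out_arcs G u \<noteq> {}"
      using that no_sinks unfolding sinks_def by blast
    then show ?thesis
      by auto
  qed
  then have "connects_to_cycle G v"
    using connects_to_cycle_if_successors[of "verts G" v] v by blast
  then obtain u d1 c1 where u: "awalk v d1 u" "awalk u c1 u" "c1 \<noteq> []"
    unfolding connects_to_cycle_iff reachable_awalk reachable1_awalk by blast
  obtain e where e: "e \<in> set c1" "out_arcs G (tail G e) \<noteq> {e}"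
    using exits u(2,3) unfolding exit_free_def by blast
  have eG: "e \<in> arcs G"
    using u(2) e(1) unfolding awalk_def by blast
  then have "e \<in> out_arcs G (tail G e)"
    by simp
  then obtain f where "f \<in> out_arcs G (tail G e)" and fe: "f \<noteq> e"
    using e(2) by blast
  then have f: "f \<in> arcs G" "tail G f = tail G e"
    by simp_all
  obtain p q where pq: "c1 = p @ e # q"
    using e(1) by (meson split_list)
  have w: "awalk u p (tail G e)" "awalk (tail G e) (e # q) u"
    using u(2) by (auto simp: pq awalk_Cons_iff)
  show ?thesis
  proof (rule that)
    show "awalk v (d1 @ p) (tail G e)"
      using u(1) w(1) by (rule awalk_appendI)
    show "awalk (tail G e) ((e # q) @ p) (tail G e)"
      using w(2,1) by (rule awalk_appendI)
  qed (use f fe in auto)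
qed

text \<open>Repeating the closed walk \<open>m\<close> times before taking the exit defeats all
  periods up to \<open>m\<close>. It follows that a ghost of \<open>g\<close> annihilates
  \<open>q @ g\<close> for every nonempty closed walk \<open>q\<close> of length at most
  \<open>m\<close>.\<close>

lemma aperiodic_walk_exists:
  assumes "sinks G = {}" "\<forall>x c. awalk x c x \<longrightarrow> c \<noteq> [] \<longrightarrow> \<not> exit_free G c" "v \<in> verts G"
  shows "\<exists>g w. awalk v g w \<and> (\<forall>q. q \<noteq> [] \<longrightarrow> length q \<le> m \<longrightarrow> take (length g) (q @ g) \<noteq> g)"
proof -
  obtain d x c f where w: "awalk v d x" "awalk x c x" "c \<noteq> []" "f \<in> arcs G" "tail G f = x" "f \<noteq> hd c"
    by (rule exit_reachable[OF assms])
  have "awalk x [f] (head G f)"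
    using w(4,5) by (auto simp: awalk_Cons_iff awalk_Nil_iff)
  then have "awalk v (d @ concat (replicate m c) @ [f]) (head G f)"
    using w(1) awalk_concat_replicate[OF w(2), of m] by (intro awalk_appendI)
  then show ?thesis
    using aperiodic[OF w(3,6) HOL.refl] by blast
qed

end

section \<open>The relations of a weighted Leavitt path algebra\<close>

locale weighted_leavitt = fin_digraph F + scalar_hom K
  for F :: "('v, 'e) pre_digraph" and K :: "'k::field \<Rightarrow> 'b::ring_1" +
  fixes N :: "'v \<Rightarrow> nat" and V :: "'v \<Rightarrow> 'b" and A S :: "'e \<Rightarrow> nat \<Rightarrow> 'b"
  assumes no_sinks: "sinks F = {}"
    and N_pos: "v \<in> verts F \<Longrightarrow> N v > 0"
    and VV: "u \<in> verts F \<Longrightarrow> v \<in> verts F \<Longrightarrow> V u * V v = (if u = v then V u else 0)"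
    and VA: "e \<in> arcs F \<Longrightarrow> i \<in> {1..N (tail F e)} \<Longrightarrow> V (tail F e) * A e i = A e i"
    and AV: "e \<in> arcs F \<Longrightarrow> i \<in> {1..N (tail F e)} \<Longrightarrow> A e i * V (head F e) = A e i"
    and VS: "e \<in> arcs F \<Longrightarrow> i \<in> {1..N (tail F e)} \<Longrightarrow> V (head F e) * S e i = S e i"
    and SV: "e \<in> arcs F \<Longrightarrow> i \<in> {1..N (tail F e)} \<Longrightarrow> S e i * V (tail F e) = S e i"
    and CK1: "v \<in> verts F \<Longrightarrow> i \<in> {1..N v} \<Longrightarrow> j \<in> {1..N v} \<Longrightarrow>
      (\<Sum>e\<in>out_arcs F v. A e i * S e j) = (if i = j then V v else 0)"
    and CK2: "e \<in> arcs F \<Longrightarrow> f \<in> arcs F \<Longrightarrow> tail F e = tail F f \<Longrightarrow>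
      (\<Sum>i\<in>{1..N (tail F e)}. S e i * A f i) = (if e = f then V (head F e) else 0)"
begin

inductive_set L :: "'b set" where
  V: "v \<in> verts F \<Longrightarrow> V v \<in> L"
| A: "e \<in> arcs F \<Longrightarrow> i \<in> {1..N (tail F e)} \<Longrightarrow> A e i \<in> L"
| S: "e \<in> arcs F \<Longrightarrow> i \<in> {1..N (tail F e)} \<Longrightarrow> S e i \<in> L"
| zero: "0 \<in> L"
| add: "a \<in> L \<Longrightarrow> b \<in> L \<Longrightarrow> a + b \<in> L"
| mult: "a \<in> L \<Longrightarrow> b \<in> L \<Longrightarrow> a * b \<in> L"
| scale: "a \<in> L \<Longrightarrow> K c * a \<in> L"

lemma L_sum: "(\<And>x. x \<in> X \<Longrightarrow> f x \<in> L) \<Longrightarrow> sum f X \<in> L"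
  by (induction X rule: infinite_finite_induct) (auto intro: L.zero L.add)

definition unit :: 'b where "unit = (\<Sum>v\<in>verts F. V v)"

lemma unit_V: "v \<in> verts F \<Longrightarrow> unit * V v = V v" "v \<in> verts F \<Longrightarrow> V v * unit = V v"
  unfolding unit_def sum_distrib_left sum_distrib_right by (simp_all add: VV)

lemma unit_L: "a \<in> L \<Longrightarrow> unit * a = a" "a \<in> L \<Longrightarrow> a * unit = a"
proof -
  have "unit * a = a \<and> a * unit = a" if "a \<in> L"
    using that
  proof induction
    case (A e i)
    have "unit * (V (tail F e) * A e i) = unit * V (tail F e) * A e i"
      "A e i * V (head F e) * unit = A e i * (V (head F e) * unit)"
      by (simp_all only: mult.assoc)
    then show ?case using A VA[OF A] AV[OF A] by (simp add: unit_V)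
  next
    case (S e i)
    have "unit * (V (head F e) * S e i) = unit * V (head F e) * S e i"
      "S e i * V (tail F e) * unit = S e i * (V (tail F e) * unit)"
      by (simp_all only: mult.assoc)
    then show ?case using S VS[OF S] SV[OF S] by (simp add: unit_V)
  next
    case (mult a b)
    have "unit * (a * b) = (unit * a) * b" "a * b * unit = a * (b * unit)"
      by (simp_all only: mult.assoc)
    then show ?case using mult.IH by simp
  next
    case (scale a c)
    have "unit * (K c * a) = K c * (unit * a)"
      by (simp only: mult.assoc[symmetric] K_commute[of c unit])
    then show ?case using scale by (simp add: mult.assoc)
  qed (auto simp: unit_V distrib_left distrib_right)
  then show "a \<in> L \<Longrightarrow> unit * a = a" "a \<in> L \<Longrightarrow> a * unit = a"
    by auto
qed

lemma nonzero_V: 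
  assumes "a \<in> L" "a \<noteq> 0"
  obtains v where "v \<in> verts F" "a * V v \<noteq> 0"
proof (rule ccontr)
  assume "\<not> thesis"
  then have "(\<Sum>v\<in>verts F. a * V v) = 0"
    using that by (intro sum.neutral) blast
  then have "a * unit = 0"
    by (simp add: unit_def sum_distrib_left)
  then show False
    using assms unit_L by simp
qed

definition L_ideal :: "'b set \<Rightarrow> bool" where
  "L_ideal J \<longleftrightarrow> 0 \<in> J \<and> (\<forall>a\<in>J. \<forall>b\<in>J. a + b \<in> J) \<and> (\<forall>a\<in>J. \<forall>x\<in>L. a * x \<in> J \<and> x * a \<in> J)"

lemma L_ideal_sum: "L_ideal J \<Longrightarrow> (\<And>x. x \<in> X \<Longrightarrow> f x \<in> J) \<Longrightarrow> sum f X \<in> J"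
  by (induction X rule: infinite_finite_induct) (auto simp: L_ideal_def)

lemma L_ideal_mult: "L_ideal J \<Longrightarrow> a \<in> J \<Longrightarrow> x \<in> L \<Longrightarrow> y \<in> L \<Longrightarrow> x * a * y \<in> J"
  unfolding L_ideal_def by blast

text \<open>By \<open>CK2\<close> the range of \<open>e\<close> is a sum of terms
  \<open>S e i * V (tail F e) * A e i\<close>, and by \<open>CK1\<close>, read at indices
  \<open>1, 1\<close>, a vertex is a sum of terms
  \<open>A e 1 * V (head F e) * S e 1\<close>.\<close>

lemma hered_sat_L_ideal:
  assumes J: "L_ideal J"
  shows "hered_sat F {v \<in> verts F. V v \<in> J}"
  unfolding hered_sat_def
proof (intro conjI ballI impI)
  fix e assume e: "e \<in> arcs F" "tail F e \<in> {v \<in> verts F. V v \<in> J}"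
  have "(\<Sum>i\<in>{1..N (tail F e)}. S e i * V (tail F e) * A e i) \<in> J"
    using e by (intro L_ideal_sum[OF J] L_ideal_mult[OF J] L.A L.S) auto
  also have "(\<Sum>i\<in>{1..N (tail F e)}. S e i * V (tail F e) * A e i) = V (head F e)"
    using CK2[of e e] e(1) SV[OF e(1)] by simp
  finally show "head F e \<in> {v \<in> verts F. V v \<in> J}"
    using e(1) by simp
next
  fix v assume v: "v \<in> verts F" "head F ` out_arcs F v \<subseteq> {v \<in> verts F. V v \<in> J}"
  have one: "1 \<in> {1..N v}"
    using N_pos[OF v(1)] by simp
  have "V (head F e) \<in> J" if "e \<in> out_arcs F v" for e
    using v(2) that by blast
  then have "(\<Sum>e\<in>out_arcs F v. A e 1 * V (head F e) * S e 1) \<in> J"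
    using one by (intro L_ideal_sum[OF J] L_ideal_mult[OF J] L.A L.S) auto
  also have "(\<Sum>e\<in>out_arcs F v. A e 1 * V (head F e) * S e 1) = (\<Sum>e\<in>out_arcs F v. A e 1 * S e 1)"
    using AV one by (intro sum.cong) auto
  also have "\<dots> = V v"
    using CK1[OF v(1) one one] by simp
  finally show "v \<in> {v \<in> verts F. V v \<in> J}"
    using v(1) by simp
qed auto

lemma L_ideal_vertex:
  assumes "hered_sat_trivial F" and J: "L_ideal J" and v: "v \<in> verts F" "V v \<in> J"
  shows "L \<subseteq> J"
proof
  have "{v \<in> verts F. V v \<in> J} = verts F"
    using assms(1) hered_sat_L_ideal[OF J] v unfolding hered_sat_trivial_def by blast
  then have V: "V u \<in> J" if "u \<in> verts F" for u
    using that by blast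
  then have "unit \<in> J"
    unfolding unit_def by (rule L_ideal_sum[OF J])
  fix a assume "a \<in> L"
  then have "unit * a \<in> J"
    using \<open>unit \<in> J\<close> J by (simp add: L_ideal_def)
  then show "a \<in> J"
    using unit_L \<open>a \<in> L\<close> by simp
qed

end

section \<open>The reduction theorem\<close>

locale leavitt = weighted_leavitt F K "\<lambda>_. 1" V "\<lambda>e _. A e" "\<lambda>e _. S e"
  for F :: "('v, 'e) pre_digraph" and K :: "'k::field \<Rightarrow> 'b::ring_1" and V :: "'v \<Rightarrow> 'b" and A S :: "'e \<Rightarrow> 'b"
begin

declare One_nat_def [simp del]

lemma VA1: "e \<in> arcs F \<Longrightarrow> V (tail F e) * A e = A e" and AV1: "e \<in> arcs F \<Longrightarrow> A e * V (head F e) = A e"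
  and VS1: "e \<in> arcs F \<Longrightarrow> V (head F e) * S e = S e" and SV1: "e \<in> arcs F \<Longrightarrow> S e * V (tail F e) = S e"
  using VA[of e 1] AV[of e 1] VS[of e 1] SV[of e 1] by simp_all

lemma A_in_L: "e \<in> arcs F \<Longrightarrow> A e \<in> L" and S_in_L: "e \<in> arcs F \<Longrightarrow> S e \<in> L"
  using L.A[of e 1] L.S[of e 1] by simp_all

lemma sum_A_S: "v \<in> verts F \<Longrightarrow> (\<Sum>e\<in>out_arcs F v. A e * S e) = V v"
  using CK1[of v 1 1] by simp

lemma S_A: "e \<in> arcs F \<Longrightarrow> f \<in> arcs F \<Longrightarrow> S e * A f = (if e = f then V (head F e) else 0)"
proof (cases "tail F e = tail F f")
  case True
  assume "e \<in> arcs F" "f \<in> arcs F"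
  then show ?thesis using CK2[of e f] True by simp
next
  case False
  assume e: "e \<in> arcs F" "f \<in> arcs F"
  have "S e * A f = (S e * V (tail F e)) * (V (tail F f) * A f)"
    using SV1[OF e(1)] VA1[OF e(2)] by simp
  also have "\<dots> = S e * (V (tail F e) * V (tail F f)) * A f"
    by (simp only: mult.assoc)
  finally have "S e * A f = S e * (V (tail F e) * V (tail F f)) * A f" .
  then show ?thesis using False e VV[of "tail F e" "tail F f"] by auto
qed

section \<open>Real paths and ghost paths\<close>

definition path :: "'v \<Rightarrow> 'e list \<Rightarrow> 'b" where
  "path u p = V u * prod_list (map A p)"

definition ghost :: "'v \<Rightarrow> 'e list \<Rightarrow> 'b" where
  "ghost u p = prod_list (map S (rev p)) * V u"

lemma path_Nil [simp]: "path u [] = V u" and ghost_Nil [simp]: "ghost u [] = V u"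
  by (simp_all add: path_def ghost_def)

lemma path_Cons: "e \<in> arcs F \<Longrightarrow> path (tail F e) (e # p) = A e * path (head F e) p"
  using VA1[of e] AV1[of e] by (simp add: path_def flip: mult.assoc)

lemma ghost_Cons: "e \<in> arcs F \<Longrightarrow> ghost (tail F e) (e # p) = ghost (head F e) p * S e"
  using SV1[of e] VS1[of e] by (simp add: ghost_def mult.assoc)

lemma V_path: "u \<in> verts F \<Longrightarrow> V u * path u p = path u p"
  by (simp add: path_def VV flip: mult.assoc)

lemma ghost_V: "u \<in> verts F \<Longrightarrow> ghost u p * V u = ghost u p"
  by (simp add: ghost_def VV mult.assoc)

lemma path_V: "awalk u p w \<Longrightarrow> path u p * V w = path u p"
proof (induction p arbitrary: u)
  case (Cons e p)
  then have "e \<in> arcs F" "u = tail F e" "awalk (head F e) p w"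
    by (simp_all add: awalk_Cons_iff)
  then show ?case using Cons.IH by (simp add: path_Cons mult.assoc)
qed (simp add: awalk_Nil_iff VV)

lemma V_ghost: "awalk u p w \<Longrightarrow> V w * ghost u p = ghost u p"
proof (induction p arbitrary: u)
  case (Cons e p)
  then have "e \<in> arcs F" "u = tail F e" "awalk (head F e) p w"
    by (simp_all add: awalk_Cons_iff)
  then show ?case using Cons.IH by (simp add: ghost_Cons flip: mult.assoc)
qed (simp add: awalk_Nil_iff VV)

lemma path_append: "awalk u p w \<Longrightarrow> path u (p @ q) = path u p * path w q"
proof (induction p arbitrary: u)
  case (Cons e p)
  then have "e \<in> arcs F" "u = tail F e" "awalk (head F e) p w"
    by (simp_all add: awalk_Cons_iff)
  then show ?case using Cons.IH by (simp add: path_Cons mult.assoc)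
qed (simp add: awalk_Nil_iff V_path)

lemma path_in_L: "awalk u p w \<Longrightarrow> path u p \<in> L"
proof (induction p arbitrary: u)
  case (Cons e p)
  then have "e \<in> arcs F" "u = tail F e" "awalk (head F e) p w"
    by (simp_all add: awalk_Cons_iff)
  then show ?case using Cons.IH by (simp add: path_Cons L.mult A_in_L)
qed (simp add: awalk_Nil_iff L.V)

lemma ghost_in_L: "awalk u p w \<Longrightarrow> ghost u p \<in> L"
proof (induction p arbitrary: u)
  case (Cons e p)
  then have "e \<in> arcs F" "u = tail F e" "awalk (head F e) p w"
    by (simp_all add: awalk_Cons_iff)
  then show ?case using Cons.IH by (simp add: ghost_Cons L.mult S_in_L)
qed (simp add: awalk_Nil_iff L.V)

lemma ghost_path:
  assumes "awalk u p w" "awalk v q w'" "length p \<le> length q"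
  shows "ghost u p * path v q = (if u = v \<and> take (length p) q = p then path w (drop (length p) q) else 0)"
  using assms
proof (induction p arbitrary: u v q)
  case Nil
  then have u: "u = w" "u \<in> verts F" "v \<in> verts F"
    by (auto simp: awalk_Nil_iff)
  have "V u * path v q = V u * V v * prod_list (map A q)"
    by (simp add: path_def mult.assoc)
  then show ?case using u by (simp add: VV path_def)
next
  case (Cons e p)
  then obtain f q' where q: "q = f # q'"
    by (cases q) auto
  have e: "e \<in> arcs F" "u = tail F e" "awalk (head F e) p w"
    and f: "f \<in> arcs F" "v = tail F f" "awalk (head F f) q' w'"
    using Cons.prems by (simp_all add: awalk_Cons_iff q)
  have "ghost u (e # p) * path v q = ghost (head F e) p * (S e * A f) * path (head F f) q'"
    using e f by (simp add: q ghost_Cons path_Cons mult.assoc)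
  also have "\<dots> = (if e = f then ghost (head F e) p * path (head F f) q' else 0)"
    using e f by (simp add: S_A ghost_V)
  also have "\<dots> = (if u = v \<and> take (length (e # p)) q = e # p then path w (drop (length (e # p)) q) else 0)"
    using Cons.IH[OF e(3) f(3)] Cons.prems(3) e f by (auto simp: q)
  finally show ?case .
qed

lemma ghost_path_self: "awalk u p w \<Longrightarrow> ghost u p * path u p = V w"
  using ghost_path[of u p w u p w] by simp

text \<open>Expanding the end vertex of the path as the sum of all \<open>A e * S e\<close> shows
  that at least one prolongation stays nonzero. There are no sinks, so this can be repeated
  \<open>n\<close> times.\<close>

lemma nonzero_path:
  assumes "a \<in> L" "a \<noteq> 0"
  shows "\<exists>u p w. awalk u p w \<and> length p = n \<and> a * path u p \<noteq> 0"
proof (induction n)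
  case 0
  obtain v where "v \<in> verts F" "a * V v \<noteq> 0"
    using nonzero_V[OF assms] .
  then show ?case
    by (intro exI[of _ v] exI[of _ "[]"]) (simp add: awalk_Nil_iff)
next
  case (Suc n)
  then obtain u p w where p: "awalk u p w" "length p = n" "a * path u p \<noteq> 0"
    by blast
  have "(\<Sum>e\<in>out_arcs F w. a * path u p * A e * S e) = a * path u p * (\<Sum>e\<in>out_arcs F w. A e * S e)"
    by (simp add: sum_distrib_left mult.assoc)
  also have "\<dots> = a * path u p"
    using p(1) awalk_last_in_verts[OF p(1)] by (simp add: sum_A_S mult.assoc path_V)
  finally have "(\<Sum>e\<in>out_arcs F w. a * path u p * A e * S e) \<noteq> 0"
    using p(3) by simp
  then obtain e where e: "e \<in> out_arcs F w" "a * path u p * A e * S e \<noteq> 0"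
    by (rule sum.not_neutral_contains_not_neutral)
  then have arc: "awalk w [e] (head F e)" "path w [e] = A e"
    using AV1[of e] path_Cons[of e "[]"] by (auto simp: awalk_Cons_iff awalk_Nil_iff)
  have "a * path u (p @ [e]) = a * path u p * A e"
    using path_append[OF p(1), of "[e]"] arc(2) by (simp add: mult.assoc)
  then have "a * path u (p @ [e]) \<noteq> 0"
    using e(2) by auto
  then show ?case
    using awalk_appendI[OF p(1) arc(1)] p(2) by (intro exI[of _ u] exI[of _ "p @ [e]"] exI[of _ "head F e"]) simp
qed

section \<open>Combinations of real paths with a common end\<close>

inductive_set path_span :: "'v \<Rightarrow> 'b set" for w where
  zero: "0 \<in> path_span w"
| path: "awalk u p w \<Longrightarrow> path u p \<in> path_span w"
| add: "a \<in> path_span w \<Longrightarrow> b \<in> path_span w \<Longrightarrow> a + b \<in> path_span w"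
| scale: "a \<in> path_span w \<Longrightarrow> K c * a \<in> path_span w"

lemma path_span_mult:
  assumes p: "awalk w p w'" and a: "\<And>u q. awalk u q w' \<Longrightarrow> length p \<le> length q \<Longrightarrow> a * path u q \<in> path_span w'"
    and x: "x \<in> path_span w"
  shows "a * (x * path w p) \<in> path_span w'"
  using x
proof induction
  case (path u q)
  then have "awalk u (q @ p) w'"
    using p by (rule awalk_appendI)
  then show ?case
    using a[of u "q @ p"] path_append[OF path, of p] by simp
next
  case (scale x c)
  have "a * (K c * x * path w p) = K c * (a * (x * path w p))"
    by (simp only: mult.assoc[symmetric] K_commute[of c a])
  then show ?case using scale by (simp add: path_span.scale)
qed (auto simp: path_span.zero distrib_left distrib_right intro: path_span.add)

text \<open>A ghost edge consumes one edge of a path to its right; vertices and real edges consume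
  none. So any element turns sufficiently long paths into combinations of real paths.\<close>

lemma path_span_absorbs:
  assumes "a \<in> L"
  shows "\<exists>n. \<forall>u p w. awalk u p w \<longrightarrow> n \<le> length p \<longrightarrow> a * path u p \<in> path_span w"
  using assms
proof induction
  case (V v)
  have "V v * path u p \<in> path_span w" if "awalk u p w" for u p w
    using ghost_path[of v "[]" v u p w] that V by (auto simp: awalk_Nil_iff intro: path_span.zero path_span.path)
  then show ?case by blast
next
  case (A e i)
  have "A e * path u p \<in> path_span w" if p: "awalk u p w" for u p w
  proof (cases "u = head F e")
    case True
    then have "awalk (tail F e) (e # p) w"
      using A(1) p by (simp add: awalk_Cons_iff)
    then show ?thesis
      using path_Cons[OF A(1), of p] True path_span.path[of "tail F e" "e # p" w] by simp
  next
    case False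
    have "A e * path u p = A e * (V (head F e) * V u) * prod_list (map A p)"
      using AV1[OF A(1)] by (simp add: path_def flip: mult.assoc)
    then show ?thesis
      using False A(1) awalk_hd_in_verts[OF p] by (simp add: VV path_span.zero)
  qed
  then show ?case by blast
next
  case (S e i)
  have "S e * path u p \<in> path_span w" if p: "awalk u p w" "1 \<le> length p" for u p w
  proof -
    obtain f q where q: "p = f # q"
      using p(2) by (cases p) auto
    have f: "f \<in> arcs F" "u = tail F f" "awalk (head F f) q w"
      using p(1) by (simp_all add: awalk_Cons_iff q)
    have "S e * path u p = S e * A f * path (head F f) q"
      using f by (simp add: q path_Cons mult.assoc)
    also have "\<dots> = (if e = f then path (head F f) q else 0)"
      using S(1) f by (simp add: S_A V_path)
    finally show ?thesis
      using f(3) by (auto intro: path_span.zero path_span.path)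
  qed
  then show ?case by blast
next
  case zero
  show ?case by (simp add: path_span.zero)
next
  case (add a b)
  then obtain m n where "\<forall>u p w. awalk u p w \<longrightarrow> m \<le> length p \<longrightarrow> a * path u p \<in> path_span w"
    "\<forall>u p w. awalk u p w \<longrightarrow> n \<le> length p \<longrightarrow> b * path u p \<in> path_span w"
    by blast
  then show ?case
    by (intro exI[of _ "max m n"]) (simp add: distrib_right path_span.add)
next
  case (mult a b)
  then obtain m n where m: "\<forall>u p w. awalk u p w \<longrightarrow> m \<le> length p \<longrightarrow> a * path u p \<in> path_span w"
    and n: "\<forall>u p w. awalk u p w \<longrightarrow> n \<le> length p \<longrightarrow> b * path u p \<in> path_span w"
    by blast
  \<comment> \<open>The first \<open>n\<close> edges serve \<open>b\<close>. The result is prolonged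
    by the remaining ones, at least \<open>m\<close> in number, which is what \<open>a\<close>
    requires.\<close>
  have "a * b * path u p \<in> path_span w" if p: "awalk u p w" "n + m \<le> length p" for u p w
  proof -
    define p1 p2 where "p1 = take n p" and "p2 = drop n p"
    have pp: "p = p1 @ p2"
      by (simp add: p1_def p2_def)
    obtain w1 where w1: "awalk u p1 w1" "awalk w1 p2 w"
      using p(1) unfolding pp by auto
    have len: "length p1 = n" "m \<le> length p2"
      using p(2) by (auto simp: p1_def p2_def)
    have "b * path u p1 \<in> path_span w1"
      using n w1(1) len by blast
    then have "a * ((b * path u p1) * path w1 p2) \<in> path_span w"
      using m len by (intro path_span_mult[OF w1(2)]) auto
    then show ?thesis
      using path_append[OF w1(1), of p2] by (simp add: pp mult.assoc)
  qed
  then show ?case by blast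
next
  case (scale a c)
  then obtain n where "\<forall>u p w. awalk u p w \<longrightarrow> n \<le> length p \<longrightarrow> a * path u p \<in> path_span w"
    by blast
  then show ?case
    by (intro exI[of _ n]) (simp add: mult.assoc path_span.scale)
qed

text \<open>Indexing by a set of pairs merges equal paths. Distinctness of the paths in the sum is
  what the cancellation in \<open>reduction\<close> rests on.\<close>

lemma path_span_sum:
  assumes "x \<in> path_span w"
  shows "\<exists>T c. finite T \<and> (\<forall>(u, p)\<in>T. awalk u p w) \<and> x = (\<Sum>(u, p)\<in>T. K (c (u, p)) * path u p)"
  using assms
proof induction
  case zero
  show ?case by (intro exI[of _ "{}"]) simp
next
  case (path u p)
  then show ?case
    by (intro exI[of _ "{(u, p)}"] exI[of _ "\<lambda>_. 1"]) (simp add: K_1)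
next
  case (add a b)
  from add.IH obtain T c U d where T: "finite T" "\<forall>(u, p)\<in>T. awalk u p w" "a = (\<Sum>(u, p)\<in>T. K (c (u, p)) * path u p)"
    and U: "finite U" "\<forall>(u, p)\<in>U. awalk u p w" "b = (\<Sum>(u, p)\<in>U. K (d (u, p)) * path u p)"
    by blast
  define c' d' where "c' t = (if t \<in> T then c t else 0)" and "d' t = (if t \<in> U then d t else 0)" for t
  have "a = (\<Sum>(u, p)\<in>T \<union> U. K (c' (u, p)) * path u p)"
    unfolding T(3) using T(1) U(1) by (intro sum.mono_neutral_cong_left) (auto simp: c'_def K_0)
  moreover have "b = (\<Sum>(u, p)\<in>T \<union> U. K (d' (u, p)) * path u p)"
    unfolding U(3) using T(1) U(1) by (intro sum.mono_neutral_cong_left) (auto simp: d'_def K_0)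
  ultimately have "a + b = (\<Sum>(u, p)\<in>T \<union> U. K (c' (u, p) + d' (u, p)) * path u p)"
    by (simp add: K_add distrib_right sum.distrib case_prod_beta)
  then show ?case
    using T(1,2) U(1,2) by (intro exI[of _ "T \<union> U"] exI[of _ "\<lambda>t. c' t + d' t"]) auto
next
  case (scale a k)
  from scale.IH obtain T c where T: "finite T" "\<forall>(u, p)\<in>T. awalk u p w" "a = (\<Sum>(u, p)\<in>T. K (c (u, p)) * path u p)"
    by blast
  then have "K k * a = (\<Sum>(u, p)\<in>T. K (k * c (u, p)) * path u p)"
    by (simp add: sum_distrib_left K_mult mult.assoc case_prod_beta)
  then show ?case
    using T(1,2) by (intro exI[of _ T] exI[of _ "\<lambda>t. k * c t"]) auto
qed

text \<open>Cancelling with a shortest path \<open>p1\<close> leaves, from each term, zero or a real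
  path \<open>r\<close>; since all paths end at \<open>w\<close>, this \<open>r\<close> is closed.
  Multiplying by \<open>ghost w g\<close> and \<open>path w g\<close>, for an aperiodic
  \<open>g\<close>, kills every nonempty \<open>r\<close>, and only the term of \<open>p1\<close>
  survives.\<close>

theorem reduction:
  assumes exits: "\<forall>x c. awalk x c x \<longrightarrow> c \<noteq> [] \<longrightarrow> \<not> exit_free F c"
    and a: "a \<in> L" "a \<noteq> 0"
  obtains x y v where "x \<in> L" "y \<in> L" "v \<in> verts F" "x * a * y = V v"
proof -
  obtain n where n: "\<forall>u p w. awalk u p w \<longrightarrow> n \<le> length p \<longrightarrow> a * path u p \<in> path_span w"
    using path_span_absorbs[OF a(1)] by blast
  obtain u p w where p: "awalk u p w" "length p = n" "a * path u p \<noteq> 0"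
    using nonzero_path[OF a] by blast
  then have "a * path u p \<in> path_span w"
    using n by simp
  then obtain T c where T: "finite T" "\<forall>(u, p)\<in>T. awalk u p w"
    and b: "a * path u p = (\<Sum>(u, p)\<in>T. K (c (u, p)) * path u p)"
    using path_span_sum[OF \<open>a * path u p \<in> path_span w\<close>] by blast
  define T' where "T' = {t \<in> T. c t \<noteq> 0}"
  have T': "finite T'" "\<forall>(u, p)\<in>T'. awalk u p w"
    using T by (auto simp: T'_def)
  have b': "a * path u p = (\<Sum>(u, p)\<in>T'. K (c (u, p)) * path u p)"
    unfolding b using T(1) by (intro sum.mono_neutral_right) (auto simp: T'_def K_0)
  then have "T' \<noteq> {}"
    using p(3) by auto
  then obtain t where t: "t \<in> T'" "\<And>t'. t' \<in> T' \<Longrightarrow> length (snd t) \<le> length (snd t')"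
    using ex_has_least_nat[of "\<lambda>t. t \<in> T'" _ "\<lambda>t. length (snd t)"] by blast
  obtain u1 p1 where t_eq: "t = (u1, p1)"
    by (cases t)
  have p1: "awalk u1 p1 w" "c t \<noteq> 0"
    using t(1) T'(2) by (auto simp: t_eq T'_def)
  \<comment> \<open>The total length is a crude common bound for all the closed remainders
    \<open>r\<close> below.\<close>
  define m where "m = (\<Sum>t\<in>T'. length (snd t))"
  have w: "w \<in> verts F"
    using p(1) by (rule awalk_last_in_verts)
  obtain g w' where g: "awalk w g w'" "\<forall>q. q \<noteq> [] \<longrightarrow> length q \<le> m \<longrightarrow> take (length g) (q @ g) \<noteq> g"
    using aperiodic_walk_exists[OF no_sinks exits w] by blast
  have summand: "ghost w g * (ghost u1 p1 * path v q) * path w g = (if (v, q) = t then V w' else 0)"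
    if vq: "(v, q) \<in> T'" for v q
  proof -
    have q: "awalk v q w" "length p1 \<le> length q"
      using vq T'(2) t(2)[OF vq] by (auto simp: t_eq)
    have gp: "ghost u1 p1 * path v q = (if u1 = v \<and> take (length p1) q = p1 then path w (drop (length p1) q) else 0)"
      using ghost_path[OF p1(1) q] .
    show ?thesis
    proof (cases "u1 = v \<and> take (length p1) q = p1")
      case False
      then have "(v, q) \<noteq> t"
        by (auto simp: t_eq)
      moreover have "ghost u1 p1 * path v q = 0"
        using gp unfolding if_not_P[OF False] .
      ultimately show ?thesis by simp
    next
      case True
      define r where "r = drop (length p1) q"
      have qr: "q = p1 @ r"
        using True append_take_drop_id[of "length p1" q] by (simp add: r_def)
      have r: "awalk w r w"
      proof -
        have "awalk v p1 (awlast v p1)" "awalk (awlast v p1) r w"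
          using q(1) by (auto simp: qr)
        moreover have "awlast v p1 = w"
          using p1(1) True by auto
        ultimately show ?thesis
          by simp
      qed
      show ?thesis
      proof (cases "r = []")
        case rNil: True
        then have "(v, q) = t" "ghost u1 p1 * path v q = V w"
          using True gp by (auto simp: t_eq qr)
        then show ?thesis
          using g(1) w by (simp add: mult.assoc V_path ghost_path_self)
      next
        case False
        have "length (snd (v, q)) \<le> m"
          unfolding m_def using vq T'(1) by (intro member_le_sum) auto
        then have "length r \<le> m"
          by (simp add: qr)
        then have "take (length g) (r @ g) \<noteq> g"
          using False g(2) by blast
        moreover have "ghost w g * (path w r * path w g) = ghost w g * path w (r @ g)"
          using path_append[OF r] by simp
        ultimately have "ghost w g * (path w r * path w g) = 0"
          using ghost_path[OF g(1) awalk_appendI[OF r g(1)]] by simp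
        moreover have "(v, q) \<noteq> t"
          using False by (auto simp: t_eq qr)
        ultimately show ?thesis
          using True gp by (simp add: mult.assoc r_def)
      qed
    qed
  qed
  let ?x = "K (1 / c t) * (ghost w g * ghost u1 p1)" and ?y = "path u p * path w g"
  have "?x * a * ?y = K (1 / c t) * (ghost w g * (ghost u1 p1 * (a * path u p)) * path w g)"
    by (simp add: mult.assoc)
  also have "ghost w g * (ghost u1 p1 * (a * path u p)) * path w g =
      (\<Sum>(v, q)\<in>T'. K (c (v, q)) * (ghost w g * (ghost u1 p1 * path v q) * path w g))"
  proof -
    have comm: "x * (y * (K k * z)) * x' = K k * (x * (y * z) * x')" for x y z x' k
      by (simp only: mult.assoc[symmetric] K_commute[of k x] K_commute[of k y]) (simp only: mult.assoc K_commute[of k y, symmetric])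
    show ?thesis
      unfolding b' sum_distrib_left sum_distrib_right by (intro sum.cong HOL.refl) (auto simp: comm)
  qed
  also have "\<dots> = (\<Sum>t'\<in>T'. if t' = t then K (c t) * V w' else 0)"
    using summand by (intro sum.cong HOL.refl) auto
  also have "\<dots> = K (c t) * V w'"
    using T'(1) t(1) by simp
  also have "K (1 / c t) * (K (c t) * V w') = V w'"
    using p1(2) by (simp add: K_1 flip: mult.assoc K_mult)
  finally have "?x * a * ?y = V w'" .
  moreover have "?x \<in> L" "?y \<in> L"
    using path_in_L[OF p(1)] path_in_L[OF g(1)] ghost_in_L[OF p1(1)] ghost_in_L[OF g(1)]
    by (blast intro: L.mult L.scale)+
  ultimately show ?thesis
    using that awalk_last_in_verts[OF g(1)] by blast
qed

end

text \<open>The two facts that do not follow from the relations; for the presented algebra both come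
  from the representation.\<close>

locale faithful_leavitt = leavitt F K V A S
  for F :: "('v, 'e) pre_digraph" and K :: "'k::field \<Rightarrow> 'b::ring_1" and V :: "'v \<Rightarrow> 'b" and A S :: "'e \<Rightarrow> 'b" +
  assumes V_nonzero: "v \<in> verts F \<Longrightarrow> V v \<noteq> 0"
    and cycle_independent: "awalk x c x \<Longrightarrow> c \<noteq> [] \<Longrightarrow> exit_free F c \<Longrightarrow> finite T \<Longrightarrow>
      (\<Sum>k\<in>T. K (d k) * (V x * path x c ^ k)) = 0 \<Longrightarrow> k \<in> T \<Longrightarrow> d k = 0"
begin

text \<open>The reduction gives a vertex \<open>v\<close>, which is moved along a path to the base
  \<open>w\<close> of a closed walk \<open>c\<close> with an exit \<open>f\<close>. Then
  \<open>ghost w c * path w c\<close> is \<open>V w\<close>, but the reverse product is not: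
  \<open>S f\<close> annihilates \<open>path w c\<close> without annihilating
  \<open>V w\<close>.\<close>

lemma proper_isometry:
  assumes exits: "\<forall>x c. awalk x c x \<longrightarrow> c \<noteq> [] \<longrightarrow> \<not> exit_free F c"
    and a: "a \<in> L" "a \<noteq> 0"
  shows "\<exists>x\<in>L. \<exists>y\<in>L. \<exists>c\<in>L. \<exists>d\<in>L. \<exists>w\<in>L. x * a * y = w \<and> w * w = w \<and>
    d * c = w \<and> c * w = c \<and> w * c = c \<and> d * w = d \<and> w * d = d \<and> c * d \<noteq> w"
proof -
  obtain x y v where r: "x \<in> L" "y \<in> L" "v \<in> verts F" "x * a * y = V v"
    by (rule reduction[OF exits a])
  obtain p w c f where w: "awalk v p w" "awalk w c w" "c \<noteq> []" "f \<in> arcs F" "tail F f = w" "f \<noteq> hd c"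
    by (rule exit_reachable[OF no_sinks exits r(3)])
  have wF: "w \<in> verts F"
    using w(1) by (rule awalk_last_in_verts)
  have "path w c * ghost w c \<noteq> V w"
  proof
    assume *: "path w c * ghost w c = V w"
    obtain e q where e: "c = e # q"
      using w(3) by (cases c) auto
    have eF: "e \<in> arcs F" "tail F e = w"
      using w(2) by (simp_all add: e awalk_Cons_iff)
    have "S f * path w c = S f * A e * path (head F e) q"
      using eF path_Cons[of e q] by (simp add: e mult.assoc)
    then have 0: "S f * path w c = 0"
      using S_A[OF w(4) eF(1)] w(6) by (simp add: e)
    have "S f * (path w c * ghost w c) * A f = (S f * path w c) * ghost w c * A f"
      by (simp only: mult.assoc)
    then have "S f * (path w c * ghost w c) * A f = 0"
      using 0 by simp
    moreover have "S f * V w * A f = V (head F f)"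
      using SV1[OF w(4)] S_A[OF w(4) w(4)] w(5) by simp
    ultimately show False
      using V_nonzero[of "head F f"] w(4) by (simp add: *)
  qed
  moreover have "(ghost v p * x) * a * (y * path v p) = ghost v p * (x * a * y) * path v p"
    by (simp only: mult.assoc)
  then have "(ghost v p * x) * a * (y * path v p) = V w"
    using r(3,4) w(1) by (simp add: ghost_V ghost_path_self)
  moreover have "V w * V w = V w"
    using wF by (simp add: VV)
  moreover have "ghost w c * path w c = V w" "path w c * V w = path w c" "V w * path w c = path w c"
    "ghost w c * V w = ghost w c" "V w * ghost w c = ghost w c"
    using w(2) wF by (simp_all only: ghost_path_self path_V V_path V_ghost ghost_V)
  ultimately have rel: "(ghost v p * x) * a * (y * path v p) = V w \<and> V w * V w = V w \<and>
    ghost w c * path w c = V w \<and> path w c * V w = path w c \<and> V w * path w c = path w c \<and>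
    ghost w c * V w = ghost w c \<and> V w * ghost w c = ghost w c \<and> path w c * ghost w c \<noteq> V w"
    by blast
  have "ghost v p * x \<in> L" "y * path v p \<in> L"
    using r(1,2) path_in_L[OF w(1)] ghost_in_L[OF w(1)] by (blast intro: L.mult)+
  then show ?thesis
    using path_in_L[OF w(2)] ghost_in_L[OF w(2)] L.V[OF wF] rel by blast
qed

lemma simple_if_exits:
  assumes "hered_sat_trivial F"
    and exits: "\<forall>x c. awalk x c x \<longrightarrow> c \<noteq> [] \<longrightarrow> \<not> exit_free F c"
    and J: "L_ideal J" "a \<in> J" "a \<in> L" "a \<noteq> 0"
  shows "L \<subseteq> J"
proof -
  obtain x y v where r: "x \<in> L" "y \<in> L" "v \<in> verts F" "x * a * y = V v"
    by (rule reduction[OF exits J(3,4)])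
  have "x * a * y \<in> J"
    using J(1,2) r(1,2) by (simp add: L_ideal_def)
  then show ?thesis
    using L_ideal_vertex[OF assms(1) J(1) r(3)] r(4) by simp
qed

end

section \<open>The case of a cycle without exits\<close>

text \<open>\<open>c_tl\<close> says that \<open>c\<close> does not return to \<open>x\<close>
  before its end, so that \<open>c\<close> is a single turn and its tail meets \<open>x\<close> only
  at the end.\<close>

locale exit_free_leavitt = faithful_leavitt F K V A S
  for F :: "('v, 'e) pre_digraph" and K :: "'k::field \<Rightarrow> 'b::ring_1" and V :: "'v \<Rightarrow> 'b" and A S :: "'e \<Rightarrow> 'b" +
  fixes x :: 'v and c :: "'e list"
  assumes trivial: "hered_sat_trivial F"
    and c: "awalk x c x" "c \<noteq> []" "exit_free F c"
    and c_tl: "x \<notin> tail F ` set (tl c)"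
begin

lemma x_in_verts: "x \<in> verts F"
  using c(1) by (rule awalk_last_in_verts)

text \<open>Saturation steps alone are enough, because the exit-free cycle itself is recovered by
  them. The induction principle is what makes the expansion of a vertex along its edges
  terminate.\<close>

inductive_set sat :: "'v set" where
  base: "x \<in> sat"
| step: "v \<in> verts F \<Longrightarrow> (\<And>e. e \<in> out_arcs F v \<Longrightarrow> head F e \<in> sat) \<Longrightarrow> v \<in> sat"

lemma sat_exit_free: "awalk u p x \<Longrightarrow> exit_free F p \<Longrightarrow> u \<in> sat"
proof (induction p arbitrary: u)
  case Nil
  then show ?case by (simp add: awalk_Nil_iff sat.base)
next
  case (Cons e p)
  then have e: "e \<in> arcs F" "u = tail F e" "awalk (head F e) p x" "out_arcs F u = {e}" "exit_free F p"
    by (simp_all add: awalk_Cons_iff exit_free_Cons)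
  show ?case
  proof (rule sat.step)
    show "u \<in> verts F"
      using e(1,2) by simp
    fix f assume "f \<in> out_arcs F u"
    then have "f = e"
      unfolding e(4) by simp
    then show "head F f \<in> sat"
      using Cons.IH[OF e(3,5)] by simp
  qed
qed

text \<open>Triviality forces this once \<open>sat\<close> is hereditary. At \<open>x\<close> that
  uses the absence of exits: the only edge is the first one of \<open>c\<close>, and its head
  returns to \<open>x\<close> without a choice.\<close>

lemma sat_eq: "sat = verts F"
proof -
  have "u \<in> verts F" if "u \<in> sat" for u
    using that
  proof cases
    case base
    show ?thesis
      unfolding base by (rule x_in_verts)
  qed
  moreover have "head F e \<in> sat" if "e \<in> arcs F" "tail F e \<in> sat" for e
    using that(2)
  proof cases
    case base
    obtain f q where f: "c = f # q"
      using c(2) by (cases c) auto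
    have f': "x = tail F f" "awalk (head F f) q x"
      using c(1) unfolding f awalk_Cons_iff by blast+
    have "exit_free F q" "out_arcs F x = {f}"
      using c(3) f'(1) unfolding f exit_free_Cons by simp_all
    moreover have "e \<in> out_arcs F x"
      using base that(1) by simp
    ultimately show ?thesis
      using sat_exit_free[OF f'(2)] by simp
  next
    case step
    show ?thesis
      by (rule step(2)) (simp add: that(1))
  qed
  moreover have "v \<in> sat" if "v \<in> verts F" "head F ` out_arcs F v \<subseteq> sat" for v
    by (rule sat.step) (use that in blast)+
  ultimately have "hered_sat F sat"
    unfolding hered_sat_def by blast
  then show ?thesis
    using trivial sat.base unfolding hered_sat_trivial_def by auto
qed

section \<open>Paths that meet the cycle vertex only at their end\<close>

definition first_paths :: "'v \<Rightarrow> 'e list set" where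
  "first_paths v = {p. awalk v p x \<and> x \<notin> tail F ` set p}"

lemma first_paths_x: "first_paths x = {[]}"
proof -
  have "p = []" if "p \<in> first_paths x" for p
    using that by (cases p) (auto simp: first_paths_def awalk_Cons_iff)
  moreover have "[] \<in> first_paths x"
    using x_in_verts by (simp add: first_paths_def awalk_Nil_iff)
  ultimately show ?thesis
    by blast
qed

lemma first_paths_step:
  assumes "v \<noteq> x"
  shows "first_paths v = (\<Union>e\<in>out_arcs F v. (#) e ` first_paths (head F e))"
proof (intro equalityI subsetI)
  fix p assume p: "p \<in> first_paths v"
  then obtain e q where "p = e # q"
    using assms by (cases p) (auto simp: first_paths_def awalk_Nil_iff)
  then show "p \<in> (\<Union>e\<in>out_arcs F v. (#) e ` first_paths (head F e))"
    using p by (auto simp: first_paths_def awalk_Cons_iff)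
qed (use assms in \<open>auto simp: first_paths_def awalk_Cons_iff\<close>)

lemma first_paths_unique:
  "p \<in> first_paths v \<Longrightarrow> q \<in> first_paths v \<Longrightarrow> exit_free F q \<Longrightarrow> p = q"
proof (induction q arbitrary: p v)
  case Nil
  then have "v = x"
    by (simp add: first_paths_def awalk_Nil_iff)
  then show ?case using Nil first_paths_x by simp
next
  case (Cons e q)
  then have v: "v = tail F e" "v \<noteq> x" "out_arcs F v = {e}" "exit_free F q" "q \<in> first_paths (head F e)"
    by (auto simp: first_paths_def awalk_Cons_iff exit_free_Cons)
  then obtain p' where "p = e # p'" "p' \<in> first_paths (head F e)"
    using Cons.prems(1) first_paths_step[of v] by auto
  then show ?case using Cons.IH v by simp
qed

text \<open>Expanding \<open>V v\<close> by \<open>CK1\<close> is repeated until every path has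
  arrived at \<open>x\<close>; the induction over \<open>sat\<close> shows that this stops, and also
  that there are only finitely many such paths.\<close>

lemma first_paths_sum:
  assumes "v \<in> verts F"
  shows "finite (first_paths v) \<and> (\<Sum>p\<in>first_paths v. path v p * ghost v p) = V v"
  using assms unfolding sat_eq[symmetric]
proof induction
  case base
  show ?case by (simp add: first_paths_x VV x_in_verts)
next
  case (step v)
  show ?case
  proof (cases "v = x")
    case True
    then show ?thesis by (simp add: first_paths_x VV x_in_verts)
  next
    case False
    have fin: "finite (first_paths v)"
      unfolding first_paths_step[OF False] using step.IH by auto
    have "(\<Sum>p\<in>first_paths v. path v p * ghost v p) =
        (\<Sum>e\<in>out_arcs F v. \<Sum>p\<in>(#) e ` first_paths (head F e). path v p * ghost v p)"
      unfolding first_paths_step[OF False]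
      using step.IH finite_out_arcs by (intro sum.UNION_disjoint) auto
    also have "\<dots> = (\<Sum>e\<in>out_arcs F v. A e * S e)"
    proof (intro sum.cong HOL.refl)
      fix e assume e: "e \<in> out_arcs F v"
      have "(\<Sum>p\<in>(#) e ` first_paths (head F e). path v p * ghost v p) =
          (\<Sum>p\<in>first_paths (head F e). A e * (path (head F e) p * ghost (head F e) p) * S e)"
        using e by (subst sum.reindex) (auto simp: path_Cons ghost_Cons mult.assoc intro!: sum.cong)
      also have "\<dots> = A e * V (head F e) * S e"
        using step.IH[OF e] by (simp flip: sum_distrib_left sum_distrib_right)
      finally show "(\<Sum>p\<in>(#) e ` first_paths (head F e). path v p * ghost v p) = A e * S e"
        using e by (simp add: AV1)
    qed
    finally show ?thesis
      using sum_A_S[OF step.hyps(1)] fin by simp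
  qed
qed

text \<open>No path of this kind is a proper prefix of another, since the longer one would then
  leave \<open>x\<close> again. So distinct ones differ at some edge, or in their starting vertex,
  and cancel to 0.\<close>

lemma first_paths_orthogonal:
  assumes "p \<in> first_paths u" "q \<in> first_paths v"
  shows "ghost u p * path v q = (if u = v \<and> p = q then V x else 0)"
  using assms
proof (induction p arbitrary: u v q)
  case Nil
  then have u: "u = x"
    by (simp add: first_paths_def awalk_Nil_iff)
  show ?case
  proof (cases "v = x")
    case True
    then show ?thesis
      using Nil u x_in_verts by (simp add: first_paths_x VV)
  next
    case False
    have "v \<in> verts F"
      using Nil by (auto simp: first_paths_def)
    then show ?thesis
      using False u x_in_verts by (simp add: path_def VV flip: mult.assoc)
  qed
next
  case (Cons e p)
  then have e: "e \<in> arcs F" "u = tail F e" "u \<noteq> x" "p \<in> first_paths (head F e)"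
    by (auto simp: first_paths_def awalk_Cons_iff)
  show ?case
  proof (cases q)
    case Nil
    then have "v = x"
      using Cons.prems by (simp add: first_paths_def awalk_Nil_iff)
    then show ?thesis
      using e x_in_verts Nil by (simp add: ghost_def VV mult.assoc)
  next
    case q: (Cons f q')
    then have f: "f \<in> arcs F" "v = tail F f" "q' \<in> first_paths (head F f)"
      using Cons.prems by (auto simp: first_paths_def awalk_Cons_iff)
    have "ghost u (e # p) * path v q = ghost (head F e) p * (S e * A f) * path (head F f) q'"
      using e f by (simp add: q ghost_Cons path_Cons mult.assoc)
    also have "\<dots> = (if e = f then ghost (head F e) p * path (head F f) q' else 0)"
      using e f by (simp add: S_A ghost_V)
    also have "\<dots> = (if u = v \<and> e # p = q then V x else 0)"
      using Cons.IH[OF e(4) f(3)] e f by (auto simp: q)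
    finally show ?thesis .
  qed
qed

lemma path_ghost_exit_free: "awalk u p w \<Longrightarrow> exit_free F p \<Longrightarrow> path u p * ghost u p = V u"
proof (induction p arbitrary: u)
  case Nil
  then show ?case by (auto simp: awalk_Nil_iff VV)
next
  case (Cons e p)
  then have e: "e \<in> arcs F" "u = tail F e" "awalk (head F e) p w" "out_arcs F u = {e}" "exit_free F p"
    by (simp_all add: awalk_Cons_iff exit_free_Cons)
  have "path u (e # p) * ghost u (e # p) = A e * (path (head F e) p * ghost (head F e) p) * S e"
    using e(1,2) by (simp add: path_Cons ghost_Cons mult.assoc)
  also have "\<dots> = A e * S e"
    using Cons.IH[OF e(3,5)] e(1) by (simp add: AV1)
  also have "\<dots> = V u"
    using sum_A_S[of u] e by simp
  finally show ?case .
qed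

section \<open>Laurent polynomials in the cycle\<close>

definition C :: 'b where "C = path x c"
definition D :: 'b where "D = ghost x c"

lemma C_D: "C * D = V x" "D * C = V x" "V x * C = C" "C * V x = C" "V x * D = D" "D * V x = D"
  using c(1,3) x_in_verts
  by (simp_all add: C_def D_def path_ghost_exit_free ghost_path_self V_path path_V V_ghost ghost_V)

text \<open>\<open>C\<close> and \<open>D\<close> are mutually inverse in the corner with unit
  \<open>V x\<close>, not in the ambient ring. The factor \<open>V x\<close> corrects the zeroth
  power.\<close>

definition cpow :: "int \<Rightarrow> 'b" where
  "cpow k = (if k \<ge> 0 then V x * C ^ nat k else V x * D ^ nat (- k))"

lemma VxVx: "V x * V x = V x"
  using x_in_verts by (simp add: VV)

lemma Vx_pow: "V x * C ^ n * V x = V x * C ^ n" "V x * D ^ n * V x = V x * D ^ n"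
proof -
  show "V x * C ^ n * V x = V x * C ^ n"
  proof (cases n)
    case (Suc m)
    then show ?thesis by (simp only: power_Suc2 mult.assoc C_D)
  qed (simp add: VxVx)
  show "V x * D ^ n * V x = V x * D ^ n"
  proof (cases n)
    case (Suc m)
    then show ?thesis by (simp only: power_Suc2 mult.assoc C_D)
  qed (simp add: VxVx)
qed

lemma cpow_step: "cpow (k + 1) = cpow k * C" "cpow (k - 1) = cpow k * D"
proof -
  have nonneg: "cpow (int n) = V x * C ^ n" "cpow (- int n) = V x * D ^ n" for n
    by (auto simp: cpow_def)
  have "cpow (k + 1) = cpow k * C \<and> cpow (k - 1) = cpow k * D"
  proof (cases k rule: int_cases3)
    case zero
    then show ?thesis
      using nonneg[of 0] nonneg[of 1] by (simp add: mult.assoc)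
  next
    case (pos n)
    then obtain m where m: "n = Suc m"
      by (cases n) auto
    have k1: "k + 1 = int (m + 2)" and k0: "k = int (Suc m)" and k2: "k - 1 = int m"
      using pos m by auto
    have "cpow (k + 1) = cpow k * C"
      unfolding k1 unfolding k0 nonneg by (simp add: power_Suc2 mult.assoc del: power_Suc)
    moreover have "cpow k * D = V x * C ^ m * (C * D)"
      unfolding k0 nonneg by (simp add: power_Suc2 mult.assoc del: power_Suc)
    then have "cpow (k - 1) = cpow k * D"
      unfolding k2 nonneg by (simp add: C_D Vx_pow)
    ultimately show ?thesis by simp
  next
    case (neg n)
    then obtain m where m: "n = Suc m"
      by (cases n) auto
    have k1: "k - 1 = - int (m + 2)" and k0: "k = - int (Suc m)" and k2: "k + 1 = - int m"
      using neg m by auto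
    have "cpow (k - 1) = cpow k * D"
      unfolding k1 unfolding k0 nonneg by (simp add: power_Suc2 mult.assoc del: power_Suc)
    moreover have "cpow k * C = V x * D ^ m * (D * C)"
      unfolding k0 nonneg by (simp add: power_Suc2 mult.assoc del: power_Suc)
    then have "cpow (k + 1) = cpow k * C"
      unfolding k2 nonneg by (simp add: C_D Vx_pow)
    ultimately show ?thesis by simp
  qed
  then show "cpow (k + 1) = cpow k * C" "cpow (k - 1) = cpow k * D"
    by auto
qed

lemma cpow_0: "cpow 0 = V x"
  by (simp add: cpow_def)

lemma cpow_add: "cpow (j + k) = cpow j * cpow k"
proof (induction k rule: int_induct[where k = 0])
  case base
  have "cpow j * V x = cpow j"
    unfolding cpow_def by (simp add: Vx_pow)
  then show ?case
    by (simp add: cpow_0)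
next
  case (step1 i)
  have "cpow (j + (i + 1)) = cpow (j + i) * C"
    using cpow_step(1)[of "j + i"] by (simp add: add.assoc)
  then show ?case
    using step1 cpow_step(1)[of i] by (simp add: mult.assoc)
next
  case (step2 i)
  have "cpow (j + (i - 1)) = cpow (j + i) * D"
    using cpow_step(2)[of "j + i"] by (simp add: add_diff_eq)
  then show ?case
    using step2 cpow_step(2)[of i] by (simp add: mult.assoc)
qed

definition ev :: "(int \<Rightarrow>\<^sub>0 'k) \<Rightarrow> 'b" where
  "ev = pm_extend K cpow"

lemma ev_0: "ev 0 = 0"
  and ev_add: "ev (f + g) = ev f + ev g"
  and ev_mult: "ev (f * g) = ev f * ev g"
  and ev_sum: "ev (sum h X) = (\<Sum>i\<in>X. ev (h i))"
  and ev_single: "ev (Poly_Mapping.single k d) = K d * cpow k"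
  by (simp_all add: ev_def pm_extend_0 pm_extend_add pm_extend_mult cpow_add pm_extend_sum pm_extend_single)

lemma ev_1: "ev 1 = V x"
  using ev_single[of 0 1] by (simp add: cpow_0 K_1)

lemma ev_Vx: "V x * ev f = ev f" "ev f * V x = ev f"
  using ev_mult[of 1 f] ev_mult[of f 1] by (simp_all add: ev_1)

lemma ev_in_L: "ev f \<in> L"
proof -
  have CD: "C \<in> L" "D \<in> L"
    unfolding C_def D_def using c(1) path_in_L ghost_in_L by blast+
  have "V x * C ^ n \<in> L" "V x * D ^ n \<in> L" for n
    using CD x_in_verts by (induction n) (auto simp: power_Suc2 L.V simp del: power_Suc simp flip: mult.assoc intro: L.mult)
  then have "cpow k \<in> L" for k
    by (simp add: cpow_def)
  then show ?thesis
    unfolding ev_def pm_extend_def by (intro L_sum L.scale)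
qed

lemma ev_inj:
  assumes "ev f = 0"
  shows "f = 0"
proof -
  let ?T = "Poly_Mapping.keys f"
  \<comment> \<open>Multiplying by \<open>cpow m\<close> clears the negative exponents, so that
    independence of the nonnegative powers applies. The inserted 0 keeps the maximum meaningful for
    empty \<open>?T\<close>.\<close>
  define m where "m = Max (insert 0 (uminus ` ?T))"
  have m: "0 \<le> k + m" if "k \<in> ?T" for k
  proof -
    have "- k \<le> m"
      unfolding m_def using that by (intro Max_ge) auto
    then show ?thesis by simp
  qed
  let ?h = "\<lambda>k. nat (k + m)"
  have inj: "inj_on ?h ?T"
    using m by (intro inj_onI) (metis add_right_cancel eq_nat_nat_iff)
  have "0 = ev f * cpow m"
    by (simp add: assms)
  also have "\<dots> = (\<Sum>k\<in>?T. K (Poly_Mapping.lookup f k) * (V x * path x c ^ ?h k))"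
    unfolding ev_def pm_extend_def sum_distrib_right
  proof (intro sum.cong HOL.refl)
    fix k assume "k \<in> ?T"
    then have "cpow k * cpow m = V x * path x c ^ ?h k"
      using m unfolding cpow_add[symmetric] by (simp add: cpow_def C_def)
    then show "K (Poly_Mapping.lookup f k) * cpow k * cpow m = K (Poly_Mapping.lookup f k) * (V x * path x c ^ ?h k)"
      by (simp add: mult.assoc)
  qed
  also have "\<dots> = (\<Sum>n\<in>?h ` ?T. K (Poly_Mapping.lookup f (int n - m)) * (V x * path x c ^ n))"
    using m by (subst sum.reindex[OF inj]) (intro sum.cong, auto)
  finally have "Poly_Mapping.lookup f (int n - m) = 0" if "n \<in> ?h ` ?T" for n
    using cycle_independent[OF c, of "?h ` ?T" "\<lambda>n. Poly_Mapping.lookup f (int n - m)" n] that by simp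
  then have "Poly_Mapping.lookup f k = 0" if "k \<in> ?T" for k
    using that m[OF that] by fastforce
  then have "k \<notin> ?T" for k
    by (metis in_keys_iff)
  then have "?T = {}"
    by blast
  then show ?thesis
    unfolding keys_eq_empty .
qed

end

context exit_free_leavitt
begin

section \<open>Matrix units and the isomorphism\<close>

definition all_first :: "('v \<times> 'e list) set" where
  "all_first = Sigma (verts F) first_paths"

lemma finite_all_first: "finite all_first"
  unfolding all_first_def using first_paths_sum by (intro finite_SigmaI) auto

definition npaths :: nat where "npaths = card all_first"

definition enum :: "nat \<Rightarrow> 'v \<times> 'e list" where
  "enum = (SOME f. bij_betw f {0..<npaths} all_first)"

lemma bij_enum: "bij_betw enum {0..<npaths} all_first"
proof -
  have "\<exists>f. bij_betw f {0..<npaths} all_first"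
    unfolding npaths_def by (rule ex_bij_betw_nat_finite[OF finite_all_first])
  then show ?thesis
    unfolding enum_def by (rule someI_ex)
qed

lemma enum_in: "i < npaths \<Longrightarrow> enum i \<in> all_first"
  using bij_betwE[OF bij_enum] by auto

lemma enum_mem: "i < npaths \<Longrightarrow> fst (enum i) \<in> verts F \<and> snd (enum i) \<in> first_paths (fst (enum i))"
  using enum_in[of i] by (cases "enum i") (simp add: all_first_def)

lemma enum_eq_iff: "i < npaths \<Longrightarrow> j < npaths \<Longrightarrow> enum i = enum j \<longleftrightarrow> i = j"
  using bij_enum by (auto simp: bij_betw_def inj_on_eq_iff)

lemma enum_surj:
  assumes "t \<in> all_first"
  obtains i where "i < npaths" "enum i = t"
  using assms bij_betw_imp_surj_on[OF bij_enum] by (metis atLeastLessThan_iff imageE)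

definition pcol :: "nat \<Rightarrow> 'b" where "pcol i = path (fst (enum i)) (snd (enum i))"
definition prow :: "nat \<Rightarrow> 'b" where "prow i = ghost (fst (enum i)) (snd (enum i))"

lemma prow_pcol:
  assumes "i < npaths" "j < npaths"
  shows "prow i * pcol j = (if i = j then V x else 0)"
proof -
  have "snd (enum i) \<in> first_paths (fst (enum i))" "snd (enum j) \<in> first_paths (fst (enum j))"
    using assms enum_mem by blast+
  from first_paths_orthogonal[OF this] show ?thesis
    using enum_eq_iff[OF assms] unfolding prow_def pcol_def prod_eq_iff by simp
qed

lemma walk_enum: "i < npaths \<Longrightarrow> awalk (fst (enum i)) (snd (enum i)) x"
  using enum_mem[of i] by (simp add: first_paths_def)

lemma pcol_Vx: "i < npaths \<Longrightarrow> pcol i * V x = pcol i"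
  using walk_enum[of i] by (simp add: pcol_def path_V)

lemma pcol_in_L: "i < npaths \<Longrightarrow> pcol i \<in> L" and prow_in_L: "i < npaths \<Longrightarrow> prow i \<in> L"
  unfolding pcol_def prow_def using path_in_L[OF walk_enum] ghost_in_L[OF walk_enum] by auto

lemma sum_pcol_prow: "(\<Sum>i\<in>{i. i < npaths \<and> fst (enum i) = v}. pcol i * prow i) = (if v \<in> verts F then V v else 0)"
proof -
  have "(\<Sum>i\<in>{i. i < npaths \<and> fst (enum i) = v}. pcol i * prow i) =
      (\<Sum>(u, p)\<in>{t \<in> all_first. fst t = v}. path u p * ghost u p)"
  proof -
    have "inj_on enum {i. i < npaths \<and> fst (enum i) = v}"
      using enum_eq_iff by (intro inj_onI) blast
    moreover have "enum ` {i. i < npaths \<and> fst (enum i) = v} = {t \<in> all_first. fst t = v}"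
      unfolding bij_betw_imp_surj_on[OF bij_enum, symmetric] by auto
    ultimately have "bij_betw enum {i. i < npaths \<and> fst (enum i) = v} {t \<in> all_first. fst t = v}"
      by (simp add: bij_betw_def)
    from sum.reindex_bij_betw[OF this, of "\<lambda>(u, p). path u p * ghost u p"] show ?thesis
      by (simp add: case_prod_beta pcol_def prow_def)
  qed
  also have "{t \<in> all_first. fst t = v} = (if v \<in> verts F then Pair v ` first_paths v else {})"
    by (auto simp: all_first_def)
  also have "(\<Sum>(u, p)\<in>\<dots>. path u p * ghost u p) = (if v \<in> verts F then V v else 0)"
    using first_paths_sum[of v] by (auto simp: sum.reindex inj_on_def)
  finally show ?thesis .
qed

definition to_alg :: "(int \<Rightarrow>\<^sub>0 'k) mat \<Rightarrow> 'b" where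
  "to_alg M = (\<Sum>i\<in>{0..<npaths}. \<Sum>j\<in>{0..<npaths}. pcol i * ev (M $$ (i, j)) * prow j)"

lemma to_alg_add:
  assumes "P \<in> carrier_mat npaths npaths" "Q \<in> carrier_mat npaths npaths"
  shows "to_alg (P + Q) = to_alg P + to_alg Q"
proof -
  have "to_alg (P + Q) = (\<Sum>i\<in>{0..<npaths}. \<Sum>j\<in>{0..<npaths}.
      pcol i * ev (P $$ (i, j)) * prow j + pcol i * ev (Q $$ (i, j)) * prow j)"
    unfolding to_alg_def using assms by (intro sum.cong HOL.refl) (simp add: ev_add distrib_left distrib_right)
  then show ?thesis
    by (simp add: to_alg_def sum.distrib)
qed

lemma to_alg_smult:
  assumes "P \<in> carrier_mat npaths npaths"
  shows "to_alg (Poly_Mapping.single 0 d \<cdot>\<^sub>m P) = K d * to_alg P"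
proof -
  have *: "pcol i * ev (Poly_Mapping.single 0 d * f) * prow j = K d * (pcol i * ev f * prow j)" for i j f
  proof -
    have "pcol i * ev (Poly_Mapping.single 0 d * f) * prow j = pcol i * K d * (V x * ev f) * prow j"
      by (simp add: ev_mult ev_single cpow_0 mult.assoc)
    also have "\<dots> = K d * (pcol i * ev f * prow j)"
      by (simp only: ev_Vx K_commute[of d "pcol i", symmetric] mult.assoc)
    finally show ?thesis .
  qed
  show ?thesis
    unfolding to_alg_def sum_distrib_left using assms by (intro sum.cong HOL.refl) (simp add: *)
qed

lemma prow_to_alg:
  assumes i: "i < npaths"
  shows "prow i * to_alg P = (\<Sum>j\<in>{0..<npaths}. ev (P $$ (i, j)) * prow j)"
proof -
  have "prow i * to_alg P = (\<Sum>k\<in>{0..<npaths}. \<Sum>j\<in>{0..<npaths}. (prow i * pcol k) * ev (P $$ (k, j)) * prow j)"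
    by (simp add: to_alg_def sum_distrib_left mult.assoc)
  also have "\<dots> = (\<Sum>k\<in>{0..<npaths}. if k = i then \<Sum>j\<in>{0..<npaths}. ev (P $$ (i, j)) * prow j else 0)"
    using i by (intro sum.cong HOL.refl) (simp add: prow_pcol ev_Vx)
  also have "\<dots> = (\<Sum>j\<in>{0..<npaths}. ev (P $$ (i, j)) * prow j)"
    using i by simp
  finally show ?thesis .
qed

lemma entry_to_alg:
  assumes "i < npaths" "j < npaths"
  shows "prow i * to_alg P * pcol j = ev (P $$ (i, j))"
proof -
  have "prow i * to_alg P * pcol j = (\<Sum>k\<in>{0..<npaths}. ev (P $$ (i, k)) * (prow k * pcol j))"
    by (simp add: prow_to_alg[OF assms(1)] sum_distrib_right mult.assoc)
  also have "\<dots> = (\<Sum>k\<in>{0..<npaths}. if k = j then ev (P $$ (i, j)) else 0)"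
    using assms by (intro sum.cong HOL.refl) (simp add: prow_pcol ev_Vx)
  also have "\<dots> = ev (P $$ (i, j))"
    using assms by simp
  finally show ?thesis .
qed

lemma to_alg_mult:
  assumes "P \<in> carrier_mat npaths npaths" "Q \<in> carrier_mat npaths npaths"
  shows "to_alg (P * Q) = to_alg P * to_alg Q"
proof -
  have "to_alg P * to_alg Q = (\<Sum>i\<in>{0..<npaths}. \<Sum>j\<in>{0..<npaths}. pcol i * ev (P $$ (i, j)) * (prow j * to_alg Q))"
    by (simp add: to_alg_def[of P] sum_distrib_right mult.assoc)
  also have "\<dots> = (\<Sum>i\<in>{0..<npaths}. \<Sum>j\<in>{0..<npaths}. \<Sum>k\<in>{0..<npaths}. pcol i * ev (P $$ (i, j) * Q $$ (j, k)) * prow k)"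
    by (intro sum.cong HOL.refl) (simp add: prow_to_alg sum_distrib_left ev_mult mult.assoc)
  also have "\<dots> = (\<Sum>i\<in>{0..<npaths}. \<Sum>k\<in>{0..<npaths}. \<Sum>j\<in>{0..<npaths}. pcol i * ev (P $$ (i, j) * Q $$ (j, k)) * prow k)"
    by (intro sum.cong HOL.refl sum.swap)
  also have "\<dots> = to_alg (P * Q)"
    unfolding to_alg_def using assms
    by (intro sum.cong HOL.refl) (simp add: scalar_prod_def ev_sum sum_distrib_left sum_distrib_right)
  finally show ?thesis
    by (rule HOL.sym)
qed

definition elem_mat :: "nat \<Rightarrow> nat \<Rightarrow> (int \<Rightarrow>\<^sub>0 'k) \<Rightarrow> (int \<Rightarrow>\<^sub>0 'k) mat" where
  "elem_mat i j f = mat npaths npaths (\<lambda>(k, l). if k = i \<and> l = j then f else 0)"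

lemma to_alg_elem_mat:
  assumes "i < npaths" "j < npaths"
  shows "to_alg (elem_mat i j f) = pcol i * ev f * prow j"
proof -
  have "to_alg (elem_mat i j f) = (\<Sum>k\<in>{0..<npaths}. \<Sum>l\<in>{0..<npaths}. if l = j then (if k = i then pcol i * ev f * prow j else 0) else 0)"
    unfolding to_alg_def elem_mat_def by (intro sum.cong HOL.refl) (auto simp: ev_0)
  then show ?thesis
    using assms by simp
qed

lemma to_alg_in_L: "to_alg P \<in> L"
  unfolding to_alg_def by (intro L_sum L.mult pcol_in_L prow_in_L ev_in_L) auto

lemma to_alg_inj: "inj_on to_alg (carrier_mat npaths npaths)"
proof (rule inj_onI)
  fix P Q assume PQ: "P \<in> carrier_mat npaths npaths" "Q \<in> carrier_mat npaths npaths" "to_alg P = to_alg Q"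
  show "P = Q"
  proof (rule eq_matI)
    fix i j assume "i < dim_row Q" "j < dim_col Q"
    then have "ev (P $$ (i, j)) = ev (Q $$ (i, j))"
      using PQ entry_to_alg[of i j] by (metis carrier_matD)
    moreover have "ev (P $$ (i, j)) = ev (P $$ (i, j) - Q $$ (i, j)) + ev (Q $$ (i, j))"
      by (simp flip: ev_add)
    ultimately have "ev (P $$ (i, j) - Q $$ (i, j)) = 0"
      by simp
    from ev_inj[OF this] show "P $$ (i, j) = Q $$ (i, j)"
      by simp
  qed (use PQ in auto)
qed

abbreviation "Img \<equiv> to_alg ` carrier_mat npaths npaths"

lemma Img_add: "a \<in> Img \<Longrightarrow> b \<in> Img \<Longrightarrow> a + b \<in> Img"
proof -
  assume "a \<in> Img" "b \<in> Img"
  then obtain P Q where PQ: "P \<in> carrier_mat npaths npaths" "a = to_alg P" "Q \<in> carrier_mat npaths npaths" "b = to_alg Q"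
    by blast
  then have "a + b = to_alg (P + Q)"
    by (simp add: to_alg_add)
  then show ?thesis
    using PQ by simp
qed

lemma Img_elem: "i < npaths \<Longrightarrow> j < npaths \<Longrightarrow> pcol i * ev f * prow j \<in> Img"
  by (intro image_eqI[of _ _ "elem_mat i j f"]) (simp add: to_alg_elem_mat, simp add: elem_mat_def)

lemma Img_zero: "0 \<in> Img"
proof -
  have "to_alg (0\<^sub>m npaths npaths) = 0"
    unfolding to_alg_def by (intro sum.neutral ballI) (simp add: ev_0)
  then show ?thesis
    by (intro image_eqI[of _ _ "0\<^sub>m npaths npaths"]) auto
qed

lemma Img_sum: "(\<And>i. i \<in> X \<Longrightarrow> f i \<in> Img) \<Longrightarrow> sum f X \<in> Img"
  by (induction X rule: infinite_finite_induct) (auto intro: Img_add Img_zero simp del: image_iff)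

lemma Img_pcol_prow: "i < npaths \<Longrightarrow> j < npaths \<Longrightarrow> pcol i * prow j \<in> Img"
  using Img_elem[of i j 1] by (simp add: ev_1 pcol_Vx)

text \<open>Prefixing an edge gives again one of the numbered paths, except when the edge starts at
  \<open>x\<close>. Then the result is one full turn of \<open>c\<close>, that is the empty path at
  \<open>x\<close> times \<open>C\<close>. These are the only places where the entries of the
  matrices are not constants.\<close>

lemma prefix_edge:
  assumes e: "e \<in> arcs F" and i: "i < npaths" "fst (enum i) = head F e"
  obtains j where "j < npaths" "A e * pcol i = pcol j" "prow i * S e = prow j"
  | j where "j < npaths" "A e * pcol i = pcol j * C" "prow i * S e = D * prow j"
proof -
  define p where "p = snd (enum i)"
  have p: "p \<in> first_paths (head F e)"
    using enum_mem[OF i(1)] i(2) by (simp add: p_def)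
  have Ae: "A e * pcol i = path (tail F e) (e # p)" and Se: "prow i * S e = ghost (tail F e) (e # p)"
    using e i(2) by (simp_all add: pcol_def prow_def p_def path_Cons ghost_Cons)
  show ?thesis
  proof (cases "tail F e = x")
    case False
    then have "(tail F e, e # p) \<in> all_first"
      using p e by (auto simp: all_first_def first_paths_def awalk_Cons_iff)
    then obtain j where "j < npaths" "enum j = (tail F e, e # p)"
      by (rule enum_surj)
    then show ?thesis
      using that(1)[of j] Ae Se by (simp add: pcol_def prow_def)
  next
    case True
    obtain f q where f: "c = f # q"
      using c(2) by (cases c) auto
    have f': "f \<in> arcs F" "tail F f = x" "awalk (head F f) q x"
      using c(1) unfolding f awalk_Cons_iff by auto
    have ex: "out_arcs F x = {f}" "exit_free F q"
      using c(3) f'(2) unfolding f exit_free_Cons by auto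
    have "e \<in> out_arcs F x"
      using True e by simp
    then have ef: "e = f"
      using ex(1) by simp
    \<comment> \<open>The tail \<open>q\<close> of \<open>c\<close> and the path \<open>p\<close>
      both lead from \<open>head F e\<close> to a first visit of \<open>x\<close>, and along
      \<open>q\<close> there is no choice; hence they agree.\<close>
    have "q \<in> first_paths (head F e)"
      using f'(3) c_tl by (simp add: first_paths_def f ef)
    then have "p = q"
      using p ex(2) by (intro first_paths_unique)
    then have "e # p = c"
      by (simp add: ef f)
    moreover have "(x, []) \<in> all_first"
      using x_in_verts by (simp add: all_first_def first_paths_x)
    then obtain j where "j < npaths" "enum j = (x, [])"
      by (rule enum_surj)
    ultimately show ?thesis
      using that(2)[of j] Ae Se True C_D by (simp add: pcol_def prow_def C_def D_def)
  qed
qed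

lemma A_in_Img: "e \<in> arcs F \<Longrightarrow> A e \<in> Img" and S_in_Img: "e \<in> arcs F \<Longrightarrow> S e \<in> Img"
proof -
  assume e: "e \<in> arcs F"
  let ?I = "{i. i < npaths \<and> fst (enum i) = head F e}"
  have C: "C = ev (Poly_Mapping.single 1 1)" and D: "D = ev (Poly_Mapping.single (- 1) 1)"
    by (simp_all add: ev_single K_1 cpow_def C_D One_nat_def)
  have mem: "A e * pcol i * prow i \<in> Img \<and> pcol i * (prow i * S e) \<in> Img" if "i \<in> ?I" for i
  proof -
    have i: "i < npaths" "fst (enum i) = head F e"
      using that by auto
    show ?thesis
    proof (rule prefix_edge[OF e i])
      fix j assume "j < npaths" "A e * pcol i = pcol j" "prow i * S e = prow j"
      then show ?thesis
        using i(1) by (simp add: Img_pcol_prow)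
    next
      fix j assume j: "j < npaths" "A e * pcol i = pcol j * C" "prow i * S e = D * prow j"
      then have "A e * pcol i * prow i = pcol j * ev (Poly_Mapping.single 1 1) * prow i"
        "pcol i * (prow i * S e) = pcol i * ev (Poly_Mapping.single (- 1) 1) * prow j"
        by (simp_all add: C D mult.assoc)
      then show ?thesis
        using i(1) j(1) by (simp add: Img_elem)
    qed
  qed
  have h: "(\<Sum>i\<in>?I. pcol i * prow i) = V (head F e)"
    using sum_pcol_prow[of "head F e"] e by simp
  have "A e = A e * (\<Sum>i\<in>?I. pcol i * prow i)"
    using e by (simp add: h AV1)
  also have "\<dots> = (\<Sum>i\<in>?I. A e * pcol i * prow i)"
    by (simp add: sum_distrib_left mult.assoc)
  also have "\<dots> \<in> Img"
    using mem by (intro Img_sum) blast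
  finally show "A e \<in> Img" .
  have "S e = (\<Sum>i\<in>?I. pcol i * prow i) * S e"
    using e by (simp add: h VS1)
  also have "\<dots> = (\<Sum>i\<in>?I. pcol i * (prow i * S e))"
    by (simp add: sum_distrib_right mult.assoc)
  also have "\<dots> \<in> Img"
    using mem by (intro Img_sum) blast
  finally show "S e \<in> Img" .
qed

lemma L_subset_Img: "L \<subseteq> Img"
proof
  fix a assume "a \<in> L"
  then show "a \<in> Img"
  proof induction
    case (V v)
    have "(\<Sum>i\<in>{i. i < npaths \<and> fst (enum i) = v}. pcol i * prow i) \<in> Img"
      by (intro Img_sum Img_pcol_prow) auto
    then show ?case
      using sum_pcol_prow[of v] V by simp
  next
    case (mult a b)
    then obtain P Q where PQ: "P \<in> carrier_mat npaths npaths" "a = to_alg P" "Q \<in> carrier_mat npaths npaths" "b = to_alg Q"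
      by blast
    then have "a * b = to_alg (P * Q)"
      by (simp add: to_alg_mult)
    then show ?case
      using PQ by simp
  next
    case (scale a d)
    then obtain P where P: "P \<in> carrier_mat npaths npaths" "a = to_alg P"
      by blast
    then have "K d * a = to_alg (Poly_Mapping.single 0 d \<cdot>\<^sub>m P)"
      by (simp add: to_alg_smult)
    then show ?case
      using P by simp
  qed (simp_all add: A_in_Img S_in_Img Img_zero Img_add del: image_iff)
qed

lemma to_alg_one: "to_alg (1\<^sub>m npaths) = unit"
proof -
  have "to_alg (1\<^sub>m npaths) = (\<Sum>i\<in>{0..<npaths}. \<Sum>j\<in>{0..<npaths}. if j = i then pcol i * prow i else 0)"
    unfolding to_alg_def by (intro sum.cong HOL.refl) (auto simp: ev_0 ev_1 pcol_Vx)
  also have "\<dots> = (\<Sum>i\<in>{0..<npaths}. pcol i * prow i)"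
    by simp
  also have "\<dots> = (\<Sum>v\<in>verts F. \<Sum>i\<in>{i \<in> {0..<npaths}. fst (enum i) = v}. pcol i * prow i)"
    using enum_mem by (intro sum.group[symmetric]) auto
  also have "\<dots> = unit"
    unfolding unit_def using sum_pcol_prow by (intro sum.cong HOL.refl) (simp add: atLeastLessThan_iff)
  finally show ?thesis .
qed

theorem matrix_isomorphism:
  "\<exists>n\<ge>1. \<exists>g. bij_betw g (carrier_mat n n :: (int \<Rightarrow>\<^sub>0 'k) mat set) L \<and> g (1\<^sub>m n) = unit \<and>
     (\<forall>P\<in>carrier_mat n n. (\<forall>d. g (Poly_Mapping.single 0 d \<cdot>\<^sub>m P) = K d * g P) \<and>
        (\<forall>Q\<in>carrier_mat n n. g (P + Q) = g P + g Q \<and> g (P * Q) = g P * g Q))"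
proof (intro exI conjI ballI allI)
  have "(x, []) \<in> all_first"
    using x_in_verts by (simp add: all_first_def first_paths_x)
  then show "1 \<le> npaths"
    unfolding npaths_def using finite_all_first card_gt_0_iff[of all_first] by (auto simp: One_nat_def Suc_le_eq)
  show "bij_betw to_alg (carrier_mat npaths npaths) L"
    unfolding bij_betw_def using to_alg_inj L_subset_Img to_alg_in_L by blast
qed (simp_all add: to_alg_one to_alg_smult to_alg_add to_alg_mult)

end

section \<open>Transfer to the presented algebra\<close>

text \<open>\<open>A\<close> and \<open>S\<close> are parameters determined only for indices in
  range. The unweighted instance can thus take families constant in the index, as
  \<open>leavitt\<close> expects.\<close>

locale lpa_model = balanced_graph G N w
  for G :: "('v, 'e) pre_digraph" and N and w +
  fixes K :: "'k::field itself"
    and A S :: "'e \<Rightarrow> nat \<Rightarrow> (('v, 'e) lpa_gen fword \<Rightarrow>\<^sub>0 'k) ideal_quotients"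
  assumes no_sinks: "sinks G = {}"
    and A_eq: "e \<in> arcs G \<Longrightarrow> i \<in> {1..N (tail G e)} \<Longrightarrow> A e i = alg_elem (lpa_gens G w) (lpa_rels G w) (ed w e i)"
    and S_eq: "e \<in> arcs G \<Longrightarrow> i \<in> {1..N (tail G e)} \<Longrightarrow> S e i = alg_elem (lpa_gens G w) (lpa_rels G w) (gh w e i)"
begin

abbreviation "gens \<equiv> lpa_gens G w"
abbreviation rels :: "(('v, 'e) lpa_gen fword \<Rightarrow>\<^sub>0 'k) set" where "rels \<equiv> lpa_rels G w"
abbreviation "el \<equiv> alg_elem gens rels"
abbreviation "cl \<equiv> alg_coset (rel_ideal gens rels)"
abbreviation "Alg \<equiv> wlpa K G w"
abbreviation "emb \<equiv> alg_embed gens rels"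

lemma rels_subset: "rels \<subseteq> free_alg gens"
  by (rule lpa_rels_subset) (rule wf_digraph_axioms)

lemma elem_eqI: "p - q \<in> rels \<Longrightarrow> el p = el q"
proof -
  assume "p - q \<in> rels"
  then have "el (p - q) = el 0"
    using rels_subset free_alg_zero
    by (subst alg_elem_eq_iff) (auto simp: alg_coset_eq_iff intro: rel_ideal.base)
  then show ?thesis
    by (simp add: alg_elem_simps)
qed

lemma weighted_leavitt: "weighted_leavitt G alg_scalar N (\<lambda>v. el (vx v)) A S"
proof (intro weighted_leavitt.intro weighted_leavitt_axioms.intro fin_digraph_axioms scalar_hom_alg_scalar no_sinks)
  note simps = alg_elem_simps(4)[symmetric]
  show "N v > 0" if "v \<in> verts G" for v
  proof -
    have "out_arcs G v \<noteq> {}"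
      using that no_sinks unfolding sinks_def by blast
    then obtain e where "e \<in> out_arcs G v"
      by blast
    then show ?thesis
      using weight_pos[of e] by auto
  qed
  show "el (vx u) * el (vx v) = (if u = v then el (vx u) else 0)" if "u \<in> verts G" "v \<in> verts G" for u v
  proof -
    have "el (vx u * vx v) = el (if u = v then vx u else 0)"
      by (rule elem_eqI) (use that in \<open>auto simp: lpa_rels_def\<close>)
    then show ?thesis
      by (simp add: alg_elem_simps split: if_splits)
  qed
  fix e i assume e: "e \<in> arcs G" "i \<in> {1..N (tail G e)}"
  then have i: "1 \<le> i" "i \<le> w e"
    by (simp_all add: weight)
  show "el (vx (tail G e)) * A e i = A e i"
    unfolding A_eq[OF e] simps by (rule elem_eqI) (use e i in \<open>auto simp: lpa_rels_def\<close>)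
  show "A e i * el (vx (head G e)) = A e i"
    unfolding A_eq[OF e] simps by (rule elem_eqI) (use e i in \<open>auto simp: lpa_rels_def\<close>)
  show "el (vx (head G e)) * S e i = S e i"
    unfolding S_eq[OF e] simps by (rule elem_eqI) (use e i in \<open>auto simp: lpa_rels_def\<close>)
  show "S e i * el (vx (tail G e)) = S e i"
    unfolding S_eq[OF e] simps by (rule elem_eqI) (use e i in \<open>auto simp: lpa_rels_def\<close>)
next
  fix v i j assume v: "v \<in> verts G" "i \<in> {1..N v}" "j \<in> {1..N v}"
  have out: "out_arcs G v \<noteq> {}"
    using v(1) no_sinks unfolding sinks_def by blast
  have "(\<Sum>e\<in>out_arcs G v. A e i * S e j) = (\<Sum>e\<in>out_arcs G v. el (ed w e i * gh w e j))"
    using v by (intro sum.cong HOL.refl) (auto simp: A_eq S_eq alg_elem_simps)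
  also have "\<dots> = el (\<Sum>e\<in>out_arcs G v. ed w e i * gh w e j)"
    by (simp add: alg_elem_simps)
  also have "\<dots> = el (if i = j then vx v else 0)"
  proof (rule elem_eqI)
    have "v \<in> regular_verts G" "i \<in> {1..vertex_weight G w v}" "j \<in> {1..vertex_weight G w v}"
      using v out by (simp_all add: regular_verts vertex_weight)
    then show "(\<Sum>e\<in>out_arcs G v. ed w e i * gh w e j) - (if i = j then vx v else 0) \<in> rels"
      unfolding lpa_rels_def by blast
  qed
  finally show "(\<Sum>e\<in>out_arcs G v. A e i * S e j) = (if i = j then el (vx v) else 0)"
    by (simp add: alg_elem_simps split: if_splits)
next
  fix e f assume ef: "e \<in> arcs G" "f \<in> arcs G" "tail G e = tail G f"
  let ?v = "tail G e"
  have v: "?v \<in> regular_verts G" "e \<in> out_arcs G ?v" "f \<in> out_arcs G ?v"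
    using ef by (auto simp: regular_verts)
  have N: "vertex_weight G w ?v = N ?v"
    using v(2) by (intro vertex_weight) blast
  have "(\<Sum>i\<in>{1..N ?v}. S e i * A f i) = (\<Sum>i\<in>{1..N ?v}. el (gh w e i * ed w f i))"
    using ef by (intro sum.cong HOL.refl) (auto simp: A_eq S_eq alg_elem_simps)
  also have "\<dots> = el (\<Sum>i\<in>{1..N ?v}. gh w e i * ed w f i)"
    by (simp add: alg_elem_simps)
  also have "\<dots> = el (if e = f then vx (head G e) else 0)"
  proof (rule elem_eqI)
    show "(\<Sum>i\<in>{1..N ?v}. gh w e i * ed w f i) - (if e = f then vx (head G e) else 0) \<in> rels"
      using v unfolding lpa_rels_def N[symmetric] by blast
  qed
  finally show "(\<Sum>i\<in>{1..N ?v}. S e i * A f i) = (if e = f then el (vx (head G e)) else 0)"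
    by (simp add: alg_elem_simps split: if_splits)
qed

end

sublocale lpa_model \<subseteq> weighted_leavitt G alg_scalar N "\<lambda>v. el (vx v)" A S
  by (rule weighted_leavitt)

context lpa_model
begin

lemma elem_gen_in_L: "g \<in> gens \<Longrightarrow> el (Poly_Mapping.single (FWord [g]) 1) \<in> L"
proof -
  assume "g \<in> gens"
  then consider (V) v where "g = Vtx v" "v \<in> verts G"
    | (E) e i where "g = Edg e i" "e \<in> arcs G" "1 \<le> i" "i \<le> w e"
    | (S) e i where "g = Gst e i" "e \<in> arcs G" "1 \<le> i" "i \<le> w e"
    unfolding lpa_gens_def by blast
  then show ?thesis
  proof cases
    case V
    then show ?thesis using L.V[of v] by (simp add: vx_def)
  next
    case E
    then have i: "i \<in> {1..N (tail G e)}"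
      by (simp add: weight)
    show ?thesis using L.A[OF E(2) i] A_eq[OF E(2) i] E by (simp add: ed_def)
  next
    case S
    then have i: "i \<in> {1..N (tail G e)}"
      by (simp add: weight)
    show ?thesis using L.S[OF S(2) i] S_eq[OF S(2) i] S by (simp add: gh_def)
  qed
qed

lemma L_eq: "L = el ` free_alg gens"
proof (intro equalityI subsetI)
  fix a assume "a \<in> L"
  then show "a \<in> el ` free_alg gens"
  proof induction
    case (V v)
    show ?case by (rule imageI[OF vx_mem[OF V]])
  next
    case (A e i)
    then show ?case unfolding A_eq[OF A] by (intro imageI ed_mem) simp_all
  next
    case (S e i)
    then show ?case unfolding S_eq[OF S] by (intro imageI gh_mem) simp_all
  next
    case zero
    show ?case unfolding alg_elem_simps(1)[of gens rels, symmetric] by (rule imageI[OF free_alg_zero])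
  next
    case (add a b)
    then show ?case by (auto simp flip: alg_elem_simps(2) intro!: imageI free_alg_add)
  next
    case (mult a b)
    then show ?case by (auto simp flip: alg_elem_simps(4) intro!: imageI free_alg_mult)
  next
    case (scale a c)
    then show ?case by (auto simp flip: alg_elem_simps(5) intro!: imageI free_alg_scale)
  qed
next
  fix a assume "a \<in> el ` free_alg gens"
  then obtain p where p: "p \<in> free_alg gens" "a = el p"
    by blast
  have word: "el (Poly_Mapping.single (FWord (g # gs)) 1) \<in> L" if "g \<in> gens" "set gs \<subseteq> gens" for g gs
    using that
  proof (induction gs arbitrary: g)
    case Nil
    then show ?case by (simp add: elem_gen_in_L)
  next
    case (Cons h gs)
    have "(Poly_Mapping.single (FWord (g # h # gs)) 1 :: ('v, 'e) lpa_gen fword \<Rightarrow>\<^sub>0 'k) =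
        Poly_Mapping.single (FWord [g]) 1 * Poly_Mapping.single (FWord (h # gs)) 1"
      by (simp add: mult_single plus_fword_def)
    then have "el (Poly_Mapping.single (FWord (g # h # gs)) 1) =
        el (Poly_Mapping.single (FWord [g]) 1) * el (Poly_Mapping.single (FWord (h # gs)) 1)"
      by (simp only: alg_elem_simps(4))
    moreover have "el (Poly_Mapping.single (FWord (h # gs)) 1) \<in> L"
      using Cons.IH[of h] Cons.prems by simp
    ultimately show ?case
      using L.mult[OF elem_gen_in_L[OF Cons.prems(1)]] by simp
  qed
  have "el (Poly_Mapping.single u c) \<in> L" if u0: "u \<noteq> 0" "set (letters u) \<subseteq> gens" for u c
  proof -
    obtain g gs where u: "u = FWord (g # gs)" and g: "g \<in> gens" "set gs \<subseteq> gens"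
      using u0 by (cases u; cases "letters u") (auto simp: zero_fword_def)
    have "Poly_Mapping.single u c = Poly_Mapping.single 0 c * Poly_Mapping.single u 1"
      by (simp add: mult_single)
    then show ?thesis
      using L.scale[OF word[OF g], of c] by (simp only: alg_elem_simps(5) u)
  qed
  then have "(\<Sum>u\<in>Poly_Mapping.keys p. el (Poly_Mapping.single u (Poly_Mapping.lookup p u))) \<in> L"
    using p(1) unfolding free_alg_def by (intro L_sum) blast
  also have "(\<Sum>u\<in>Poly_Mapping.keys p. el (Poly_Mapping.single u (Poly_Mapping.lookup p u))) =
      el (\<Sum>u\<in>Poly_Mapping.keys p. Poly_Mapping.single u (Poly_Mapping.lookup p u))"
    by (rule alg_elem_simps(6)[symmetric])
  also have "\<dots> = a"
    unfolding p(2) by (rule arg_cong[OF poly_mapping_eq_sum_single[symmetric]])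
  finally show "a \<in> L" .
qed

lemma Alg_simps:
  "carrier Alg = cl ` free_alg gens" "\<one>\<^bsub>Alg\<^esub> = cl (\<Sum>v\<in>verts G. vx v)" "\<zero>\<^bsub>Alg\<^esub> = cl 0"
  "p \<in> free_alg gens \<Longrightarrow> q \<in> free_alg gens \<Longrightarrow> cl p \<otimes>\<^bsub>Alg\<^esub> cl q = cl (p * q)"
  "cl p \<oplus>\<^bsub>Alg\<^esub> cl q = cl (p + q)"
  "c \<odot>\<^bsub>Alg\<^esub> cl p = cl (Poly_Mapping.single 0 c * p)"
  unfolding wlpa_def by (simp_all add: presented_alg_simps[OF rels_subset])

lemma emb_cl: "p \<in> free_alg gens \<Longrightarrow> emb (cl p) = el p"
  by (rule alg_embed_coset[OF rels_subset])

lemma bij_emb: "bij_betw emb (carrier Alg) L"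
  unfolding bij_betw_def
proof
  show "inj_on emb (carrier Alg)"
    by (rule inj_onI) (auto simp: Alg_simps emb_cl alg_elem_eq_iff)
  show "emb ` carrier Alg = L"
    unfolding L_eq Alg_simps image_image by (intro image_cong HOL.refl emb_cl)
qed

lemma emb_in_L: "a \<in> carrier Alg \<Longrightarrow> emb a \<in> L"
  using bij_betwE[OF bij_emb] by blast

lemma emb_eq_iff: "a \<in> carrier Alg \<Longrightarrow> b \<in> carrier Alg \<Longrightarrow> emb a = emb b \<longleftrightarrow> a = b"
  using bij_betw_imp_inj_on[OF bij_emb] by (simp add: inj_on_eq_iff)

lemma emb_surj:
  assumes "b \<in> L"
  obtains a where "a \<in> carrier Alg" "emb a = b"
proof -
  have "b \<in> emb ` carrier Alg"
    using assms bij_betw_imp_surj_on[OF bij_emb] by simp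
  then show ?thesis
    using that by blast
qed

lemma emb_simps:
  "a \<in> carrier Alg \<Longrightarrow> b \<in> carrier Alg \<Longrightarrow> emb (a \<otimes>\<^bsub>Alg\<^esub> b) = emb a * emb b"
  "a \<in> carrier Alg \<Longrightarrow> b \<in> carrier Alg \<Longrightarrow> emb (a \<oplus>\<^bsub>Alg\<^esub> b) = emb a + emb b"
  "a \<in> carrier Alg \<Longrightarrow> emb (c \<odot>\<^bsub>Alg\<^esub> a) = alg_scalar c * emb a"
  "emb \<zero>\<^bsub>Alg\<^esub> = 0"
  "emb \<one>\<^bsub>Alg\<^esub> = unit"
proof -
  show "a \<in> carrier Alg \<Longrightarrow> b \<in> carrier Alg \<Longrightarrow> emb (a \<otimes>\<^bsub>Alg\<^esub> b) = emb a * emb b"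
    by (auto simp: Alg_simps emb_cl free_alg_mult alg_elem_simps)
  show "a \<in> carrier Alg \<Longrightarrow> b \<in> carrier Alg \<Longrightarrow> emb (a \<oplus>\<^bsub>Alg\<^esub> b) = emb a + emb b"
    by (auto simp: Alg_simps emb_cl free_alg_add alg_elem_simps)
  show "a \<in> carrier Alg \<Longrightarrow> emb (c \<odot>\<^bsub>Alg\<^esub> a) = alg_scalar c * emb a"
    by (auto simp: Alg_simps emb_cl free_alg_scale alg_elem_simps(5))
  show "emb \<zero>\<^bsub>Alg\<^esub> = 0"
    by (simp add: Alg_simps emb_cl free_alg_zero alg_elem_simps)
  show "emb \<one>\<^bsub>Alg\<^esub> = unit"
    by (simp add: Alg_simps emb_cl free_alg_sum vx_mem alg_elem_simps unit_def)
qed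

lemma wlpa_vertex: "v \<in> verts G \<Longrightarrow> wlpa_vertex K G w v \<in> carrier Alg"
  "v \<in> verts G \<Longrightarrow> emb (wlpa_vertex K G w v) = el (vx v)"
  by (simp_all add: wlpa_vertex_def Alg_simps vx_mem emb_cl)

lemma ring_Alg: "ring Alg"
  by (rule ring_wlpa) (rule fin_digraph_axioms)

lemma L_ideal_image:
  assumes "ideal J Alg"
  shows "L_ideal (emb ` J)"
proof -
  interpret J: ideal J Alg
    by fact
  have J: "a \<in> carrier Alg" if "a \<in> J" for a
    using that J.a_subset by blast
  show ?thesis
    unfolding L_ideal_def
  proof (intro conjI ballI)
    show "0 \<in> emb ` J"
      using emb_simps(4) J.zero_closed by (intro image_eqI[of _ _ "\<zero>\<^bsub>Alg\<^esub>"]) simp_all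
  next
    fix a b assume "a \<in> emb ` J" "b \<in> emb ` J"
    then obtain a' b' where ab: "a' \<in> J" "b' \<in> J" "a = emb a'" "b = emb b'"
      by blast
    then have "a + b = emb (a' \<oplus>\<^bsub>Alg\<^esub> b')"
      using J by (simp add: emb_simps)
    then show "a + b \<in> emb ` J"
      using ab J.a_closed by blast
  next
    fix a y assume "a \<in> emb ` J" "y \<in> L"
    then obtain a' where a: "a' \<in> J" "a = emb a'"
      by blast
    obtain y' where y: "y' \<in> carrier Alg" "emb y' = y"
      using \<open>y \<in> L\<close> by (rule emb_surj)
    have "a * y = emb (a' \<otimes>\<^bsub>Alg\<^esub> y')" "y * a = emb (y' \<otimes>\<^bsub>Alg\<^esub> a')"
      using a y J by (simp_all add: emb_simps)
    then show "a * y \<in> emb ` J" "y * a \<in> emb ` J"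
      using a(1) y(1) J.I_r_closed J.I_l_closed by blast+
  qed
qed

lemma ideal_eq_carrier:
  assumes "ideal J Alg" "L \<subseteq> emb ` J"
  shows "J = carrier Alg"
proof -
  interpret J: ideal J Alg
    by fact
  have "a \<in> J" if a: "a \<in> carrier Alg" for a
  proof -
    obtain b where "b \<in> J" "emb a = emb b"
      using assms(2) emb_in_L[OF a] by blast
    then show ?thesis
      using emb_eq_iff[OF a, of b] J.a_subset by blast
  qed
  then show ?thesis
    using J.a_subset by blast
qed

lemma vertex_simple_iff: "vertex_simple K G w \<longleftrightarrow> hered_sat_trivial G"
proof
  interpret A: ring Alg
    by (rule ring_Alg)
  assume simple: "vertex_simple K G w"
  then have eq: "Idl\<^bsub>Alg\<^esub> (wlpa_vertex K G w ` V) = carrier Alg" if "V \<subseteq> verts G" "V \<noteq> {}" for V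
    using that unfolding vertex_simple_def vertex_ideals_def by blast
  \<comment> \<open>For the empty graph there is no nonempty set of vertices, so the family of
    vertex ideals is empty and not a singleton.\<close>
  have "verts G \<noteq> {}"
    using simple unfolding vertex_simple_def vertex_ideals_def by force
  moreover have "H = verts G" if H: "hered_sat G H" "H \<noteq> {}" for H
  proof -
    obtain J where J: "ideal J Alg" "\<forall>v\<in>verts G. wlpa_vertex K G w v \<in> J \<longleftrightarrow> v \<in> H"
      using hered_sat_ideal[OF H(1)] by blast
    have HG: "H \<subseteq> verts G"
      using H(1) by (rule hered_satD)
    then have "Idl\<^bsub>Alg\<^esub> (wlpa_vertex K G w ` H) \<subseteq> J"
      using J by (intro A.genideal_minimal) auto
    then have "carrier Alg \<subseteq> J"
      using eq[OF HG H(2)] by simp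
    then show ?thesis
      using J(2) wlpa_vertex(1) HG by blast
  qed
  ultimately show "hered_sat_trivial G"
    unfolding hered_sat_trivial_def by blast
next
  interpret A: ring Alg
    by (rule ring_Alg)
  assume trivial: "hered_sat_trivial G"
  have eq: "Idl\<^bsub>Alg\<^esub> (wlpa_vertex K G w ` V) = carrier Alg" if V: "V \<subseteq> verts G" "V \<noteq> {}" for V
  proof -
    let ?J = "Idl\<^bsub>Alg\<^esub> (wlpa_vertex K G w ` V)"
    have sub: "wlpa_vertex K G w ` V \<subseteq> carrier Alg"
      using V(1) wlpa_vertex(1) by blast
    have J: "ideal ?J Alg"
      by (rule A.genideal_ideal[OF sub])
    obtain v where v: "v \<in> V" "v \<in> verts G"
      using V by blast
    then have "wlpa_vertex K G w v \<in> ?J"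
      using A.genideal_self[OF sub] by blast
    then have "el (vx v) \<in> emb ` ?J"
      unfolding wlpa_vertex(2)[OF v(2), symmetric] by (rule imageI)
    then have "L \<subseteq> emb ` ?J"
      by (rule L_ideal_vertex[OF trivial L_ideal_image[OF J] v(2)])
    then show ?thesis
      by (rule ideal_eq_carrier[OF J])
  qed
  have "verts G \<noteq> {}"
    using trivial by (simp add: hered_sat_trivial_def)
  then have "carrier Alg \<in> vertex_ideals K G w"
    using eq[of "verts G"] unfolding vertex_ideals_def by blast
  then show "vertex_simple K G w"
    using eq unfolding vertex_simple_def vertex_ideals_def by blast
qed

text \<open>The ideal belonging to the empty hereditary saturated set contains zero but no
  vertex.\<close>

lemma vertex_nonzero: "v \<in> verts G \<Longrightarrow> el (vx v) \<noteq> 0"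
proof
  assume v: "v \<in> verts G" "el (vx v) = 0"
  obtain J where J: "ideal J Alg" "\<forall>v\<in>verts G. wlpa_vertex K G w v \<in> J \<longleftrightarrow> v \<in> {}"
    using hered_sat_ideal[OF hered_sat_empty] by blast
  interpret J: ideal J Alg
    by (rule J)
  have "wlpa_vertex K G w v = \<zero>\<^bsub>Alg\<^esub>"
    using v wlpa_vertex emb_simps(4) emb_eq_iff[of "wlpa_vertex K G w v" "\<zero>\<^bsub>Alg\<^esub>"] by simp
  moreover have "wlpa_vertex K G w v \<notin> J"
    using J(2) v(1) by simp
  ultimately show False
    using J.zero_closed by simp
qed

end

section \<open>The dichotomy for Leavitt path algebras\<close>

locale sinkless_lpa = fin_digraph G for G :: "('v, 'e) pre_digraph" +
  fixes Kt :: "'k::field itself"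
  assumes no_sinks: "sinks G = {}"

sublocale sinkless_lpa \<subseteq> lpa_model G "\<lambda>_. 1" "\<lambda>_. 1" Kt
  "\<lambda>e _. alg_elem (lpa_gens G (\<lambda>_. 1)) (lpa_rels G (\<lambda>_. 1)) (ed (\<lambda>_. 1) e 1)"
  "\<lambda>e _. alg_elem (lpa_gens G (\<lambda>_. 1)) (lpa_rels G (\<lambda>_. 1)) (gh (\<lambda>_. 1) e 1)"
  by (intro lpa_model.intro balanced_graph.intro balanced_graph_axioms.intro lpa_model_axioms.intro
      fin_digraph_axioms no_sinks) auto

context sinkless_lpa
begin

abbreviation "vert \<equiv> \<lambda>v. el (vx v)"
abbreviation "edge \<equiv> \<lambda>e. el (ed (\<lambda>_. 1) e 1)"
abbreviation "star \<equiv> \<lambda>e. el (gh (\<lambda>_. 1) e 1)"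

lemma leavitt: "leavitt G alg_scalar vert edge star"
  by (intro leavitt.intro weighted_leavitt)

lemma el_word: "el (Poly_Mapping.single (FWord (g # gs)) 1) =
    el (Poly_Mapping.single (FWord [g]) 1) * prod_list (map (\<lambda>g. el (Poly_Mapping.single (FWord [g]) 1)) gs)"
proof (induction gs arbitrary: g)
  case (Cons h gs)
  have "(Poly_Mapping.single (FWord (g # h # gs)) 1 :: ('v, 'e) lpa_gen fword \<Rightarrow>\<^sub>0 'k) =
      Poly_Mapping.single (FWord [g]) 1 * Poly_Mapping.single (FWord (h # gs)) 1"
    by (simp add: mult_single plus_fword_def)
  then have "el (Poly_Mapping.single (FWord (g # h # gs)) 1) =
      el (Poly_Mapping.single (FWord [g]) 1) * el (Poly_Mapping.single (FWord (h # gs)) 1)"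
    by (simp only: alg_elem_simps(4))
  then show ?case
    by (simp only: Cons list.map prod_list.Cons)
qed simp

lemma el_cycle_word: "el (Poly_Mapping.single (cycle_word x c k) 1) = vert x * prod_list (map edge c) ^ k"
proof -
  have e: "el (Poly_Mapping.single (FWord [Edg e 1]) 1) = edge e" for e
    by (simp add: ed_def)
  have "prod_list (map f (concat (replicate k xs))) = prod_list (map f xs) ^ k"
    for f :: "('v, 'e) lpa_gen \<Rightarrow> (('v, 'e) lpa_gen fword \<Rightarrow>\<^sub>0 'k) ideal_quotients" and xs
    by (induction k) auto
  then show ?thesis
    unfolding cycle_word_def by (subst el_word) (simp add: vx_def e comp_def del: One_nat_def)
qed

end

sublocale sinkless_lpa \<subseteq> faithful_leavitt G alg_scalar vert edge star
proof (intro faithful_leavitt.intro faithful_leavitt_axioms.intro leavitt)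
  interpret leavitt G alg_scalar vert edge star
    by (rule leavitt)
  show "vert v \<noteq> 0" if "v \<in> verts G" for v
    using that by (rule vertex_nonzero)
  fix x c T and d :: "nat \<Rightarrow> 'k" and k
  assume c: "awalk x c x" "c \<noteq> []" "exit_free G c" and T: "finite T" "k \<in> T"
    and sum: "(\<Sum>k\<in>T. alg_scalar (d k) * (vert x * path x c ^ k)) = 0"
  have "path x c = prod_list (map edge c)"
  proof (cases c)
    case (Cons e q)
    then have "e \<in> arcs G" "x = tail G e"
      using c(1) by (simp_all add: awalk_Cons_iff)
    then show ?thesis
      using VA1[of e] by (simp add: path_def Cons flip: mult.assoc)
  qed (use c in simp)
  then have summand: "alg_scalar (d k) * (vert x * path x c ^ k) = el (Poly_Mapping.single (cycle_word x c k) (d k))" for k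
  proof -
    have "Poly_Mapping.single (cycle_word x c k) (d k) =
        Poly_Mapping.single 0 (d k) * Poly_Mapping.single (cycle_word x c k) 1"
      by (simp add: mult_single)
    then show ?thesis
      by (simp only: alg_elem_simps(5) el_cycle_word \<open>path x c = prod_list (map edge c)\<close>)
  qed
  have "el (\<Sum>k\<in>T. Poly_Mapping.single (cycle_word x c k) (d k)) = el 0"
    using sum unfolding summand by (simp add: alg_elem_simps(1,6))
  moreover have "(\<Sum>k\<in>T. Poly_Mapping.single (cycle_word x c k) (d k)) \<in> free_alg gens"
  proof (rule free_alg_sum)
    fix k
    have "set c \<subseteq> arcs G"
      using c(1) by (simp add: awalk_def)
    then show "Poly_Mapping.single (cycle_word x c k) (d k) \<in> free_alg gens"
      using awalk_hd_in_verts[OF c(1)] unfolding cycle_word_def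
      by (intro free_alg_word) (auto simp: lpa_gens_def)
  qed
  ultimately have "(\<Sum>k\<in>T. Poly_Mapping.single (cycle_word x c k) (d k)) \<in> rel_ideal gens rels"
    using alg_elem_eq_iff[OF _ free_alg_zero, of _ gens rels] by (simp add: alg_coset_eq_iff)
  then show "d k = 0"
    by (rule cycle_words_independent[OF fin_digraph_axioms c T(1) _ T(2)])
qed

context sinkless_lpa
begin

lemma Alg_nonzero:
  assumes "hered_sat_trivial G"
  shows "carrier Alg \<noteq> {\<zero>\<^bsub>Alg\<^esub>}"
proof
  assume *: "carrier Alg = {\<zero>\<^bsub>Alg\<^esub>}"
  obtain v where v: "v \<in> verts G"
    using assms by (auto simp: hered_sat_trivial_def)
  then have "wlpa_vertex Kt G (\<lambda>_. 1) v = \<zero>\<^bsub>Alg\<^esub>"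
    using wlpa_vertex(1)[OF v] unfolding * by blast
  then show False
    using wlpa_vertex(2)[OF v] vertex_nonzero[OF v] emb_simps(4) by simp
qed

lemma emb_nonzero: "a \<in> carrier Alg \<Longrightarrow> a \<noteq> \<zero>\<^bsub>Alg\<^esub> \<Longrightarrow> emb a \<noteq> 0"
  using emb_eq_iff[of a "\<zero>\<^bsub>Alg\<^esub>"] emb_simps(4) ring.ring_simprules(2)[OF ring_Alg] by simp

lemma purely_infinite_if_exits:
  assumes trivial: "hered_sat_trivial G"
    and exits: "\<forall>x c. awalk x c x \<longrightarrow> c \<noteq> [] \<longrightarrow> \<not> exit_free G c"
  shows "purely_infinite_simple Alg"
  unfolding purely_infinite_simple_def simple_ring_def
proof (intro conjI allI impI)
  interpret A: ring Alg
    by (rule ring_Alg)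
  show "carrier Alg \<noteq> {\<zero>\<^bsub>Alg\<^esub>}"
    using trivial by (rule Alg_nonzero)
  show "J = {\<zero>\<^bsub>Alg\<^esub>} \<or> J = carrier Alg" if J: "ideal J Alg" for J
  proof (rule disjCI)
    interpret J: ideal J Alg
      by (rule J)
    assume "J \<noteq> carrier Alg"
    have "a = \<zero>\<^bsub>Alg\<^esub>" if a: "a \<in> J" for a
    proof (rule ccontr)
      assume "a \<noteq> \<zero>\<^bsub>Alg\<^esub>"
      moreover have aC: "a \<in> carrier Alg"
        using a J.a_subset by blast
      ultimately have "L \<subseteq> emb ` J"
        using simple_if_exits[OF trivial exits L_ideal_image[OF J] imageI[OF a] emb_in_L[OF aC] emb_nonzero[OF aC]]
        by blast
      then show False
        using ideal_eq_carrier[OF J] \<open>J \<noteq> carrier Alg\<close> by blast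
    qed
    then show "J = {\<zero>\<^bsub>Alg\<^esub>}"
      using J.zero_closed by blast
  qed
  fix J assume J: "right_ideal J Alg \<and> J \<noteq> {\<zero>\<^bsub>Alg\<^esub>}"
  then interpret J: additive_subgroup J Alg
    by (simp add: right_ideal_def)
  obtain a where a: "a \<in> J" "a \<noteq> \<zero>\<^bsub>Alg\<^esub>"
    using J J.zero_closed by blast
  have aC: "a \<in> carrier Alg"
    using a(1) J.a_subset by blast
  obtain x y c d w where L: "x \<in> L" "y \<in> L" "c \<in> L" "d \<in> L" "w \<in> L"
    and r: "x * emb a * y = w" "w * w = w" "d * c = w" "c * w = c" "w * c = c" "d * w = d" "w * d = d" "c * d \<noteq> w"
    using proper_isometry[OF exits emb_in_L[OF aC] emb_nonzero[OF aC a(2)]] by blast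
  obtain x' where x': "x' \<in> carrier Alg" "emb x' = x"
    by (rule emb_surj[OF L(1)])
  obtain y' where y': "y' \<in> carrier Alg" "emb y' = y"
    by (rule emb_surj[OF L(2)])
  obtain c' where c': "c' \<in> carrier Alg" "emb c' = c"
    by (rule emb_surj[OF L(3)])
  obtain d' where d': "d' \<in> carrier Alg" "emb d' = d"
    by (rule emb_surj[OF L(4)])
  obtain w' where w': "w' \<in> carrier Alg" "emb w' = w"
    by (rule emb_surj[OF L(5)])
  note C = x'(1) y'(1) c'(1) d'(1) w'(1) and eq = x'(2) y'(2) c'(2) d'(2) w'(2)
  have mult: "u \<otimes>\<^bsub>Alg\<^esub> v = t \<longleftrightarrow> emb u * emb v = emb t"
    if "u \<in> carrier Alg" "v \<in> carrier Alg" "t \<in> carrier Alg" for u v t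
    using that emb_eq_iff[of "u \<otimes>\<^bsub>Alg\<^esub> v" t] by (simp add: emb_simps)
  show "\<exists>e\<in>J. infinite_idempotent Alg e"
  proof (rule A.right_ideal_infinite_idempotent[OF _ a(1) C])
    show "right_ideal J Alg"
      using J by blast
    show "x' \<otimes>\<^bsub>Alg\<^esub> a \<otimes>\<^bsub>Alg\<^esub> y' = w'"
      using C aC r(1) by (simp add: mult eq emb_simps)
    show "w' \<otimes>\<^bsub>Alg\<^esub> w' = w'" "d' \<otimes>\<^bsub>Alg\<^esub> c' = w'" "c' \<otimes>\<^bsub>Alg\<^esub> w' = c'" "w' \<otimes>\<^bsub>Alg\<^esub> c' = c'"
      "d' \<otimes>\<^bsub>Alg\<^esub> w' = d'" "w' \<otimes>\<^bsub>Alg\<^esub> d' = d'" "c' \<otimes>\<^bsub>Alg\<^esub> d' \<noteq> w'"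
      using C r by (simp_all add: mult eq)
  qed
qed

lemma matrix_algebra_if_exit_free:
  assumes trivial: "hered_sat_trivial G"
    and "\<not> (\<forall>x c. awalk x c x \<longrightarrow> c \<noteq> [] \<longrightarrow> \<not> exit_free G c)"
  shows "\<exists>n\<ge>1. alg_isomorphic Alg (laurent_matrix_alg n)"
proof -
  let ?P = "\<lambda>(x, c). awalk x c x \<and> c \<noteq> [] \<and> exit_free G c"
  \<comment> \<open>A shortest exit-free closed walk: if it passed its base point in between, the
    piece up to that visit would be a shorter one.\<close>
  obtain t where t: "?P t" "\<And>t'. ?P t' \<Longrightarrow> length (snd t) \<le> length (snd t')"
    using assms(2) ex_has_least_nat[of ?P _ "\<lambda>t. length (snd t)"] by blast
  obtain x c where xc: "t = (x, c)"
    by (cases t)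
  have c: "awalk x c x" "c \<noteq> []" "exit_free G c"
    using t(1) by (auto simp: xc)
  have "x \<notin> tail G ` set (tl c)"
  proof
    assume "x \<in> tail G ` set (tl c)"
    then obtain f where f: "f \<in> set (tl c)" "tail G f = x"
      by auto
    obtain q1 q2 where q: "tl c = q1 @ f # q2"
      using f(1) by (meson split_list)
    obtain e where e: "c = (e # q1) @ f # q2"
      using c(2) q by (cases c) auto
    have w: "awalk x (e # q1) (awlast x (e # q1))" "awalk (awlast x (e # q1)) (f # q2) x"
      using c(1) unfolding e awalk_append_iff by blast+
    then have "awlast x (e # q1) = x"
      using f(2) unfolding awalk_Cons_iff[of _ f] by blast
    then have "?P (x, e # q1)"
      using w(1) c(3) by (simp add: e exit_free_def)
    then show False
      using t(2)[of "(x, e # q1)"] by (simp add: xc e)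
  qed
  then interpret M: exit_free_leavitt G alg_scalar vert edge star x c
    using c trivial by (intro exit_free_leavitt.intro exit_free_leavitt_axioms.intro faithful_leavitt_axioms)
  obtain n and g :: "(int \<Rightarrow>\<^sub>0 'k) mat \<Rightarrow> _" where n: "n \<ge> 1" and bij: "bij_betw g (carrier_mat n n) L"
    and g: "g (1\<^sub>m n) = unit"
      "\<And>P d. P \<in> carrier_mat n n \<Longrightarrow> g (Poly_Mapping.single 0 d \<cdot>\<^sub>m P) = alg_scalar d * g P"
      "\<And>P Q. P \<in> carrier_mat n n \<Longrightarrow> Q \<in> carrier_mat n n \<Longrightarrow> g (P + Q) = g P + g Q"
      "\<And>P Q. P \<in> carrier_mat n n \<Longrightarrow> Q \<in> carrier_mat n n \<Longrightarrow> g (P * Q) = g P * g Q"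
    using M.matrix_isomorphism by blast
  define h where "h a = inv_into (carrier_mat n n) g (emb a)" for a
  have hC: "h a \<in> carrier_mat n n" and gh: "g (h a) = emb a" if "a \<in> carrier Alg" for a
    using bij_betw_inv_into_right[OF bij emb_in_L[OF that]] bij_betwE[OF bij_betw_inv_into[OF bij]] emb_in_L[OF that]
    by (auto simp: h_def)
  have hI: "h a = P" if "a \<in> carrier Alg" "P \<in> carrier_mat n n" "emb a = g P" for a P
    using bij_betw_inv_into_left[OF bij that(2)] that(3) by (simp add: h_def)
  interpret A: ring Alg
    by (rule ring_Alg)
  have bij_h: "bij_betw h (carrier Alg) (carrier_mat n n)"
    using bij_betw_trans[OF bij_emb bij_betw_inv_into[OF bij]] by (simp add: h_def[abs_def] comp_def)
  have "h \<in> ring_iso Alg (laurent_matrix_alg n)"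
  proof (rule ring_iso_memI)
    fix a b assume a: "a \<in> carrier Alg"
    show "h a \<in> carrier (laurent_matrix_alg n)"
      using hC[OF a] by (simp add: laurent_matrix_alg_def)
    assume b: "b \<in> carrier Alg"
    show "h (a \<otimes>\<^bsub>Alg\<^esub> b) = h a \<otimes>\<^bsub>laurent_matrix_alg n\<^esub> h b"
      using a b hC gh mult_carrier_mat[OF hC[OF a] hC[OF b]] by (simp add: laurent_matrix_alg_def) (intro hI, simp_all add: emb_simps g)
    show "h (a \<oplus>\<^bsub>Alg\<^esub> b) = h a \<oplus>\<^bsub>laurent_matrix_alg n\<^esub> h b"
      using a b hC gh by (simp add: laurent_matrix_alg_def) (intro hI, simp_all add: emb_simps g)
  next
    show "h \<one>\<^bsub>Alg\<^esub> = \<one>\<^bsub>laurent_matrix_alg n\<^esub>"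
      by (simp add: laurent_matrix_alg_def) (intro hI, simp_all add: emb_simps g)
    show "bij_betw h (carrier Alg) (carrier (laurent_matrix_alg n))"
      using bij_h by (simp add: laurent_matrix_alg_def)
  qed
  moreover have "h (d \<odot>\<^bsub>Alg\<^esub> a) = d \<odot>\<^bsub>laurent_matrix_alg n\<^esub> h a" if a: "a \<in> carrier Alg" for d a
  proof -
    have "d \<odot>\<^bsub>Alg\<^esub> a \<in> carrier Alg"
      using a by (auto simp: Alg_simps free_alg_scale)
    then show ?thesis
      using a hC gh by (simp add: laurent_matrix_alg_def) (intro hI, simp_all add: emb_simps g)
  qed
  ultimately show ?thesis
    unfolding alg_isomorphic_def using n by blast
qed

lemma hered_sat_trivialI:
  assumes ideals: "\<And>J v. ideal J Alg \<Longrightarrow> v \<in> verts G \<Longrightarrow> wlpa_vertex Kt G (\<lambda>_. 1) v \<in> J \<Longrightarrow> J = carrier Alg"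
    and nonzero: "carrier Alg \<noteq> {\<zero>\<^bsub>Alg\<^esub>}"
  shows "hered_sat_trivial G"
  unfolding hered_sat_trivial_def
proof (intro conjI allI impI)
  interpret A: ring Alg
    by (rule ring_Alg)
  show "verts G \<noteq> {}"
  proof
    assume "verts G = {}"
    then have "\<one>\<^bsub>Alg\<^esub> = \<zero>\<^bsub>Alg\<^esub>"
      by (simp add: Alg_simps)
    then show False
      using nonzero A.one_zeroD by blast
  qed
  fix H assume H: "hered_sat G H"
  obtain J where J: "ideal J Alg" "\<forall>v\<in>verts G. wlpa_vertex Kt G (\<lambda>_. 1) v \<in> J \<longleftrightarrow> v \<in> H"
    using hered_sat_ideal[OF H] by blast
  have HG: "H \<subseteq> verts G"
    using H by (rule hered_satD)
  show "H = {} \<or> H = verts G"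
  proof (rule disjCI)
    assume "H \<noteq> verts G"
    then obtain u where u: "u \<in> verts G" "u \<notin> H"
      using HG by blast
    show "H = {}"
    proof (rule ccontr)
      assume "H \<noteq> {}"
      then obtain v where v: "v \<in> H"
        by blast
      then have "J = carrier Alg"
        using ideals[OF J(1), of v] J(2) HG by blast
      then show False
        using J(2) u wlpa_vertex(1) by blast
    qed
  qed
qed

lemma hered_sat_trivial_if_simple:
  assumes "simple_ring Alg"
  shows "hered_sat_trivial G"
proof (rule hered_sat_trivialI)
  fix J v assume J: "ideal J Alg" "v \<in> verts G" "wlpa_vertex Kt G (\<lambda>_. 1) v \<in> J"
  have "wlpa_vertex Kt G (\<lambda>_. 1) v \<noteq> \<zero>\<^bsub>Alg\<^esub>"
    using wlpa_vertex(2)[OF J(2)] vertex_nonzero[OF J(2)] emb_simps(4) by auto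
  then show "J = carrier Alg"
    using assms J unfolding simple_ring_def by blast
qed (use assms in \<open>simp add: simple_ring_def\<close>)

text \<open>The matrix algebra has many proper ideals, but none contains a vertex: vertices are
  nonzero idempotents, and these generate everything.\<close>

lemma hered_sat_trivial_if_matrix_algebra:
  assumes n: "n \<ge> 1" and iso: "alg_isomorphic Alg (laurent_matrix_alg n)"
  shows "hered_sat_trivial G"
proof -
  interpret A: ring Alg
    by (rule ring_Alg)
  obtain h :: "_ \<Rightarrow> (int \<Rightarrow>\<^sub>0 'k) mat" where h: "h \<in> ring_iso Alg (laurent_matrix_alg n)"
    using iso by (auto simp: alg_isomorphic_def)
  have bij: "bij_betw h (carrier Alg) (carrier_mat n n)"
    and hmult: "\<And>a b. a \<in> carrier Alg \<Longrightarrow> b \<in> carrier Alg \<Longrightarrow> h (a \<otimes>\<^bsub>Alg\<^esub> b) = h a * h b"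
    and hadd: "\<And>a b. a \<in> carrier Alg \<Longrightarrow> b \<in> carrier Alg \<Longrightarrow> h (a \<oplus>\<^bsub>Alg\<^esub> b) = h a + h b"
    and hone: "h \<one>\<^bsub>Alg\<^esub> = 1\<^sub>m n"
    using h by (auto simp: ring_iso_def Ring.ring_hom_def laurent_matrix_alg_def)
  have hC: "h a \<in> carrier_mat n n" if "a \<in> carrier Alg" for a
    using bij_betwE[OF bij] that by blast
  have inj: "h a = h b \<longleftrightarrow> a = b" if "a \<in> carrier Alg" "b \<in> carrier Alg" for a b
    using bij_betw_imp_inj_on[OF bij] that by (simp add: inj_on_eq_iff)
  \<comment> \<open>\<open>ring_iso\<close> speaks of sums, products and the unit; preservation of
    zero comes from cancelling in \<open>0 = 0 + 0\<close> entry by entry.\<close>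
  have hzero: "h \<zero>\<^bsub>Alg\<^esub> = 0\<^sub>m n n"
  proof -
    let ?Z = "h \<zero>\<^bsub>Alg\<^esub>"
    have Z: "?Z = ?Z + ?Z" and ZC: "?Z \<in> carrier_mat n n"
      using hadd[of "\<zero>\<^bsub>Alg\<^esub>" "\<zero>\<^bsub>Alg\<^esub>"] hC by simp_all
    have "?Z $$ (i, j) = 0" if ij: "i < n" "j < n" for i j
    proof -
      have "?Z $$ (i, j) = (?Z + ?Z) $$ (i, j)"
        using Z by simp
      also have "\<dots> = ?Z $$ (i, j) + ?Z $$ (i, j)"
        using ij ZC by simp
      finally show ?thesis
        by (simp only: add_cancel_right_right)
    qed
    then show ?thesis
      using ZC by (intro eq_matI) auto
  qed
  show ?thesis
  proof (rule hered_sat_trivialI)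
    show "carrier Alg \<noteq> {\<zero>\<^bsub>Alg\<^esub>}"
    proof
      assume "carrier Alg = {\<zero>\<^bsub>Alg\<^esub>}"
      then have "\<one>\<^bsub>Alg\<^esub> = \<zero>\<^bsub>Alg\<^esub>"
        using A.one_closed by blast
      then have "(1\<^sub>m n :: (int \<Rightarrow>\<^sub>0 'k) mat) $$ (0, 0) = 0\<^sub>m n n $$ (0, 0)"
        using hone hzero by simp
      then show False
        using n by simp
    qed
    fix J v assume J: "ideal J Alg" and v: "v \<in> verts G" "wlpa_vertex Kt G (\<lambda>_. 1) v \<in> J"
    interpret J: ideal J Alg
      by (rule J)
    have JC: "a \<in> carrier Alg" if "a \<in> J" for a
      using that J.a_subset by blast
    let ?v = "wlpa_vertex Kt G (\<lambda>_. 1) v"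
    have vC: "?v \<in> carrier Alg"
      using v(1) by (rule wlpa_vertex)
    have "1\<^sub>m n \<in> h ` J"
    proof (rule idempotent_matrix_ideal)
      fix P Q assume "P \<in> h ` J" "Q \<in> h ` J"
      then obtain a b where "a \<in> J" "b \<in> J" "P = h a" "Q = h b"
        by blast
      then have "P + Q = h (a \<oplus>\<^bsub>Alg\<^esub> b)" "a \<oplus>\<^bsub>Alg\<^esub> b \<in> J"
        using JC J.a_closed by (simp_all add: hadd)
      then show "P + Q \<in> h ` J"
        by blast
    next
      fix P Q :: "(int \<Rightarrow>\<^sub>0 'k) mat" assume "P \<in> h ` J" "Q \<in> carrier_mat n n"
      then obtain a b where ab: "a \<in> J" "b \<in> carrier Alg" "P = h a" "Q = h b"
        using bij_betw_imp_surj_on[OF bij] by blast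
      then have "P * Q = h (a \<otimes>\<^bsub>Alg\<^esub> b)" "Q * P = h (b \<otimes>\<^bsub>Alg\<^esub> a)"
        using JC by (simp_all add: hmult)
      then show "P * Q \<in> h ` J \<and> Q * P \<in> h ` J"
        using J.I_r_closed[OF ab(1,2)] J.I_l_closed[OF ab(1,2)] by blast
    next
      show "h ` J \<subseteq> carrier_mat n n"
        using JC hC by blast
      show "h ?v \<in> h ` J"
        using v(2) by (rule imageI)
      have "?v \<otimes>\<^bsub>Alg\<^esub> ?v = ?v"
        using emb_eq_iff[of "?v \<otimes>\<^bsub>Alg\<^esub> ?v" ?v] vC VV[OF v(1) v(1)] by (simp add: emb_simps wlpa_vertex v(1))
      then show "h ?v * h ?v = h ?v"
        using hmult[OF vC vC] by simp
      have "?v \<noteq> \<zero>\<^bsub>Alg\<^esub>"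
        using wlpa_vertex(2)[OF v(1)] vertex_nonzero[OF v(1)] emb_simps(4) by auto
      then show "h ?v \<noteq> 0\<^sub>m n n"
        using inj[OF vC A.zero_closed] hzero by simp
    qed
    then obtain a where "a \<in> J" "h a = h \<one>\<^bsub>Alg\<^esub>"
      using hone by auto
    then have "\<one>\<^bsub>Alg\<^esub> \<in> J"
      using inj[OF JC A.one_closed] by blast
    then show "J = carrier Alg"
      by (rule J.one_imp_carrier)
  qed
qed

theorem hered_sat_trivial_iff:
  "hered_sat_trivial G \<longleftrightarrow>
    (\<exists>n\<ge>1. alg_isomorphic (lpa Kt G) (laurent_matrix_alg n)) \<or> purely_infinite_simple (lpa Kt G)"
  unfolding lpa_def
proof
  assume trivial: "hered_sat_trivial G"
  show "(\<exists>n\<ge>1. alg_isomorphic Alg (laurent_matrix_alg n)) \<or> purely_infinite_simple Alg"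
  proof (cases "\<forall>x c. awalk x c x \<longrightarrow> c \<noteq> [] \<longrightarrow> \<not> exit_free G c")
    case True
    then show ?thesis
      using purely_infinite_if_exits[OF trivial] by simp
  next
    case False
    from matrix_algebra_if_exit_free[OF trivial this] show ?thesis
      by (rule disjI1)
  qed
next
  assume "(\<exists>n\<ge>1. alg_isomorphic Alg (laurent_matrix_alg n)) \<or> purely_infinite_simple Alg"
  then show "hered_sat_trivial G"
    using hered_sat_trivial_if_matrix_algebra hered_sat_trivial_if_simple
    unfolding purely_infinite_simple_def by blast
qed

end

section \<open>The three conditions\<close>

theorem theorem4p12:
  fixes E :: "('v, 'e) pre_digraph" and s :: 'v
  assumes "sandpile_graph E s"
  shows "(card (idempotents (SP E s)) = 2 \<longleftrightarrow>
            (\<exists>n\<ge>1. alg_isomorphic (lpa TYPE('k::field) (quotient_graph E (no_cycle_verts E)))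
                                  (laurent_matrix_alg n)) \<or>
            purely_infinite_simple (lpa TYPE('k) (quotient_graph E (no_cycle_verts E))))
       \<and> (card (idempotents (SP E s)) = 2 \<longleftrightarrow>
            vertex_simple TYPE('k) (quotient_graph E (no_cycle_verts E))
              (restrict (balanced_weight E) (arcs (quotient_graph E (no_cycle_verts E)))))"
proof -
  interpret E: sandpile_graph E s
    by fact
  let ?F = "quotient_graph E (no_cycle_verts E)"
  let ?w = "restrict (balanced_weight E) (arcs ?F)"
  let ?el = "alg_elem (lpa_gens ?F ?w) (lpa_rels ?F ?w) :: _ \<Rightarrow> (('v, 'e) lpa_gen fword \<Rightarrow>\<^sub>0 'k) ideal_quotients"
  have fin: "fin_digraph ?F"
    by (rule fin_digraph_quotient_graph) (rule E.fin_digraph_axioms)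
  have "hered_sat_trivial ?F \<longleftrightarrow>
      (\<exists>n\<ge>1. alg_isomorphic (lpa TYPE('k) ?F) (laurent_matrix_alg n)) \<or> purely_infinite_simple (lpa TYPE('k) ?F)"
    by (intro sinkless_lpa.hered_sat_trivial_iff sinkless_lpa.intro sinkless_lpa_axioms.intro fin E.sinks_cyc_part)
  moreover have "vertex_simple TYPE('k) ?F ?w \<longleftrightarrow> hered_sat_trivial ?F"
  proof (rule lpa_model.vertex_simple_iff)
    \<comment> \<open>The weight of an edge is the outdegree of its source in \<open>E\<close>, even
      where the quotient graph has fewer edges; hence \<open>N\<close> counts edges of
      \<open>E\<close>.\<close>
    have weight: "?w e = card (out_arcs E (tail ?F e))" "card (out_arcs E (tail ?F e)) > 0" if "e \<in> arcs ?F" for e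
    proof -
      have "e \<in> out_arcs E (tail E e)"
        using that by (simp add: E.cyc_part_simps)
      then show "card (out_arcs E (tail ?F e)) > 0"
        unfolding E.cyc_part_simps(3) using E.finite_out_arcs card_gt_0_iff by blast
      show "?w e = card (out_arcs E (tail ?F e))"
        using that by (simp add: balanced_weight_def E.cyc_part_simps(3))
    qed
    show "lpa_model ?F (\<lambda>v. card (out_arcs E v)) ?w (\<lambda>e i. ?el (ed ?w e i)) (\<lambda>e i. ?el (gh ?w e i))"
      by (intro lpa_model.intro balanced_graph.intro balanced_graph_axioms.intro lpa_model_axioms.intro
          fin weight E.sinks_cyc_part HOL.refl)
  qed
  ultimately show ?thesis
    using E.two_idempotents_iff by simp
qed

end
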